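(* Let $n\in\mathbb{N}$, $R_0>0$ and $\mathcal{B}=B_{R_0}(0)\subset\mathbb{R}^2$. Suppose that the configuration $\big((a_i)_{i=1}^n,(v_i)_{i=1}^n\big)$ is attainable, with $\lambda>1$ given by $\sum_i v_i=(\lambda^2-1)\pi R_0^2$ and with evolutions $z_i$, $L_i$ on $[1,\lambda]$ of centers and radii as in the definition of attainability. Let $R_1,\dots,R_n$ be any positive numbers such that, with $r_i(t):=\sqrt{L_i(t)^2+R_i^2}$, at all times $t\in[1,\lambda]$ the disks $\overline{B}_{r_i(t)}(z_i(t))$, $i=1,\dots,n$, are disjoint and contained in $B_{tR_0}(0)$. Let $E(t):=B_{tR_0}(0)\setminus\bigcup_{i=1}^n\overline{B}_{r_i(t)}(z_i(t))$. Then the velocity fields $v(\cdot,t)=D\phi_t+D^\perp\psi_t$ (constructed in the context) satisfy $$\mathrm{div}\,v(y,t)=0\quad\text{for all }t\in[1,\lambda],\ y\in E(t),$$ $$v\big(z_i(t)+r_i(t)e^{i\theta},t\big)=\frac{dr_i}{dt}(t)\,e^{i\theta}\quad\text{for all }t\in[1,\lambda],\ i\in\{1,\dots,n\},\ \theta\in[0,2\pi],$$ and $$\sup_{t\in[1,\lambda]}\|Dv(\cdot,t)\|_{L^\infty(E(t))}<\infty.$$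
   Context: $B_r(x)$ is the open disk of radius $r$ centred at $x\in\mathbb{R}^2$. $\mathbb{R}^2$ is identified with $\mathbb{C}$ in writing $e^{i\theta}=(\cos\theta,\sin\theta)$ (the $i$ in the exponent is the imaginary unit). Attainable configuration. The pair $\big((a_i)_{i=1}^n,(v_i)_{i=1}^n\big)$ is an attainable configuration (through an evolution of circular cavities) if $a_i\in\mathcal{B}$ and $v_i>0$ for all $i$ and, with $\lambda>1$ given by $\sum_i v_i=(\lambda^2-1)\pi R_0^2$, there exist $z_i\in C^1([1,\lambda],\mathbb{R}^2)$ and $L_i:[1,\lambda]\to[0,\infty)$, $i=1,\dots,n$, such that $\sum_{i=1}^n\pi L_i^2(t)=(t^2-1)\pi R_0^2$ for all $t\in[1,\lambda]$ and, for each $i$: (i) $L_i^2\in C^1([1,\lambda],[0,\infty))$; (ii) $z_i(1)=a_i$ and $L_i(1)=0$; (iii) $\pi L_i^2(\lambda)=v_i$; (iv) for all $t\in[1,\lambda]$ the disks $\overline{B}_{L_i(t)}(z_i(t))$, $i=1,\dots,n$, are disjoint and contained in $B_{tR_0}(0)$. Construction of $v$. Put $z_0(t):=0$, $r_0(t):=tR_0$, so $\partial E(t)=\bigcup_{i=0}^n\partial B_{r_i(t)}(z_i(t))$. Fix $d>0$ such that for all $t\in[1,\lambda]$: $r_i(t)\ge d$ for $i=1,\dots,n$, and the disks $\overline{B}_{r_i(t)+d}(z_i(t))$, $i=1,\dots,n$, are disjoint and contained in $B_{r_0(t)-d}(0)$ (such $d$ exists by continuity). On each component $\partial B_{r_i(t)}(z_i(t))$,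 $i=0,\dots,n$, let $\nu$ be the radial unit normal $\nu(z_i(t)+r_i(t)e^{i\theta})=e^{i\theta}$ and $\tau=ie^{i\theta}$ the counterclockwise unit tangent. For each $t\in[1,\lambda]$: - $\phi_t$ is the unique solution of $\Delta\phi_t=0$ in $E(t)$, $\frac{\partial\phi_t}{\partial\nu}(z_i(t)+r_i(t)e^{i\theta})=\frac{dr_i(t)}{dt}$ on $\partial E(t)$ ($i=0,\dots,n$), $\int_{E(t)}\phi_t=0$; - $\varphi_t$ is the unique solution of $\Delta\varphi_t=0$ in $E(t)$, $\frac{\partial\varphi_t}{\partial\nu}=\frac{\partial\phi_t}{\partial\tau}$ on $\partial E(t)$, $\int_{E(t)}\varphi_t=0$; - $q_t(y):=z_i(t)+r_i(t)\frac{y-z_i(t)}{|y-z_i(t)|}$ if $|y-z_i(t)|<r_i(t)+\frac d2$ ($1\le i\le n$), and $q_t(y):=r_0(t)\frac{y}{|y|}$ if $|y|>r_0(t)-\frac d2$; - $\zeta:[0,\infty)\to[0,1]$ is a fixed smooth cutoff function with $\zeta(0)=1$, $\zeta'(0)=0$ and $\zeta=0$ on $[1,\infty)$; - $\psi_t(y):=\varphi_t(y)-\zeta\Big(\frac{\mathrm{dist}(y,\partial E(t))}{d/2}\Big)\varphi_t(q_t(y))$ (the second term being $0$ where $\zeta$ vanishes); - $v(y,t):=D\phi_t(y)+D^\perp\psi_t(y)$, where $D^\perp\psi:=(\partial_2\psi,-\partial_1\psi)$. The values of $v(\cdot,t)$ on $\partial E(t)$ are understood as the continuous extension from $E(t)$.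 *)

theory Defs
  imports "HOL-Analysis.Analysis" "HOL-Probability.Essential_Supremum"
begin

text \<open>
  The plane is the type \<^typ>\<open>complex\<close> throughout, so a scalar function has type
  \<^typ>\<open>complex \<Rightarrow> real\<close>, a vector field has type \<^typ>\<open>complex \<Rightarrow> complex\<close>, and \<^term>\<open>cis \<theta>\<close> is the
  point with coordinates cos and sin of the angle. Euclidean inner product is \<^term>\<open>inner\<close>.
\<close>

subsection \<open>Differential operators in the plane\<close>

definition grad :: "(complex \<Rightarrow> real) \<Rightarrow> complex \<Rightarrow> complex" where
  "grad f y = Complex (frechet_derivative f (at y) 1) (frechet_derivative f (at y) \<i>)"

definition perp_grad :: "(complex \<Rightarrow> real) \<Rightarrow> complex \<Rightarrow> complex" where
  "perp_grad f y = Complex (frechet_derivative f (at y) \<i>) (- frechet_derivative f (at y) 1)"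

definition divergence :: "(complex \<Rightarrow> complex) \<Rightarrow> complex \<Rightarrow> real" where
  "divergence w y = Re (frechet_derivative w (at y) 1) + Im (frechet_derivative w (at y) \<i>)"

definition laplacian :: "(complex \<Rightarrow> real) \<Rightarrow> complex \<Rightarrow> real" where
  "laplacian f y = divergence (grad f) y"

subsection \<open>Regularity classes\<close>

text \<open>Derivatives are taken within the set, hence one-sided at the endpoints of an interval; the
  library predicate \<^const>\<open>C1_differentiable_on\<close> uses two-sided derivatives, which would constrain
  the values of a function outside its interval of definition.\<close>

definition C1_within :: "real set \<Rightarrow> (real \<Rightarrow> 'a::real_normed_vector) \<Rightarrow> bool" where
  "C1_within T f \<longleftrightarrow>
     (\<exists>f'. (\<forall>t\<in>T. (f has_vector_derivative f' t) (at t within T)) \<and> continuous_on T f')"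

definition smooth_within :: "real set \<Rightarrow> (real \<Rightarrow> real) \<Rightarrow> bool" where
  "smooth_within T f \<longleftrightarrow>
     (\<exists>D :: nat \<Rightarrow> real \<Rightarrow> real. D 0 = f \<and>
        (\<forall>k. \<forall>x\<in>T. (D k has_real_derivative D (Suc k) x) (at x within T)))"

definition C2_on :: "complex set \<Rightarrow> (complex \<Rightarrow> real) \<Rightarrow> bool" where
  "C2_on S f \<longleftrightarrow>
     (\<forall>y\<in>S. f differentiable (at y)) \<and> (\<forall>y\<in>S. grad f differentiable (at y)) \<and>
     (\<forall>e. continuous_on S (\<lambda>y. frechet_derivative (grad f) (at y) e))"

text \<open>Class C1 up to the boundary of an open set: function and gradient extend continuously to the
  closure. The boundary values of \<^term>\<open>f\<close> itself are the values that \<^term>\<open>f\<close> takes there.\<close>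

definition C1_closure :: "complex set \<Rightarrow> (complex \<Rightarrow> real) \<Rightarrow> bool" where
  "C1_closure S f \<longleftrightarrow>
     continuous_on (closure S) f \<and> (\<forall>y\<in>S. f differentiable (at y)) \<and>
     (\<exists>G. continuous_on (closure S) G \<and> (\<forall>y\<in>S. G y = grad f y))"

text \<open>Derivative in direction \<^term>\<open>e\<close> at a boundary point of \<^term>\<open>S\<close>, through the continuous
  extension of the gradient from \<^term>\<open>S\<close>.\<close>

definition bdry_deriv :: "complex set \<Rightarrow> (complex \<Rightarrow> real) \<Rightarrow> complex \<Rightarrow> complex \<Rightarrow> real" where
  "bdry_deriv S f e y = inner (Lim (at y within S) (grad f)) e"

subsection \<open>Attainable configurations\<close>

definition attainable_evolution ::
  "real \<Rightarrow> nat \<Rightarrow> (nat \<Rightarrow> complex) \<Rightarrow> (nat \<Rightarrow> real) \<Rightarrow>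
   real \<Rightarrow> (nat \<Rightarrow> real \<Rightarrow> complex) \<Rightarrow> (nat \<Rightarrow> real \<Rightarrow> real) \<Rightarrow> bool" where
  "attainable_evolution R0 n a V lam z L \<longleftrightarrow>
     (\<forall>i\<in>{1..n}. a i \<in> ball 0 R0 \<and> V i > 0) \<and>
     lam > 1 \<and> (\<Sum>i=1..n. V i) = (lam\<^sup>2 - 1) * pi * R0\<^sup>2 \<and>
     (\<forall>i\<in>{1..n}. C1_within {1..lam} (z i)) \<and>
     (\<forall>i\<in>{1..n}. \<forall>t\<in>{1..lam}. L i t \<ge> 0) \<and>
     (\<forall>t\<in>{1..lam}. (\<Sum>i=1..n. pi * (L i t)\<^sup>2) = (t\<^sup>2 - 1) * pi * R0\<^sup>2) \<and>
     (\<forall>i\<in>{1..n}. C1_within {1..lam} (\<lambda>t. (L i t)\<^sup>2)) \<and>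
     (\<forall>i\<in>{1..n}. z i 1 = a i \<and> L i 1 = 0) \<and>
     (\<forall>i\<in>{1..n}. pi * (L i lam)\<^sup>2 = V i) \<and>
     (\<forall>t\<in>{1..lam}. disjoint_family_on (\<lambda>i. cball (z i t) (L i t)) {1..n} \<and>
        (\<forall>i\<in>{1..n}. cball (z i t) (L i t) \<subseteq> ball 0 (t * R0)))"

definition attainable :: "real \<Rightarrow> nat \<Rightarrow> (nat \<Rightarrow> complex) \<Rightarrow> (nat \<Rightarrow> real) \<Rightarrow> bool" where
  "attainable R0 n a V \<longleftrightarrow> (\<exists>lam z L. attainable_evolution R0 n a V lam z L)"

subsection \<open>Circular domains and the velocity field\<close>

text \<open>Index 0 is the outer circle, indices \<open>1..n\<close> are the cavities.\<close>

definition centres :: "(nat \<Rightarrow> real \<Rightarrow> complex) \<Rightarrow> real \<Rightarrow> nat \<Rightarrow> complex" where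
  "centres z t i = (if i = 0 then 0 else z i t)"

definition radii ::
  "real \<Rightarrow> (nat \<Rightarrow> real) \<Rightarrow> (nat \<Rightarrow> real \<Rightarrow> real) \<Rightarrow> real \<Rightarrow> nat \<Rightarrow> real" where
  "radii R0 R L t i = (if i = 0 then t * R0 else sqrt ((L i t)\<^sup>2 + (R i)\<^sup>2))"

definition circular_domain ::
  "nat \<Rightarrow> (nat \<Rightarrow> complex) \<Rightarrow> (nat \<Rightarrow> real) \<Rightarrow> complex set" where
  "circular_domain n c \<rho> = ball (c 0) (\<rho> 0) - (\<Union>i\<in>{1..n}. cball (c i) (\<rho> i))"

text \<open>Classical solutions with mean zero. The datum \<^term>\<open>g i \<theta>\<close> is prescribed for the derivative in the
  radial direction \<^term>\<open>cis \<theta>\<close> on every circle, so on the cavities the normal points into the domain.\<close>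

definition neumann_solution ::
  "nat \<Rightarrow> (nat \<Rightarrow> complex) \<Rightarrow> (nat \<Rightarrow> real) \<Rightarrow> (nat \<Rightarrow> real \<Rightarrow> real) \<Rightarrow> (complex \<Rightarrow> real) \<Rightarrow> bool" where
  "neumann_solution n c \<rho> g f \<longleftrightarrow>
     (let E = circular_domain n c \<rho> in
        C2_on E f \<and> C1_closure E f \<and>
        (\<forall>y\<in>E. laplacian f y = 0) \<and>
        (\<forall>i\<in>{0..n}. \<forall>\<theta>. bdry_deriv E f (cis \<theta>) (c i + of_real (\<rho> i) * cis \<theta>) = g i \<theta>) \<and>
        (f has_integral 0) E)"

definition circle_proj ::
  "nat \<Rightarrow> (nat \<Rightarrow> complex) \<Rightarrow> (nat \<Rightarrow> real) \<Rightarrow> real \<Rightarrow> complex \<Rightarrow> complex" where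
  "circle_proj n c \<rho> d y =
     (if \<exists>i\<in>{1..n}. cmod (y - c i) < \<rho> i + d / 2
      then let i = (THE i. i \<in> {1..n} \<and> cmod (y - c i) < \<rho> i + d / 2)
           in c i + of_real (\<rho> i) * ((y - c i) / of_real (cmod (y - c i)))
      else if cmod y > \<rho> 0 - d / 2 then of_real (\<rho> 0) * (y / of_real (cmod y))
      else undefined)"

text \<open>Inside the domain, where \<^const>\<open>circle_proj\<close> is \<^const>\<open>undefined\<close> the cutoff factor vanishes.\<close>

definition stream_fun ::
  "nat \<Rightarrow> (nat \<Rightarrow> complex) \<Rightarrow> (nat \<Rightarrow> real) \<Rightarrow> real \<Rightarrow> (real \<Rightarrow> real) \<Rightarrow> (complex \<Rightarrow> real) \<Rightarrow>
   complex \<Rightarrow> real" where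
  "stream_fun n c \<rho> d \<zeta> f y =
     f y - \<zeta> (infdist y (frontier (circular_domain n c \<rho>)) / (d / 2)) * f (circle_proj n c \<rho> d y)"

end

theory Submission
  imports Defs "HOL-Complex_Analysis.Great_Picard"
begin

text \<open>
  At a fixed time write \<open>F = \<phi>\<^sub>x - i \<phi>\<^sub>y\<close> and \<open>H = \<varphi>\<^sub>x - i \<varphi>\<^sub>y\<close> for the complex gradients of the two potentials
  (\<open>\<varphi>\<close> is the second one, from which the stream function \<open>\<psi>\<close> is made). Both are holomorphic in the circular
  domain, and on the circle with centre \<open>c\<close> the two Neumann conditions read
  \<open>Re ((y - c) F) = r r'\<close> and \<open>Re ((y - c) H) = Re (i (y - c) F)\<close>. So both have the form
  \<open>Re ((y - c) (F - h)) = 0\<close> with \<open>h\<close> holomorphic in a full annulus around the circle: \<open>h = r r' / (y - c)\<close>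
  for \<open>F\<close>, and \<open>h = i F\<close> for \<open>H\<close> as soon as \<open>F\<close> is extended. By the Schwarz reflection principle
  such a function extends across the circle to an annulus of definite width, with a bound that is a multiple of
  the bounds of the function and of \<open>h\<close> (\<open>domain_extension\<close>). Cauchy's inequality then bounds
  the second derivatives of the potentials up to the boundary by the sup norms of \<open>F\<close> and \<open>H\<close>.

  A bound for these sup norms that is uniform in time comes from compactness
  (\<open>uniform_gradient_bound\<close>). If they were unbounded along a sequence of times, then after
  normalisation the reflected functions would form a normal family on a neighbourhood of the limiting domain, and
  a limit would be a nonzero holomorphic \<open>g\<close> with a single-valued potential and with
  \<open>Re ((y - c) g) = 0\<close> on all circles. The potential attains its supremum on the closed domain; after
  reflection every boundary point is an interior point, so the open mapping theorem forces \<open>g = 0\<close>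
  (\<open>homogeneous_neumann_zero\<close>). That potentials converge, and that the domain is connected,
  both follow from one estimate: the oscillation of a potential is at most a constant times the supremum of its
  gradient (\<open>oscillation_bound\<close>). The same estimate, with the normalisation by mean zero,
  bounds \<open>\<varphi>\<close> itself.

  Near a circle the subtracted term of \<open>\<psi>\<close> is a cutoff of the distance times the boundary values
  of \<open>\<varphi>\<close>, continued radially. Those boundary values are smooth along the circle with derivative
  \<open>- Im ((y - c) H)\<close>, and this gives an explicit formula for the gradient of \<open>\<psi>\<close>, hence
  differentiability, a bound for the second derivatives, and the boundary values of the velocity. On the circle
  the radial derivative of \<open>\<varphi>\<close>, which \<open>\<psi>\<close> retains, cancels the tangential derivative of
  \<open>\<phi>\<close>, so that only \<open>r'\<close> times the normal remains. The divergence vanishes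
  because \<open>\<phi>\<close> is harmonic and because mixed second derivatives of \<open>\<psi>\<close> commute.
\<close>

section \<open>Gradients, harmonic functions and potentials\<close>

text \<open>
  The mean value theorem in the direction \<open>u\<close> turns the second difference into an increment of the
  derivative along \<open>u\<close> over the step \<open>h v\<close>, which is \<open>h A v\<close> up to the error of linearisation.
\<close>
lemma second_difference_bound:
  fixes f :: "complex \<Rightarrow> real"
  assumes h: "0 < h" and e: "0 \<le> e" and u: "norm u = 1" and v: "norm v = 1"
    and f: "\<And>k. norm k \<le> 2 * h \<Longrightarrow> (f has_derivative f' (y + k)) (at (y + k))"
    and lin: "linear A"
    and A: "\<And>k. norm k \<le> 2 * h \<Longrightarrow> \<bar>f' (y + k) u - f' y u - A k\<bar> \<le> e * norm k"
  shows "\<bar>f (y + h *\<^sub>R u + h *\<^sub>R v) - f (y + h *\<^sub>R u) - f (y + h *\<^sub>R v) + f y - h\<^sup>2 * A v\<bar>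
          \<le> 4 * e * h\<^sup>2"
proof -
  define g where "g s = f (y + (s *\<^sub>R u + h *\<^sub>R v)) - f (y + s *\<^sub>R u)" for s
  have bound: "norm (s *\<^sub>R u + h *\<^sub>R v) \<le> 2 * h" "norm (s *\<^sub>R u) \<le> 2 * h" "norm (s *\<^sub>R u) \<le> h"
    if "0 \<le> s" "s \<le> h" for s
    using that u v h norm_triangle_ineq[of "s *\<^sub>R u" "h *\<^sub>R v"] by auto
  have g': "(g has_derivative
        (\<lambda>k. f' (y + (s *\<^sub>R u + h *\<^sub>R v)) (k *\<^sub>R u) - f' (y + s *\<^sub>R u) (k *\<^sub>R u))) (at s)"
    if "0 \<le> s" "s \<le> h" for s
  proof -
    have 1: "((\<lambda>s. y + (s *\<^sub>R u + h *\<^sub>R v)) has_derivative (\<lambda>k. k *\<^sub>R u)) (at s)"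
      and 2: "((\<lambda>s. y + s *\<^sub>R u) has_derivative (\<lambda>k. k *\<^sub>R u)) (at s)"
      by (auto intro!: derivative_eq_intros)
    show ?thesis
      unfolding g_def
      using has_derivative_diff[OF has_derivative_compose[OF 1 f[OF bound(1)[OF that]]]
          has_derivative_compose[OF 2 f[OF bound(2)[OF that]]]] .
  qed
  have "\<exists>s\<in>{0<..<h}. g h - g 0 = (\<lambda>k. f' (y + (s *\<^sub>R u + h *\<^sub>R v)) (k *\<^sub>R u) - f' (y + s *\<^sub>R u) (k *\<^sub>R u)) (h - 0)"
    using h g' by (intro mvt_simple) (auto intro: has_derivative_at_withinI)
  then obtain s where s: "0 < s" "s < h"
    and gs: "g h - g 0 = f' (y + (s *\<^sub>R u + h *\<^sub>R v)) (h *\<^sub>R u) - f' (y + s *\<^sub>R u) (h *\<^sub>R u)"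
    by auto
  have lf: "linear (f' (y + k))" if "norm k \<le> 2 * h" for k
    using has_derivative_linear[OF f[OF that]] .
  define p where "p = f' (y + (s *\<^sub>R u + h *\<^sub>R v)) u"
  define q where "q = f' (y + s *\<^sub>R u) u"
  have ghg: "g h - g 0 = h * (p - q)"
    using gs linear_scale[OF lf[OF bound(1)], of s h u] linear_scale[OF lf[OF bound(2)], of s h u] s
    by (simp add: p_def q_def right_diff_distrib)
  have A1: "\<bar>p - f' y u - A (s *\<^sub>R u + h *\<^sub>R v)\<bar> \<le> e * (2 * h)"
    unfolding p_def using A[OF bound(1)] bound(1)[of s] s e
    by (meson less_imp_le mult_left_mono order_trans)
  have A2: "\<bar>q - f' y u - A (s *\<^sub>R u)\<bar> \<le> e * (2 * h)"
    unfolding q_def using A[OF bound(2)] bound(2)[of s] s e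
    by (meson less_imp_le mult_left_mono order_trans)
  have "A (s *\<^sub>R u + h *\<^sub>R v) - A (s *\<^sub>R u) = h * A v"
    using lin by (simp add: linear_add linear_scale)
  then have "\<bar>p - q - h * A v\<bar> \<le> 4 * e * h"
    using A1 A2 by linarith
  then have "h * \<bar>p - q - h * A v\<bar> \<le> h * (4 * e * h)"
    using h by (intro mult_left_mono) auto
  moreover have "h * \<bar>p - q - h * A v\<bar> = \<bar>g h - g 0 - h\<^sup>2 * A v\<bar>"
    using h unfolding ghg by (simp add: abs_mult_pos' power2_eq_square algebra_simps)
  ultimately show ?thesis
    by (simp add: g_def power2_eq_square algebra_simps)
qed

text \<open>
  Young's theorem: both mixed derivatives are approximated by the same second difference quotient.
\<close>
lemma mixed_derivatives_symmetric:
  fixes f :: "complex \<Rightarrow> real"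
  assumes S: "open S" "y \<in> S"
    and f: "\<And>x. x \<in> S \<Longrightarrow> (f has_derivative f' x) (at x)"
    and A: "((\<lambda>x. f' x u) has_derivative A) (at y)"
    and B: "((\<lambda>x. f' x v) has_derivative B) (at y)"
    and u: "norm u = 1" and v: "norm v = 1"
  shows "A v = B u"
proof -
  have "\<bar>A v - B u\<bar> \<le> 8 * e" if e: "e > 0" for e
  proof -
    obtain r where r: "r > 0" "ball y r \<subseteq> S" using S openE by blast
    obtain r1 where r1: "r1 > 0" "\<And>x. norm (x - y) < r1 \<Longrightarrow> norm (f' x u - f' y u - A (x - y)) \<le> e * norm (x - y)"
      using A[unfolded has_derivative_at_alt] e by blast
    obtain r2 where r2: "r2 > 0" "\<And>x. norm (x - y) < r2 \<Longrightarrow> norm (f' x v - f' y v - B (x - y)) \<le> e * norm (x - y)"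
      using B[unfolded has_derivative_at_alt] e by blast
    define h where "h = min r (min r1 r2) / 3"
    have h: "h > 0" "2 * h < r" "2 * h < r1" "2 * h < r2" using r r1 r2 by (auto simp: h_def)
    have d: "(f has_derivative f' (y + k)) (at (y + k))" if "norm k \<le> 2 * h" for k
      using that h r by (intro f) (auto simp: dist_norm)
    have 1: "\<bar>f (y + h *\<^sub>R u + h *\<^sub>R v) - f (y + h *\<^sub>R u) - f (y + h *\<^sub>R v) + f y - h\<^sup>2 * A v\<bar> \<le> 4 * e * h\<^sup>2"
      by (rule second_difference_bound[where f' = f'])
         (use h e u v d r1(2)[of "y + _"] has_derivative_linear[OF A] in auto)
    have 2: "\<bar>f (y + h *\<^sub>R v + h *\<^sub>R u) - f (y + h *\<^sub>R v) - f (y + h *\<^sub>R u) + f y - h\<^sup>2 * B u\<bar> \<le> 4 * e * h\<^sup>2"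
      by (rule second_difference_bound[where f' = f'])
         (use h e u v d r2(2)[of "y + _"] has_derivative_linear[OF B] in auto)
    have "y + h *\<^sub>R v + h *\<^sub>R u = y + h *\<^sub>R u + h *\<^sub>R v" by simp
    then have "\<bar>h\<^sup>2 * A v - h\<^sup>2 * B u\<bar> \<le> 8 * e * h\<^sup>2"
      using 1 2[unfolded \<open>y + h *\<^sub>R v + h *\<^sub>R u = _\<close>] by linarith
    moreover have "\<bar>h\<^sup>2 * A v - h\<^sup>2 * B u\<bar> = h\<^sup>2 * \<bar>A v - B u\<bar>"
      by (simp add: right_diff_distrib[symmetric] abs_mult)
    ultimately have "h\<^sup>2 * \<bar>A v - B u\<bar> \<le> h\<^sup>2 * (8 * e)"
      by (simp add: mult.commute)
    then show ?thesis using h by simp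
  qed
  from this[of "\<bar>A v - B u\<bar> / 16"] show ?thesis by fastforce
qed

lemma has_derivative_grad:
  assumes "f differentiable (at y)"
  shows "(f has_derivative (\<lambda>h. Re (cnj (grad f y) * h))) (at y)"
proof -
  have D: "(f has_derivative frechet_derivative f (at y)) (at y)"
    using assms frechet_derivative_works by blast
  then have "linear (frechet_derivative f (at y))" by (rule has_derivative_linear)
  then have "frechet_derivative f (at y) h = Re (cnj (grad f y) * h)" for h
    using linear_add[of "frechet_derivative f (at y)" "Re h *\<^sub>R 1" "Im h *\<^sub>R \<i>"]
      linear_scale[of "frechet_derivative f (at y)" "Re h" 1]
      linear_scale[of "frechet_derivative f (at y)" "Im h" \<i>]
    by (simp add: grad_def scaleR_conv_of_real complex_eq[symmetric] mult.commute)
  with D show ?thesis by (metis (no_types, lifting) ext)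
qed

lemma grad_eqI:
  assumes "(f has_derivative (\<lambda>h. Re (cnj g * h))) (at y)"
  shows "grad f y = g"
  unfolding grad_def frechet_derivative_at[OF assms, symmetric] by (simp add: complex_eq_iff)

lemma perp_grad_eq: "perp_grad f y = - \<i> * grad f y"
  by (simp add: perp_grad_def grad_def complex_eq_iff)

lemma mixed_derivatives_grad:
  assumes S: "open S" "y \<in> S" and f: "\<And>x. x \<in> S \<Longrightarrow> f differentiable (at x)"
    and g: "(grad f has_derivative A) (at y)"
  shows "Re (A \<i>) = Im (A 1)"
proof -
  have "((\<lambda>x. Re (cnj (grad f x) * u)) has_derivative (\<lambda>h. Re (cnj (A h) * u))) (at y)" for u
    by (auto intro!: derivative_eq_intros g simp: scaleR_conv_of_real)
  from mixed_derivatives_symmetric[OF S has_derivative_grad[OF f] this[of 1] this[of \<i>]]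
  show ?thesis by simp
qed

lemma divergence_perp_grad:
  assumes S: "open S" "y \<in> S" and f: "\<And>x. x \<in> S \<Longrightarrow> f differentiable (at x)"
    and g: "(grad f has_derivative A) (at y)"
  shows "divergence (perp_grad f) y = 0"
proof -
  have "perp_grad f = (\<lambda>x. - \<i> * grad f x)" by (simp add: fun_eq_iff perp_grad_eq)
  then have "(perp_grad f has_derivative (\<lambda>h. - \<i> * A h)) (at y)"
    by (auto intro!: derivative_eq_intros g)
  then show ?thesis
    using mixed_derivatives_grad[OF S f g]
    unfolding divergence_def by (subst (1 2) frechet_derivative_at[symmetric]) auto
qed

text \<open>
  The Cauchy-Riemann equations of \<open>f\<^sub>x - i f\<^sub>y\<close> are the Laplace equation and the symmetry of the mixed
  derivatives.
\<close>
lemma holomorphic_cnj_grad: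
  assumes S: "open S" and f: "\<And>x. x \<in> S \<Longrightarrow> f differentiable (at x)"
    and g: "\<And>x. x \<in> S \<Longrightarrow> grad f differentiable (at x)"
    and harm: "\<And>x. x \<in> S \<Longrightarrow> laplacian f x = 0"
  shows "(\<lambda>y. cnj (grad f y)) holomorphic_on S"
  unfolding holomorphic_on_open[OF S]
proof
  fix y assume y: "y \<in> S"
  obtain A where A: "(grad f has_derivative A) (at y)"
    using g[OF y] by (auto simp: differentiable_def)
  have lin: "linear A" using A has_derivative_linear by blast
  have 1: "Re (A \<i>) = Im (A 1)" by (rule mixed_derivatives_grad[OF S y f A])
  have 2: "Im (A \<i>) = - Re (A 1)"
    using harm[OF y] unfolding laplacian_def divergence_def frechet_derivative_at[OF A, symmetric]
    by simp
  have "cnj (A h) = cnj (A 1) * h" for h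
    using linear_add[OF lin, of "Re h *\<^sub>R 1" "Im h *\<^sub>R \<i>"]
      linear_scale[OF lin, of "Re h" 1] linear_scale[OF lin, of "Im h" \<i>] 1 2
    by (simp add: scaleR_conv_of_real complex_eq[symmetric] complex_eq_iff mult.commute)
  then have "(\<lambda>h. cnj (A h)) = (*) (cnj (A 1))" by (rule ext)
  with has_derivative_cnj[OF A] show "\<exists>f'. ((\<lambda>y. cnj (grad f y)) has_field_derivative f') (at y)"
    unfolding has_field_derivative_def by metis
qed

text \<open>
  Locally \<open>f\<close> is then the real part of a complex primitive of \<open>F\<close>; single-valuedness of \<open>f\<close> on
  all of \<open>S\<close> is the information that \<open>F\<close> alone does not carry.
\<close>
definition potential_on :: "complex set \<Rightarrow> (complex \<Rightarrow> real) \<Rightarrow> (complex \<Rightarrow> complex) \<Rightarrow> bool" where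
  "potential_on S f F \<longleftrightarrow> (\<forall>y\<in>S. (f has_derivative (\<lambda>h. Re (F y * h))) (at y))"

lemma potential_onD: "potential_on S f F \<Longrightarrow> y \<in> S \<Longrightarrow> (f has_derivative (\<lambda>h. Re (F y * h))) (at y)"
  by (auto simp: potential_on_def)

lemma potential_on_subset: "potential_on S f F \<Longrightarrow> T \<subseteq> S \<Longrightarrow> potential_on T f F"
  by (auto simp: potential_on_def)

lemma norm_Re_mult_le: "\<bar>Re (a * h)\<bar> \<le> cmod a * cmod h"
  by (metis abs_Re_le_cmod norm_mult)

lemma potential_continuous_on: "potential_on S f F \<Longrightarrow> continuous_on S f"
  unfolding potential_on_def
  by (meson continuous_at_imp_continuous_on has_derivative_continuous)

lemma potential_lipschitz:
  assumes "potential_on S f F" "convex S" "\<And>y. y \<in> S \<Longrightarrow> cmod (F y) \<le> M" "x \<in> S" "y \<in> S"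
  shows "\<bar>f x - f y\<bar> \<le> M * cmod (x - y)"
proof -
  have "norm (f x - f y) \<le> M * norm (x - y)"
  proof (rule differentiable_bound[OF assms(2) _ _ assms(4,5)])
    show "(f has_derivative (\<lambda>h. Re (F z * h))) (at z within S)" if "z \<in> S" for z
      using assms(1) that by (auto simp: potential_on_def intro: has_derivative_at_withinI)
    show "onorm (\<lambda>h. Re (F z * h)) \<le> M" if "z \<in> S" for z
    proof (rule onorm_le)
      fix h
      have "cmod (F z) * cmod h \<le> M * cmod h"
        using assms(3)[OF that] by (rule mult_right_mono) simp
      then show "norm (Re (F z * h)) \<le> M * norm h"
        using norm_Re_mult_le[of "F z" h] by simp
    qed
  qed
  then show ?thesis by simp
qed

lemma potential_on_diff:
  "potential_on S f F \<Longrightarrow> potential_on S g G \<Longrightarrow> potential_on S (\<lambda>y. f y - g y) (\<lambda>y. F y - G y)"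
  unfolding potential_on_def by (auto intro!: derivative_eq_intros simp: algebra_simps)

lemma potential_on_cmult:
  "potential_on S f F \<Longrightarrow> potential_on S (\<lambda>y. a * f y) (\<lambda>y. of_real a * F y)"
  unfolding potential_on_def by (auto intro!: derivative_eq_intros simp: algebra_simps)

lemma potential_on_Re_primitive:
  assumes "\<And>y. y \<in> S \<Longrightarrow> (Q has_field_derivative F y) (at y)"
  shows "potential_on S (\<lambda>y. Re (Q y)) F"
  unfolding potential_on_def
proof
  fix y assume "y \<in> S"
  from has_derivative_Re[OF assms[OF this, unfolded has_field_derivative_def]]
  show "((\<lambda>y. Re (Q y)) has_derivative (\<lambda>h. Re (F y * h))) (at y)" by simp
qed

lemma potential_unique:
  assumes "potential_on S f F" "potential_on S g F" "convex S"
  shows "\<exists>k. \<forall>y\<in>S. f y = g y + k"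
proof (cases "S = {}")
  case False
  then obtain z where z: "z \<in> S" by auto
  have "f y = g y + (f z - g z)" if "y \<in> S" for y
    using potential_lipschitz[OF potential_on_diff[OF assms(1,2)] assms(3) _ that z, of 0] by simp
  then show ?thesis by blast
qed auto

lemma primitive_convex:
  assumes "F holomorphic_on S" "convex S" "open S"
  obtains Q where "\<And>y. y \<in> S \<Longrightarrow> (Q has_field_derivative F y) (at y)" "potential_on S (\<lambda>y. Re (Q y)) F"
proof -
  obtain Q where "\<And>y. y \<in> S \<Longrightarrow> (Q has_field_derivative F y) (at y within S)"
    using holomorphic_convex_primitive'[OF assms(2,3,1)] by metis
  then have Q': "(Q has_field_derivative F y) (at y)" if "y \<in> S" for y
    using assms(3) that by (metis at_within_open)
  show ?thesis by (rule that[OF Q' potential_on_Re_primitive[OF Q']])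
qed

text \<open>
  A point where \<open>Re Q\<close> is maximal is mapped to a boundary point of the image, and the image is open unless
  \<open>Q\<close> is constant.
\<close>
lemma Re_max_imp_derivative_zero:
  assumes Q: "\<And>y. y \<in> S \<Longrightarrow> (Q has_field_derivative F y) (at y)"
    and S: "open S" "connected S" and p: "p \<in> S" and le: "\<And>y. y \<in> S \<Longrightarrow> Re (Q y) \<le> Re (Q p)"
    and y: "y \<in> S"
  shows "F y = 0"
proof -
  have hol: "Q holomorphic_on S"
    using Q S(1) holomorphic_on_open by blast
  have "Q constant_on S"
  proof (rule ccontr)
    assume "\<not> Q constant_on S"
    then have "open (Q ` S)" using open_mapping_thm[OF hol S S(1)] by blast
    then obtain e where e: "e > 0" "ball (Q p) e \<subseteq> Q ` S" using p openE by blast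
    have "Q p + of_real (e / 2) \<in> ball (Q p) e" using e by (simp add: dist_norm)
    then obtain x where "x \<in> S" "Q x = Q p + of_real (e / 2)" using e by auto
    then show False using le[of x] e by simp
  qed
  then obtain k where k: "\<And>x. x \<in> S \<Longrightarrow> Q x = k" by (auto simp: constant_on_def)
  have "(Q has_field_derivative 0) (at y)"
    by (rule has_field_derivative_transform_within_open[OF DERIV_const[of k] S(1) y]) (use k in auto)
  then show ?thesis using Q[OF y] DERIV_unique by blast
qed

section \<open>Circular domains and the oscillation of potentials\<close>

text \<open>
  The signed distance to a circle, positive on the side of the domain. The outer circle has index 0 and is approached
  from inside; with this sign convention it obeys the same rules as the cavities.
\<close>
definition gap :: "(nat \<Rightarrow> complex) \<Rightarrow> (nat \<Rightarrow> real) \<Rightarrow> nat \<Rightarrow> complex \<Rightarrow> real" where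
  "gap c \<rho> i y = (if i = 0 then \<rho> i - cmod (y - c i) else cmod (y - c i) - \<rho> i)"

text \<open>
  The open domain is the case \<open>s = 0\<close>. A positive \<open>s\<close> enlarges it across every circle by \<open>s\<close>, a
  negative one shrinks it.
\<close>
definition collar :: "nat \<Rightarrow> (nat \<Rightarrow> complex) \<Rightarrow> (nat \<Rightarrow> real) \<Rightarrow> real \<Rightarrow> complex set" where
  "collar n c \<rho> s = {y. \<forall>i\<le>n. - s < gap c \<rho> i y}"

definition closed_collar :: "nat \<Rightarrow> (nat \<Rightarrow> complex) \<Rightarrow> (nat \<Rightarrow> real) \<Rightarrow> real \<Rightarrow> complex set" where
  "closed_collar n c \<rho> s = {y. \<forall>i\<le>n. - s \<le> gap c \<rho> i y}"

definition side :: "nat \<Rightarrow> real" where "side i = (if i = 0 then - 1 else 1)"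

lemma side_sq [simp]: "side i * side i = 1" "side i * (side i * x) = x" "(side i)\<^sup>2 = 1" "\<bar>side i\<bar> = 1"
  by (auto simp: side_def)

lemma gap_side: "gap c \<rho> i y = side i * (cmod (y - c i) - \<rho> i)"
  by (simp add: gap_def side_def)

lemma gap_lipschitz: "\<bar>gap c \<rho> i x - gap c \<rho> i y\<bar> \<le> dist x y"
proof -
  have "\<bar>cmod (x - c i) - cmod (y - c i)\<bar> \<le> cmod ((x - c i) - (y - c i))" by (rule norm_triangle_ineq3)
  then show ?thesis by (cases "i = 0") (auto simp: gap_def dist_norm abs_minus_commute)
qed

lemma gap_perturb:
  assumes "dist (c i) (c' i) \<le> a" "\<bar>\<rho> i - \<rho>' i\<bar> \<le> b"
  shows "\<bar>gap c \<rho> i y - gap c' \<rho>' i y\<bar> \<le> a + b"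
proof -
  have "\<bar>cmod (y - c i) - cmod (y - c' i)\<bar> \<le> cmod ((y - c i) - (y - c' i))" by (rule norm_triangle_ineq3)
  also have "\<dots> = dist (c i) (c' i)" by (simp add: dist_norm norm_minus_commute)
  finally have *: "\<bar>cmod (y - c i) - cmod (y - c' i)\<bar> \<le> a" using assms(1) by simp
  show ?thesis using * assms(2) unfolding gap_def abs_le_iff by auto
qed

lemma continuous_on_gap [continuous_intros]: "continuous_on A (gap c \<rho> i)"
  unfolding gap_side by (intro continuous_intros)

lemma isCont_gap: "isCont (gap c \<rho> i) y"
  unfolding gap_side by (intro continuous_intros)

lemma open_collar: "open (collar n c \<rho> s)"
proof -
  have "collar n c \<rho> s = (\<Inter>i\<in>{..n}. {y. - s < gap c \<rho> i y})" by (auto simp: collar_def)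
  moreover have "open \<dots>"
    by (intro open_INT) (auto intro!: open_Collect_less continuous_intros)
  ultimately show ?thesis by simp
qed

lemma closed_closed_collar: "closed (closed_collar n c \<rho> s)"
proof -
  have "closed_collar n c \<rho> s = (\<Inter>i\<in>{..n}. {y. - s \<le> gap c \<rho> i y})" by (auto simp: closed_collar_def)
  moreover have "closed \<dots>"
    by (intro closed_INT) (auto intro!: closed_Collect_le continuous_intros)
  ultimately show ?thesis by simp
qed

lemma compact_closed_collar: "compact (closed_collar n c \<rho> s)"
proof -
  have "closed_collar n c \<rho> s \<subseteq> cball (c 0) (\<rho> 0 + s)"
    by (auto simp: closed_collar_def gap_def dist_norm norm_minus_commute dest!: spec[of _ 0])
  then show ?thesis
    using bounded_subset[OF bounded_cball] closed_closed_collar compact_eq_bounded_closed by blast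
qed

lemma collar_mono: "s \<le> s' \<Longrightarrow> collar n c \<rho> s \<subseteq> collar n c \<rho> s'"
  by (fastforce simp: collar_def)

lemma collar_subset_closed_collar: "s \<le> s' \<Longrightarrow> collar n c \<rho> s \<subseteq> closed_collar n c \<rho> s'"
  unfolding collar_def closed_collar_def by (smt (verit) Collect_mono)

lemma closed_collar_subset_collar: "s < s' \<Longrightarrow> closed_collar n c \<rho> s \<subseteq> collar n c \<rho> s'"
  unfolding collar_def closed_collar_def by (smt (verit) Collect_mono)

lemma ball_subset_collar: "y \<in> closed_collar n c \<rho> s \<Longrightarrow> ball y e \<subseteq> collar n c \<rho> (s + e)"
proof
  fix x assume y: "y \<in> closed_collar n c \<rho> s" and x: "x \<in> ball y e"
  have "- (s + e) < gap c \<rho> i x" if "i \<le> n" for i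
    using gap_lipschitz[of c \<rho> i y x] x y that by (auto simp: closed_collar_def abs_le_iff)
  then show "x \<in> collar n c \<rho> (s + e)" by (simp add: collar_def)
qed

lemma closed_segment_first_hit:
  fixes y p w c :: complex
  assumes y: "r \<le> cmod (y - c)" and p: "p \<in> closed_segment y w"
    and hit: "\<And>x. x \<in> closed_segment y w \<Longrightarrow> cmod (x - c) \<le> r \<Longrightarrow> dist y p \<le> dist y x"
    and x: "x \<in> closed_segment y p"
  shows "r \<le> cmod (x - c)"
proof (rule ccontr)
  assume "\<not> r \<le> cmod (x - c)"
  then have xr: "cmod (x - c) < r" by simp
  have sub: "closed_segment y p \<subseteq> closed_segment y w"
    using p by (simp add: subset_closed_segment)
  \<comment> \<open>Somewhere between \<open>y\<close> and \<open>x\<close> the segment crosses the circle, strictly before \<open>p\<close>.\<close>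
  have "\<exists>s. 0 \<le> s \<and> s \<le> 1 \<and> cmod (y + s *\<^sub>R (x - y) - c) = r"
    using xr y by (intro IVT2'[of "\<lambda>s. cmod (y + s *\<^sub>R (x - y) - c)"]) (auto intro!: continuous_intros)
  then obtain s where s: "0 \<le> s" "s \<le> 1" "cmod (y + s *\<^sub>R (x - y) - c) = r" by blast
  define x' where "x' = y + s *\<^sub>R (x - y)"
  have "x' \<in> closed_segment y x"
    unfolding x'_def in_segment by (intro exI[of _ s]) (use s in \<open>auto simp: algebra_simps\<close>)
  moreover from this have "x' \<in> closed_segment y w"
    using x sub by (meson ends_in_segment(1) subset_closed_segment subsetD)
  then have "dist y p \<le> dist y x'" using hit s x'_def by auto
  moreover have "dist y x' \<le> dist y x" "dist y x \<le> dist y p"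
    using \<open>x' \<in> closed_segment y x\<close> x by (metis dist_commute dist_in_closed_segment)+
  ultimately have "dist y x' = dist y x" by linarith
  moreover have "dist y x' = s * dist y x"
    using s by (simp add: x'_def dist_norm norm_minus_commute)
  ultimately have "s = 1 \<or> x = y" by auto
  then have "x' = x" by (auto simp: x'_def)
  then show False using s(3) xr x'_def by simp
qed

text \<open>
  Disjointness of the disks and their inclusion in the large disk, each with the margin \<open>d\<close>, say that the gaps
  of two different circles add up to at least \<open>2 * d\<close>. In this form the condition passes to limits of
  configurations and is symmetric in all circles.
\<close>
locale circular_config =
  fixes n :: nat and c :: "nat \<Rightarrow> complex" and \<rho> :: "nat \<Rightarrow> real" and d :: real
  assumes d_pos: "0 < d"
    and c0: "c 0 = 0"
    and radius_ge: "\<And>i. i \<le> n \<Longrightarrow> d \<le> \<rho> i"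
    and gap_sum: "\<And>i j y. i \<le> n \<Longrightarrow> j \<le> n \<Longrightarrow> i \<noteq> j \<Longrightarrow> 2 * d \<le> gap c \<rho> i y + gap c \<rho> j y"
begin

lemma radius_pos: "i \<le> n \<Longrightarrow> 0 < \<rho> i"
  using d_pos radius_ge by fastforce

lemma domain_eq_collar: "circular_domain n c \<rho> = collar n c \<rho> 0"
  unfolding circular_domain_def collar_def gap_def
  by (auto simp: dist_norm norm_minus_commute Suc_le_eq split: if_splits)

lemma radius_le: "i \<le> n \<Longrightarrow> i \<noteq> 0 \<Longrightarrow> \<rho> i + 2 * d \<le> \<rho> 0"
  using gap_sum[of 0 i "c i"] norm_ge_zero[of "c i - c 0"] by (simp add: gap_def del: norm_ge_zero)

lemma other_gap: "i \<le> n \<Longrightarrow> j \<le> n \<Longrightarrow> i \<noteq> j \<Longrightarrow> gap c \<rho> i y \<le> s \<Longrightarrow> 2 * d - s \<le> gap c \<rho> j y"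
  using gap_sum[of i j y] by linarith

text \<open>
  Walk from \<open>y\<close> to \<open>w\<close> along a segment and go around each cavity on the way. The induction is on a set
  \<open>J\<close> of cavities that contains all those met by the segment. If the segment enters the cavity \<open>i\<close>,
  its first and its last point on the enlarged circle leave two shorter segments that avoid \<open>i\<close> and an arc
  of angle at most \<open>2 * pi < 8\<close>. The bound \<open>C m = 10 * 2 ^ m - 8\<close> solves \<open>C (Suc m) = 2 * C m + 8\<close>,
  \<open>C 0 = 2\<close>. All paths keep the distance \<open>\<delta>\<close> from the circles, so that they stay in the open domain.
\<close>
lemma oscillation_chain:
  assumes pot: "potential_on (collar n c \<rho> 0) f F"
    and F: "\<And>y. y \<in> collar n c \<rho> 0 \<Longrightarrow> cmod (F y) \<le> M"
    and M: "0 \<le> M" and P: "\<rho> 0 \<le> P" and \<delta>: "0 < \<delta>" "\<delta> < d"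
    and J: "finite J" "J \<subseteq> {1..n}"
    and y: "y \<in> closed_collar n c \<rho> (- \<delta>)" and w: "w \<in> closed_collar n c \<rho> (- \<delta>)"
    and seg: "\<And>j x. j \<in> {1..n} - J \<Longrightarrow> x \<in> closed_segment y w \<Longrightarrow> \<delta> \<le> gap c \<rho> j x"
  shows "\<bar>f y - f w\<bar> \<le> M * P * (10 * 2 ^ card J - 8)"
  using J y w seg
proof (induction J arbitrary: y w rule: finite_induct)
  case empty
  have sub: "closed_segment y w \<subseteq> collar n c \<rho> 0"
  proof
    fix x assume x: "x \<in> closed_segment y w"
    have "closed_segment y w \<subseteq> cball 0 (\<rho> 0 - \<delta>)"
      using empty.prems(2,3) c0 by (intro closed_segment_subset)
         (auto simp: closed_collar_def gap_def dest!: spec[of _ 0])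
    then have "\<delta> \<le> gap c \<rho> 0 x" using x c0 by (auto simp: gap_def)
    then have "\<delta> \<le> gap c \<rho> i x" if "i \<le> n" for i
      using empty.prems(4)[of i x] x that by (cases "i = 0") auto
    then show "x \<in> collar n c \<rho> 0" using \<delta> by (fastforce simp: collar_def)
  qed
  have "\<bar>f y - f w\<bar> \<le> M * cmod (y - w)"
    by (rule potential_lipschitz[OF potential_on_subset[OF pot sub]]) (use sub F in auto)
  also have "\<dots> \<le> M * (2 * P)"
  proof (rule mult_left_mono[OF _ M])
    have "cmod y \<le> P" "cmod w \<le> P"
      using empty.prems(2,3) c0 P \<delta> by (auto simp: closed_collar_def gap_def dest!: spec[of _ 0])
    then show "cmod (y - w) \<le> 2 * P" using norm_triangle_ineq4[of y w] by linarith
  qed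
  finally show ?case by simp
next
  case (insert i J)
  have i: "1 \<le> i" "i \<le> n" "i \<noteq> 0" using insert.prems by auto
  have P0: "0 \<le> P" using P radius_pos[of 0] by simp
  define r where "r = \<rho> i + \<delta>"
  have r: "0 < r" "r \<le> P" using radius_pos[OF i(2)] radius_le[OF i(2,3)] \<delta> P by (auto simp: r_def)
  have gr: "\<delta> \<le> gap c \<rho> i x \<longleftrightarrow> r \<le> cmod (x - c i)" for x using i by (auto simp: gap_def r_def)
  have IH: "\<bar>f y' - f w'\<bar> \<le> M * P * (10 * 2 ^ card J - 8)"
    if "y' \<in> closed_collar n c \<rho> (- \<delta>)" "w' \<in> closed_collar n c \<rho> (- \<delta>)"
       "closed_segment y' w' \<subseteq> closed_segment y w"
       "\<And>x. x \<in> closed_segment y' w' \<Longrightarrow> r \<le> cmod (x - c i)" for y' w'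
  proof (rule insert.IH)
    show "\<delta> \<le> gap c \<rho> j x" if "j \<in> {1..n} - J" "x \<in> closed_segment y' w'" for j x
      using that \<open>closed_segment y' w' \<subseteq> _\<close> insert.prems(4)[of j x] gr
        \<open>\<And>x. x \<in> closed_segment y' w' \<Longrightarrow> r \<le> cmod (x - c i)\<close> by (cases "j = i") auto
  qed (use that insert.prems in auto)
  have card: "card (insert i J) = Suc (card J)" using insert.hyps by simp
  have pow: "1 \<le> (2::real) ^ card J" by simp
  have MP: "0 \<le> M * P" using M P0 by simp
  let ?T = "closed_segment y w \<inter> cball (c i) r"
  show ?case
  proof (cases "?T = {}")
    case True
    then have "r \<le> cmod (x - c i)" if "x \<in> closed_segment y w" for x
      using that by (auto simp: disjoint_iff dist_norm norm_minus_commute not_le intro: less_imp_le)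
    then have "\<bar>f y - f w\<bar> \<le> M * P * (10 * 2 ^ card J - 8)"
      by (intro IH) (use insert.prems in auto)
    also have "\<dots> \<le> M * P * (10 * 2 ^ card (insert i J) - 8)"
      unfolding card using pow by (intro mult_left_mono MP) auto
    finally show ?thesis .
  next
    case False
    have T: "closed ?T" by (intro closed_Int) auto
    obtain p where p: "p \<in> ?T" "\<And>x. x \<in> ?T \<Longrightarrow> dist y p \<le> dist y x"
      using distance_attains_inf[OF T False] by metis
    obtain q where q: "q \<in> ?T" "\<And>x. x \<in> ?T \<Longrightarrow> dist w q \<le> dist w x"
      using distance_attains_inf[OF T False] by metis
    have ry: "r \<le> cmod (y - c i)" and rw: "r \<le> cmod (w - c i)"
      using insert.prems i(2) by (auto simp: closed_collar_def simp flip: gr)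
    have yp: "r \<le> cmod (x - c i)" if "x \<in> closed_segment y p" for x
      by (rule closed_segment_first_hit[OF ry _ _ that, of w])
         (use p in \<open>auto simp: dist_norm norm_minus_commute\<close>)
    have wq: "r \<le> cmod (x - c i)" if "x \<in> closed_segment w q" for x
      by (rule closed_segment_first_hit[OF rw _ _ that, of y])
         (use q in \<open>auto simp: dist_norm norm_minus_commute closed_segment_commute\<close>)
    have rp: "cmod (p - c i) = r" and rq: "cmod (q - c i) = r"
      using yp[of p] wq[of q] p q by (auto simp: dist_norm norm_minus_commute)
    have circle: "x \<in> closed_collar n c \<rho> (- \<delta>)" "x \<in> collar n c \<rho> 0" if "cmod (x - c i) = r" for x
    proof -
      have gi: "gap c \<rho> i x = \<delta>" using that i by (simp add: gap_def r_def)
      have "\<delta> \<le> gap c \<rho> j x" if "j \<le> n" for j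
        using other_gap[OF i(2) that, of x \<delta>] gi \<delta> by (cases "j = i") auto
      then show "x \<in> closed_collar n c \<rho> (- \<delta>)" "x \<in> collar n c \<rho> 0"
        using \<delta> by (fastforce simp: closed_collar_def collar_def)+
    qed
    have 1: "\<bar>f y - f p\<bar> \<le> M * P * (10 * 2 ^ card J - 8)"
      by (rule IH) (use insert.prems p rp circle yp in \<open>auto simp: subset_closed_segment\<close>)
    have 2: "\<bar>f w - f q\<bar> \<le> M * P * (10 * 2 ^ card J - 8)"
      by (rule IH) (use insert.prems q rq circle wq in \<open>auto simp: subset_closed_segment closed_segment_commute\<close>)
    define g where "g \<theta> = f (c i + of_real r * cis \<theta>)" for \<theta>
    have pol: "x = c i + of_real r * cis (Arg (x - c i))" if "cmod (x - c i) = r" for x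
      using rcis_cmod_Arg[of "x - c i"] that by (simp add: rcis_def)
    have "norm (g (Arg (p - c i)) - g (Arg (q - c i))) \<le> (M * r) * norm (Arg (p - c i) - Arg (q - c i))"
    proof (rule differentiable_bound[OF convex_UNIV])
      fix \<theta> :: real
      let ?x = "c i + of_real r * cis \<theta>"
      have x: "?x \<in> collar n c \<rho> 0" by (rule circle) (use r in \<open>simp add: norm_mult\<close>)
      have "((\<lambda>\<theta>. c i + of_real r * cis \<theta>) has_derivative (\<lambda>h. of_real r * (h *\<^sub>R (\<i> * cis \<theta>)))) (at \<theta>)"
        by (auto intro!: derivative_eq_intros has_derivative_cis)
      from has_derivative_compose[OF this potential_onD[OF pot x]]
      show "(g has_derivative (\<lambda>h. Re (F ?x * (of_real r * (h *\<^sub>R (\<i> * cis \<theta>)))))) (at \<theta> within UNIV)"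
        unfolding g_def by simp
      show "onorm (\<lambda>h. Re (F ?x * (of_real r * (h *\<^sub>R (\<i> * cis \<theta>))))) \<le> M * r"
      proof (rule onorm_le)
        fix h :: real
        have "\<bar>Re (F ?x * (of_real r * (h *\<^sub>R (\<i> * cis \<theta>))))\<bar> \<le> cmod (F ?x) * cmod (of_real r * (h *\<^sub>R (\<i> * cis \<theta>)))"
          by (rule norm_Re_mult_le)
        also have "\<dots> = cmod (F ?x) * (r * \<bar>h\<bar>)" using r by (simp add: norm_mult)
        also have "\<dots> \<le> M * (r * \<bar>h\<bar>)" using F[OF x] r by (intro mult_right_mono) auto
        finally show "norm (Re (F ?x * (of_real r * (h *\<^sub>R (\<i> * cis \<theta>))))) \<le> M * r * norm h"
          by (simp add: mult.assoc)
      qed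
    qed auto
    moreover have "\<bar>Arg (p - c i) - Arg (q - c i)\<bar> \<le> 8"
      using Arg_bounded[of "p - c i"] Arg_bounded[of "q - c i"] pi_less_4 by (auto simp: abs_le_iff)
    then have "(M * r) * norm (Arg (p - c i) - Arg (q - c i)) \<le> (M * P) * 8"
      using M r by (intro mult_mono) (auto intro: mult_left_mono)
    ultimately have 3: "\<bar>f p - f q\<bar> \<le> M * P * 8"
      unfolding g_def using pol[OF rp] pol[OF rq] by simp
    have "\<bar>f y - f w\<bar> \<le> 2 * (M * P * (10 * 2 ^ card J - 8)) + M * P * 8"
      using 1 2 3 by linarith
    also have "\<dots> = M * P * (10 * 2 ^ card (insert i J) - 8)"
      unfolding card by (simp add: algebra_simps)
    finally show ?thesis .
  qed
qed

lemma oscillation_bound: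
  assumes pot: "potential_on (collar n c \<rho> 0) f F"
    and F: "\<And>y. y \<in> collar n c \<rho> 0 \<Longrightarrow> cmod (F y) \<le> M"
    and y: "y \<in> collar n c \<rho> 0" and w: "w \<in> collar n c \<rho> 0"
  shows "\<bar>f y - f w\<bar> \<le> M * \<rho> 0 * (10 * 2 ^ n)"
proof -
  define \<delta> where "\<delta> = Min ({d / 2} \<union> (\<lambda>i. gap c \<rho> i y) ` {..n} \<union> (\<lambda>i. gap c \<rho> i w) ` {..n})"
  have \<delta>: "0 < \<delta>" "\<delta> < d"
    using d_pos y w unfolding \<delta>_def by (auto simp: collar_def Min_less_iff)
  have "y \<in> closed_collar n c \<rho> (- \<delta>)" "w \<in> closed_collar n c \<rho> (- \<delta>)"
    unfolding closed_collar_def \<delta>_def by (auto intro!: Min_le simp del: Min_insert minus_Min_eq_Max Un_insert_left)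
  moreover have M: "0 \<le> M" using F[OF y] by (meson norm_ge_zero order_trans)
  ultimately have "\<bar>f y - f w\<bar> \<le> M * \<rho> 0 * (10 * 2 ^ card {1..n} - 8)"
    by (intro oscillation_chain[OF pot F _ order_refl \<delta>]) auto
  also have "\<dots> \<le> M * \<rho> 0 * (10 * 2 ^ n)"
    using M radius_pos[of 0] by (intro mult_left_mono) auto
  finally show ?thesis .
qed

text \<open>
  The indicator function of a relatively clopen piece is a potential of the zero field, so it has no oscillation.
\<close>
lemma connected_domain: "connected (collar n c \<rho> 0)"
proof (rule ccontr)
  let ?E = "collar n c \<rho> 0"
  assume "\<not> connected ?E"
  then obtain A B where AB: "open A" "open B" "?E \<subseteq> A \<union> B" "A \<inter> B \<inter> ?E = {}"
      "A \<inter> ?E \<noteq> {}" "B \<inter> ?E \<noteq> {}"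
    unfolding connected_def by metis
  define f :: "complex \<Rightarrow> real" where "f y = (if y \<in> A then 1 else 0)" for y
  have "potential_on ?E f (\<lambda>_. 0)"
    unfolding potential_on_def
  proof
    fix y assume y: "y \<in> ?E"
    show "(f has_derivative (\<lambda>h. Re (0 * h))) (at y)"
    proof (cases "y \<in> A")
      case True
      show ?thesis
        by (rule has_derivative_transform_within_open[of "\<lambda>_. 1" _ _ _ A])
           (use True AB in \<open>auto simp: f_def\<close>)
    next
      case False
      show ?thesis
        by (rule has_derivative_transform_within_open[of "\<lambda>_. 0" _ _ _ "B \<inter> ?E"])
           (use False y AB open_collar in \<open>auto simp: f_def\<close>)
    qed
  qed
  moreover obtain x y where "x \<in> A \<inter> ?E" "y \<in> B \<inter> ?E" using AB by blast
  ultimately have "\<bar>f x - f y\<bar> \<le> 0 * \<rho> 0 * (10 * 2 ^ n)"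
    by (intro oscillation_bound) auto
  moreover have "f x = 1" "f y = 0"
    using \<open>x \<in> A \<inter> ?E\<close> \<open>y \<in> B \<inter> ?E\<close> AB by (auto simp: f_def)
  ultimately show False by simp
qed

end

section \<open>Logarithmic charts around the circles\<close>

text \<open>
  Logarithmic polar coordinates at a circle. The real axis is mapped to the circle, the upper half plane to the side
  of the domain (this is what \<open>side\<close> achieves), and complex conjugation corresponds to reflection in the
  circle. The gain over the annulus is that strips are convex, so that holomorphic functions on them have primitives.
\<close>
definition chart :: "(nat \<Rightarrow> complex) \<Rightarrow> (nat \<Rightarrow> real) \<Rightarrow> nat \<Rightarrow> complex \<Rightarrow> complex" where
  "chart c \<rho> i w = c i + of_real (\<rho> i) * exp (- \<i> * of_real (side i) * w)"

definition strip :: "real \<Rightarrow> complex set" where "strip b = {w. \<bar>Im w\<bar> < b}"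

text \<open>
  The image of the strip of this half-width lies in the annulus of points at distance less than \<open>e\<close> from the
  circle and covers the annulus for \<open>e / 2\<close>, for cavities as well as for the outer circle.
\<close>
definition width :: "(nat \<Rightarrow> real) \<Rightarrow> nat \<Rightarrow> real \<Rightarrow> real" where
  "width \<rho> i e = ln (1 + e / \<rho> i)"

lemma convex_strip: "convex (strip b)"
proof -
  have "strip b = {w. Im w < b} \<inter> {w. Im w > - b}" by (auto simp: strip_def)
  then show ?thesis by (simp add: convex_Int convex_halfspace_Im_lt convex_halfspace_Im_gt)
qed

lemma open_strip: "open (strip b)"
  unfolding strip_def by (intro open_Collect_less continuous_intros)

lemma cnj_strip: "w \<in> strip b \<Longrightarrow> cnj w \<in> strip b"
  by (simp add: strip_def)

lemma strip_upper_limit: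
  assumes w: "w \<in> strip b" "0 \<le> Im w"
  obtains W where "\<And>k. W k \<in> strip b" "\<And>k. 0 < Im (W k)" "W \<longlonglongrightarrow> w"
proof -
  define W where "W k = w + \<i> * of_real ((b - Im w) / real (k + 2))" for k
  have b: "Im w < b" using w by (simp add: strip_def)
  have "(\<lambda>k. (b - Im w) / real (k + 2)) \<longlonglongrightarrow> 0"
    by (rule LIMSEQ_ignore_initial_segment[OF lim_const_over_n])
  then have "(\<lambda>k. \<i> * complex_of_real ((b - Im w) / real (k + 2))) \<longlonglongrightarrow> \<i> * complex_of_real 0"
    by (rule tendsto_mult[OF tendsto_const tendsto_of_real])
  from tendsto_add[OF tendsto_const[of w] this] have "W \<longlonglongrightarrow> w" unfolding W_def by simp
  moreover have Im: "0 < Im (W k)" "Im (W k) < b" for k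
  proof -
    have "(b - Im w) / real (k + 2) < b - Im w" using b by (simp add: divide_less_eq)
    moreover have "0 < (b - Im w) / real (k + 2)" using b by simp
    moreover have "Im (W k) = Im w + (b - Im w) / real (k + 2)" by (simp add: W_def)
    ultimately show "0 < Im (W k)" "Im (W k) < b" using w by linarith+
  qed
  moreover have "W k \<in> strip b" for k
    using Im[of k] by (simp add: strip_def)
  ultimately show ?thesis using that by blast
qed

lemma chart_minus: "chart c \<rho> i w - c i = of_real (\<rho> i) * exp (- \<i> * of_real (side i) * w)"
  by (simp add: chart_def)

lemma norm_chart_minus: "0 < \<rho> i \<Longrightarrow> cmod (chart c \<rho> i w - c i) = \<rho> i * exp (side i * Im w)"
  by (simp add: chart_minus norm_mult)

lemma chart_minus_nonzero: "0 < \<rho> i \<Longrightarrow> chart c \<rho> i w - c i \<noteq> 0"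
  by (simp add: chart_minus)

lemma chart_deriv:
  "(chart c \<rho> i has_field_derivative (- \<i> * of_real (side i) * (chart c \<rho> i w - c i))) (at w)"
  unfolding chart_def by (auto intro!: derivative_eq_intros)

lemma continuous_on_chart: "continuous_on S (chart c \<rho> i)"
  by (meson chart_deriv DERIV_isCont continuous_at_imp_continuous_on)

lemma holomorphic_on_chart: "chart c \<rho> i holomorphic_on S"
  unfolding chart_def by (intro holomorphic_intros)

lemma chart_cnj:
  assumes "0 < \<rho> i"
  shows "chart c \<rho> i (cnj w) = c i + (of_real (\<rho> i))\<^sup>2 / cnj (chart c \<rho> i w - c i)"
proof -
  let ?s = "\<i> * of_real (side i)"
  have "cnj (exp (- ?s * w)) = exp (?s * cnj w)" by (simp add: exp_cnj)
  moreover have "exp (- ?s * cnj w) * exp (?s * cnj w) = 1" by (simp flip: exp_add)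
  ultimately show ?thesis
    using assms by (simp add: chart_def field_simps power2_eq_square)
qed

text \<open>
  The inverse is a branch of the logarithm, normalised at the given point.
\<close>
lemma chart_local_inverse:
  assumes \<rho>: "0 < \<rho> i"
  obtains W where "W (chart c \<rho> i w1) = w1"
    "(W has_field_derivative (\<i> * of_real (side i) / (chart c \<rho> i w1 - c i))) (at (chart c \<rho> i w1))"
    "\<And>y. y \<noteq> c i \<Longrightarrow> chart c \<rho> i (W y) = y"
proof -
  define y1 where "y1 = chart c \<rho> i w1"
  define \<eta> where "\<eta> = y1 - c i"
  have \<eta>: "\<eta> \<noteq> 0" using chart_minus_nonzero[of \<rho> i c w1] \<rho> by (simp add: \<eta>_def y1_def)
  define W where "W y = w1 + \<i> * of_real (side i) * Ln ((y - c i) / \<eta>)" for y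
  have W1: "W y1 = w1" using \<eta> by (simp add: W_def \<eta>_def)
  have chW: "chart c \<rho> i (W y) = y" if "y \<noteq> c i" for y
  proof -
    have "- \<i> * of_real (side i) * W y = - \<i> * of_real (side i) * w1 + of_real (side i * side i) * Ln ((y - c i) / \<eta>)"
      unfolding W_def of_real_mult by (simp add: algebra_simps)
    then have "exp (- \<i> * of_real (side i) * W y) = exp (- \<i> * of_real (side i) * w1) * ((y - c i) / \<eta>)"
      using that \<eta> by (simp only: exp_add side_sq(1) of_real_1 mult_1) simp
    then have "chart c \<rho> i (W y) - c i = (chart c \<rho> i w1 - c i) * ((y - c i) / \<eta>)"
      unfolding chart_minus by simp
    then show ?thesis using \<eta> by (simp add: y1_def[symmetric] \<eta>_def)
  qed
  have "(W has_field_derivative (\<i> * of_real (side i) / (y1 - c i))) (at y1)"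
    unfolding W_def using \<eta> by (auto intro!: derivative_eq_intros simp: \<eta>_def)
  with W1 chW that show ?thesis unfolding y1_def by blast
qed

lemma chart_surjective:
  assumes \<rho>: "0 < \<rho> i" and y: "y \<noteq> c i"
  shows "\<exists>w. chart c \<rho> i w = y"
proof -
  define w where "w = \<i> * of_real (side i) * Ln ((y - c i) / of_real (\<rho> i))"
  have "- \<i> * of_real (side i) * w = of_real (side i * side i) * Ln ((y - c i) / of_real (\<rho> i))"
    unfolding w_def of_real_mult by (simp add: algebra_simps)
  then have "exp (- \<i> * of_real (side i) * w) = (y - c i) / of_real (\<rho> i)"
    using y \<rho> by simp
  then have "chart c \<rho> i w = y" using \<rho> by (simp add: chart_def)
  then show ?thesis by blast
qed

lemma holomorphic_on_chart_image:
  assumes \<rho>: "0 < \<rho> i" and g: "(\<lambda>w. g (chart c \<rho> i w)) holomorphic_on T" and T: "open T"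
    and S: "open S" "S \<subseteq> chart c \<rho> i ` T"
  shows "g holomorphic_on S"
  unfolding holomorphic_on_open[OF S(1)]
proof
  fix y1 assume "y1 \<in> S"
  then obtain w1 where w1: "w1 \<in> T" "y1 = chart c \<rho> i w1" using S by blast
  obtain W where W: "W y1 = w1" "(W has_field_derivative (\<i> * of_real (side i) / (y1 - c i))) (at y1)"
    "\<And>y. y \<noteq> c i \<Longrightarrow> chart c \<rho> i (W y) = y"
    unfolding w1(2) using chart_local_inverse[of \<rho> i c w1, OF \<rho>] by metis
  have g': "((\<lambda>w. g (chart c \<rho> i w)) has_field_derivative deriv (\<lambda>w. g (chart c \<rho> i w)) w1) (at (W y1))"
    using holomorphic_derivI[OF g T w1(1)] W(1) by simp
  have "y1 \<noteq> c i" using chart_minus_nonzero[of \<rho> i c w1] \<rho> w1 by auto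
  then have "(g has_field_derivative deriv (\<lambda>w. g (chart c \<rho> i w)) w1 * (\<i> * of_real (side i) / (y1 - c i))) (at y1)"
    by (intro has_field_derivative_transform_within_open[OF DERIV_chain2[OF g' W(2)], of "- {c i}"])
       (auto simp: W(3))
  then show "\<exists>f'. (g has_field_derivative f') (at y1)" by blast
qed

lemma abs_exp_minus_one_le: "\<bar>exp x - 1\<bar> \<le> exp \<bar>x\<bar> - (1::real)"
proof (cases "x \<ge> 0")
  case False
  have "2 \<le> exp x + exp (- x)"
    using exp_ge_add_one_self[of x] exp_ge_add_one_self[of "- x"] by linarith
  then show ?thesis using False by (simp add: abs_if)
qed simp

context circular_config begin

lemma width_pos: "i \<le> n \<Longrightarrow> 0 < e \<Longrightarrow> 0 < width \<rho> i e"
  unfolding width_def using radius_pos by (intro ln_gt_zero) simp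

lemma gap_chart:
  "i \<le> n \<Longrightarrow> gap c \<rho> i (chart c \<rho> i w) = side i * \<rho> i * (exp (side i * Im w) - 1)"
  using norm_chart_minus[of \<rho> i c w] radius_pos[of i] by (simp add: gap_side algebra_simps)

lemma gap_chart_pos_iff:
  assumes "i \<le> n"
  shows "0 < gap c \<rho> i (chart c \<rho> i w) \<longleftrightarrow> 0 < Im w" "0 \<le> gap c \<rho> i (chart c \<rho> i w) \<longleftrightarrow> 0 \<le> Im w"
  unfolding gap_chart[OF assms]
  using radius_pos[OF assms] by (auto simp: side_def zero_less_mult_iff zero_le_mult_iff mult_le_0_iff)

lemma gap_chart_real: "i \<le> n \<Longrightarrow> Im w = 0 \<Longrightarrow> gap c \<rho> i (chart c \<rho> i w) = 0"
  by (simp add: gap_chart)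

lemma abs_gap_chart_less:
  assumes "i \<le> n" "0 < e" "w \<in> strip (width \<rho> i e)"
  shows "\<bar>gap c \<rho> i (chart c \<rho> i w)\<bar> < e"
proof -
  have \<rho>: "0 < \<rho> i" using radius_pos assms by simp
  have "\<bar>gap c \<rho> i (chart c \<rho> i w)\<bar> = \<rho> i * \<bar>exp (side i * Im w) - 1\<bar>"
    using \<rho> by (simp add: gap_chart[OF assms(1)] abs_mult)
  also have "\<dots> \<le> \<rho> i * (exp \<bar>Im w\<bar> - 1)"
    using abs_exp_minus_one_le[of "side i * Im w"] \<rho> by (intro mult_left_mono) (auto simp: abs_mult)
  also have "\<dots> < \<rho> i * ((1 + e / \<rho> i) - 1)"
  proof -
    have "exp \<bar>Im w\<bar> < exp (ln (1 + e / \<rho> i))"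
      using assms(3) by (simp add: strip_def width_def)
    also have "\<dots> = 1 + e / \<rho> i" using \<rho> assms(2) by (subst exp_ln) (auto intro: add_pos_pos)
    finally have "exp \<bar>Im w\<bar> - 1 < (1 + e / \<rho> i) - 1" by simp
    then show ?thesis by (rule mult_strict_left_mono[OF _ \<rho>])
  qed
  finally show ?thesis using \<rho> by simp
qed

lemma chart_surj:
  assumes i: "i \<le> n" and e: "0 < e" "e \<le> d" and y: "\<bar>gap c \<rho> i y\<bar> < e / 2"
  shows "\<exists>w\<in>strip (width \<rho> i e). chart c \<rho> i w = y"
proof -
  have \<rho>: "0 < \<rho> i" "e \<le> \<rho> i" using radius_pos radius_ge i e by fastforce+
  define x where "x = e / \<rho> i"
  have x: "0 < x" "x \<le> 1" using \<rho> e by (auto simp: x_def)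
  define a where "a = cmod (y - c i) / \<rho> i"
  have ga: "gap c \<rho> i y = side i * (\<rho> i * (a - 1))" using \<rho> by (simp add: gap_side a_def right_diff_distrib)
  have "\<rho> i * \<bar>a - 1\<bar> < \<rho> i * (x / 2)"
    using y \<rho> unfolding ga x_def by (simp add: abs_mult)
  then have a1: "\<bar>a - 1\<bar> < x / 2" using \<rho> by simp
  then have a: "a > 0" using x by linarith
  have "a < 1 + x" using a1 x by linarith
  moreover have "1 < (1 + x) * a"
  proof -
    \<comment> \<open>This is where \<open>e \<le> \<rho> i\<close>, that is \<open>x \<le> 1\<close>, is used.\<close>
  have "1 \<le> (1 + x) * (1 - x / 2)"
      using mult_left_mono[OF x(2), of x] x(1) by (simp add: algebra_simps power2_eq_square)
    also have "\<dots> < (1 + x) * a" using a1 x by (intro mult_strict_left_mono; linarith)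
    finally show ?thesis .
  qed
  then have "1 / (1 + x) < a" using x by (simp add: divide_less_eq mult.commute)
  ultimately have "ln a < ln (1 + x)" "ln (1 / (1 + x)) < ln a"
    using a x by (simp_all add: ln_less_cancel_iff)
  then have la: "\<bar>ln a\<bar> < ln (1 + x)" using x by (simp add: ln_div abs_less_iff)
  have "y \<noteq> c i" using a by (auto simp: a_def)
  then obtain w where w: "chart c \<rho> i w = y" using chart_surjective[of \<rho> i y c] \<rho>(1) by blast
  have "a = exp (side i * Im w)"
    using norm_chart_minus[of \<rho> i c w] \<rho>(1) unfolding w by (simp add: a_def)
  then have "w \<in> strip (width \<rho> i e)"
    using la by (simp add: strip_def width_def abs_mult x_def)
  then show ?thesis using w by blast
qed

lemma chart_surj_nonneg:
  assumes i: "i \<le> n" and e: "0 < e" "e \<le> d" and y: "\<bar>gap c \<rho> i y\<bar> < e / 2" and g: "0 \<le> gap c \<rho> i y"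
  obtains w where "w \<in> strip (width \<rho> i e)" "chart c \<rho> i w = y" "0 \<le> Im w"
  using chart_surj[OF i e y] gap_chart_pos_iff(2)[OF i] g by blast

lemma near_circle_closed_collar:
  assumes i: "i \<le> n" and e: "0 \<le> e" and y: "- e \<le> gap c \<rho> i y" "gap c \<rho> i y \<le> 2 * d"
  shows "y \<in> closed_collar n c \<rho> e"
proof -
  have "- e \<le> gap c \<rho> j y" if "j \<le> n" for j
    using other_gap[OF i that _ y(2)] y e d_pos by (cases "j = i") auto
  then show ?thesis by (simp add: closed_collar_def)
qed

lemma near_circle_collar:
  assumes i: "i \<le> n" and e: "0 \<le> e" and y: "- e < gap c \<rho> i y" "gap c \<rho> i y < 2 * d"
  shows "y \<in> collar n c \<rho> e"
proof -
  have "- e < gap c \<rho> j y" if "j \<le> n" for j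
    using gap_sum[OF i that, of y] y e d_pos by (cases "j = i") auto
  then show ?thesis by (simp add: collar_def)
qed

lemma chart_in_domain:
  assumes "i \<le> n" "0 < e" "e \<le> d" "w \<in> strip (width \<rho> i e)"
  shows "0 < Im w \<Longrightarrow> chart c \<rho> i w \<in> collar n c \<rho> 0"
    and "0 \<le> Im w \<Longrightarrow> chart c \<rho> i w \<in> closed_collar n c \<rho> 0"
    and "chart c \<rho> i w \<in> collar n c \<rho> e"
  using abs_gap_chart_less[OF assms(1,2,4)] gap_chart_pos_iff[OF assms(1), of w] assms d_pos
    near_circle_collar[OF assms(1), of 0 "chart c \<rho> i w"]
    near_circle_collar[OF assms(1), of e "chart c \<rho> i w"]
    near_circle_closed_collar[OF assms(1), of 0 "chart c \<rho> i w"]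
  by (auto simp: abs_less_iff)

lemma circle_point_in_closed_collar: "i \<le> n \<Longrightarrow> gap c \<rho> i y = 0 \<Longrightarrow> y \<in> closed_collar n c \<rho> 0"
  using near_circle_closed_collar[of i 0 y] d_pos by simp

lemma closure_domain: "closure (collar n c \<rho> 0) = closed_collar n c \<rho> 0"
proof
  show "closure (collar n c \<rho> 0) \<subseteq> closed_collar n c \<rho> 0"
    by (intro closure_minimal collar_subset_closed_collar closed_closed_collar) simp
  show "closed_collar n c \<rho> 0 \<subseteq> closure (collar n c \<rho> 0)"
  proof
    fix y assume y: "y \<in> closed_collar n c \<rho> 0"
    show "y \<in> closure (collar n c \<rho> 0)"
    proof (cases "y \<in> collar n c \<rho> 0")
      case True then show ?thesis using closure_subset by blast
    next
      case False
      then obtain i where i: "i \<le> n" "gap c \<rho> i y = 0"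
        using y by (force simp: collar_def closed_collar_def not_less)
      obtain w where w: "w \<in> strip (width \<rho> i d)" "chart c \<rho> i w = y" "0 \<le> Im w"
        using chart_surj_nonneg[OF i(1) d_pos order_refl, of y] i d_pos by auto
      obtain W where W: "\<And>k. W k \<in> strip (width \<rho> i d)" "\<And>k. 0 < Im (W k)" "W \<longlonglongrightarrow> w"
        using strip_upper_limit[OF w(1,3)] by blast
      have "(\<lambda>k. chart c \<rho> i (W k)) \<longlonglongrightarrow> y"
        using isCont_tendsto_compose[OF DERIV_isCont[OF chart_deriv] W(3)] w(2) by blast
      moreover have "chart c \<rho> i (W k) \<in> collar n c \<rho> 0" for k
        using chart_in_domain(1)[OF i(1) d_pos order_refl W(1,2)] .
      ultimately show ?thesis
        unfolding closure_sequential by (intro exI[of _ "\<lambda>k. chart c \<rho> i (W k)"]) simp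
    qed
  qed
qed

lemma frontier_domain:
  "frontier (collar n c \<rho> 0) = {y \<in> closed_collar n c \<rho> 0. \<exists>i\<le>n. gap c \<rho> i y = 0}"
  unfolding frontier_def closure_domain interior_open[OF open_collar]
  by (force simp: collar_def closed_collar_def not_less)

lemma cmod_pos_near_circle:
  assumes "i \<le> n" "0 \<le> gap c \<rho> i y" "gap c \<rho> i y < d"
  shows "y - c i \<noteq> 0" "d - gap c \<rho> i y \<le> cmod (y - c i)"
proof -
  show 1: "d - gap c \<rho> i y \<le> cmod (y - c i)"
    using assms radius_ge[OF assms(1)] by (auto simp: gap_def split: if_splits)
  show "y - c i \<noteq> 0" using 1 assms by auto
qed

lemma infdist_frontier_ge:
  assumes y: "y \<in> closed_collar n c \<rho> (- s)"
  shows "s \<le> infdist y (frontier (collar n c \<rho> 0))"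
proof -
  have "gap c \<rho> 0 (of_real (\<rho> 0)) = 0" using radius_pos[of 0] c0 by (simp add: gap_def)
  then have "of_real (\<rho> 0) \<in> frontier (collar n c \<rho> 0)"
    using circle_point_in_closed_collar[of 0 "of_real (\<rho> 0)"] by (auto simp: frontier_domain)
  then have "frontier (collar n c \<rho> 0) \<noteq> {}" by blast
  moreover have "s \<le> dist y x" if "x \<in> frontier (collar n c \<rho> 0)" for x
  proof -
    have "\<exists>i\<le>n. gap c \<rho> i x = 0" using that by (simp add: frontier_domain)
    then obtain i where i: "i \<le> n" "gap c \<rho> i x = 0" by blast
    then have "s \<le> gap c \<rho> i y" using y by (simp add: closed_collar_def)
    then show ?thesis using gap_lipschitz[of c \<rho> i y x] i by linarith
  qed
  ultimately show ?thesis
    by (metis infdist_notempty cINF_greatest)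
qed

text \<open>
  The radial projection realises the distance: any other circle is at distance at least \<open>2 * d\<close> minus the gap.
\<close>
lemma infdist_frontier_eq:
  assumes i: "i \<le> n" and y: "0 \<le> gap c \<rho> i y" "gap c \<rho> i y < d"
  shows "infdist y (frontier (collar n c \<rho> 0)) = gap c \<rho> i y"
proof (rule antisym)
  let ?\<eta> = "y - c i"
  have \<eta>: "?\<eta> \<noteq> 0" by (rule cmod_pos_near_circle[OF i y])
  let ?p = "c i + of_real (\<rho> i) * (?\<eta> / of_real (cmod ?\<eta>))"
  have "cmod (?p - c i) = \<rho> i" using \<eta> radius_pos[OF i] by (simp add: norm_mult norm_divide)
  then have "gap c \<rho> i ?p = 0" by (simp add: gap_side)
  then have p: "?p \<in> frontier (collar n c \<rho> 0)"
    using circle_point_in_closed_collar[OF i] i by (auto simp: frontier_domain)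
  have "?\<eta> = of_real (cmod ?\<eta>) * (?\<eta> / of_real (cmod ?\<eta>))" using \<eta> by simp
  then have "y - ?p = of_real (cmod ?\<eta>) * (?\<eta> / of_real (cmod ?\<eta>)) - of_real (\<rho> i) * (?\<eta> / of_real (cmod ?\<eta>))"
    by (simp only: diff_diff_eq[symmetric])
  then have "y - ?p = of_real (cmod ?\<eta> - \<rho> i) * (?\<eta> / of_real (cmod ?\<eta>))"
    by (simp only: of_real_diff left_diff_distrib)
  then have "dist y ?p = \<bar>cmod ?\<eta> - \<rho> i\<bar>"
    using \<eta> unfolding dist_norm by (simp add: norm_mult norm_divide del: of_real_diff)
  also have "\<dots> = gap c \<rho> i y" using y(1) by (auto simp: gap_def split: if_splits)
  finally show "infdist y (frontier (collar n c \<rho> 0)) \<le> gap c \<rho> i y"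
    using infdist_le[OF p, of y] by simp
  have "gap c \<rho> i y \<le> gap c \<rho> j y" if "j \<le> n" for j
    using other_gap[OF i that, of y d] y by (cases "j = i") auto
  then show "gap c \<rho> i y \<le> infdist y (frontier (collar n c \<rho> 0))"
    by (intro infdist_frontier_ge) (simp add: closed_collar_def)
qed

end

section \<open>Reflection across the circles and uniqueness\<close>

context circular_config begin

text \<open>
  The one-form \<open>F dy\<close> in the chart.
\<close>
definition chart_pull :: "nat \<Rightarrow> (complex \<Rightarrow> complex) \<Rightarrow> complex \<Rightarrow> complex" where
  "chart_pull i F w = F (chart c \<rho> i w) * (- \<i> * of_real (side i) * (chart c \<rho> i w - c i))"

text \<open>
  A primitive on the whole strip exists by convexity; on the upper half its real part has the same differential as
  the potential.
\<close>
lemma chart_pull_potential: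
  assumes i: "i \<le> n" and s: "0 < s" "s \<le> d"
    and F: "F holomorphic_on collar n c \<rho> s" and pot: "potential_on (collar n c \<rho> 0) f F"
  obtains Q where "\<And>w. w \<in> strip (width \<rho> i s) \<Longrightarrow> (Q has_field_derivative chart_pull i F w) (at w)"
    and "\<And>w. w \<in> strip (width \<rho> i s) \<Longrightarrow> 0 < Im w \<Longrightarrow> f (chart c \<rho> i w) = Re (Q w)"
proof -
  let ?S = "strip (width \<rho> i s)"
  let ?H = "?S \<inter> {w. Im w > 0}"
  have sub: "chart c \<rho> i ` ?S \<subseteq> collar n c \<rho> s" using chart_in_domain(3)[OF i s] by blast
  have "chart_pull i F holomorphic_on ?S"
    unfolding chart_pull_def
    by (intro holomorphic_intros holomorphic_on_compose_gen[OF holomorphic_on_chart F sub, unfolded o_def]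
        holomorphic_on_chart)
  then obtain Q where Q: "\<And>w. w \<in> ?S \<Longrightarrow> (Q has_field_derivative chart_pull i F w) (at w)"
    and potQ: "potential_on ?S (\<lambda>w. Re (Q w)) (chart_pull i F)"
    using primitive_convex[OF _ convex_strip open_strip] by metis
  have "potential_on ?H (\<lambda>w. f (chart c \<rho> i w)) (chart_pull i F)"
    unfolding potential_on_def
  proof
    fix w assume w: "w \<in> ?H"
    have x: "chart c \<rho> i w \<in> collar n c \<rho> 0" by (rule chart_in_domain(1)[OF i s]) (use w in auto)
    from has_derivative_compose[OF chart_deriv[unfolded has_field_derivative_def] potential_onD[OF pot x]]
    show "((\<lambda>w. f (chart c \<rho> i w)) has_derivative (\<lambda>h. Re (chart_pull i F w * h))) (at w)"
      unfolding chart_pull_def by (simp only: mult.assoc)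
  qed
  from potential_unique[OF this potential_on_subset[OF potQ Int_lower1]]
  obtain k where k: "\<And>w. w \<in> ?H \<Longrightarrow> f (chart c \<rho> i w) = Re (Q w) + k"
    using convex_Int[OF convex_strip convex_halfspace_Im_gt] by blast
  show ?thesis
  proof (rule that[of "\<lambda>w. Q w + of_real k"])
    show "((\<lambda>w. Q w + of_real k) has_field_derivative chart_pull i F w) (at w)" if "w \<in> ?S" for w
      using Q[OF that] by (auto intro!: derivative_eq_intros)
  qed (use k in auto)
qed

lemma chart_pull_potential_closed:
  assumes i: "i \<le> n" and s: "0 < s" "s \<le> d"
    and F: "F holomorphic_on collar n c \<rho> s" and pot: "potential_on (collar n c \<rho> 0) f F"
    and cont: "continuous_on (closed_collar n c \<rho> 0) f"
  obtains Q where "\<And>w. w \<in> strip (width \<rho> i s) \<Longrightarrow> (Q has_field_derivative chart_pull i F w) (at w)"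
    and "\<And>w. w \<in> strip (width \<rho> i s) \<Longrightarrow> 0 \<le> Im w \<Longrightarrow> f (chart c \<rho> i w) = Re (Q w)"
proof -
  obtain Q where Q: "\<And>w. w \<in> strip (width \<rho> i s) \<Longrightarrow> (Q has_field_derivative chart_pull i F w) (at w)"
    and f: "\<And>w. w \<in> strip (width \<rho> i s) \<Longrightarrow> 0 < Im w \<Longrightarrow> f (chart c \<rho> i w) = Re (Q w)"
    using chart_pull_potential[OF i s F pot] by blast
  have "f (chart c \<rho> i w) = Re (Q w)" if w: "w \<in> strip (width \<rho> i s)" "0 \<le> Im w" for w
  proof -
    obtain W where W: "\<And>k. W k \<in> strip (width \<rho> i s)" "\<And>k. 0 < Im (W k)" "W \<longlonglongrightarrow> w"
      using strip_upper_limit[OF w] by blast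
    have "(\<lambda>k. chart c \<rho> i (W k)) \<longlonglongrightarrow> chart c \<rho> i w"
      using isCont_tendsto_compose[OF DERIV_isCont[OF chart_deriv] W(3)] .
    then have 1: "(\<lambda>k. f (chart c \<rho> i (W k))) \<longlonglongrightarrow> f (chart c \<rho> i w)"
      using chart_in_domain(2)[OF i s W(1) less_imp_le[OF W(2)]] chart_in_domain(2)[OF i s w]
      by (intro continuous_on_tendsto_compose[OF cont] always_eventually) auto
    have "(\<lambda>k. Re (Q (W k))) \<longlonglongrightarrow> Re (Q w)"
      using isCont_tendsto_compose[OF DERIV_isCont[OF Q[OF w(1)]] W(3)] by (rule tendsto_Re)
    then have "(\<lambda>k. f (chart c \<rho> i (W k))) \<longlonglongrightarrow> Re (Q w)" using f W by simp
    then show ?thesis using 1 LIMSEQ_unique by blast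
  qed
  then show ?thesis using that Q by blast
qed

text \<open>
  The coefficient is chosen such that the one-form of the reflected function is the complex conjugate of the one-form
  \<open>u dy\<close> at the mirror point.
\<close>
definition reflect :: "nat \<Rightarrow> (complex \<Rightarrow> complex) \<Rightarrow> complex \<Rightarrow> complex" where
  "reflect i u y = - ((of_real (\<rho> i))\<^sup>2 / (y - c i)\<^sup>2) * cnj (u (c i + (of_real (\<rho> i))\<^sup>2 / cnj (y - c i)))"

text \<open>
  In the chart the condition \<open>Re ((y - c) u) = 0\<close> on the circle says that the pulled-back one-form
  is real on the real axis, so the classical reflection principle applies.
\<close>
lemma reflect_holomorphic:
  assumes i: "i \<le> n" and e: "0 < e" "e \<le> d"
    and F: "F holomorphic_on collar n c \<rho> 0" and contF: "continuous_on (closed_collar n c \<rho> 0) F"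
    and h: "h holomorphic_on {y. \<bar>gap c \<rho> i y\<bar> < e}"
    and bc: "\<And>y. gap c \<rho> i y = 0 \<Longrightarrow> Re ((y - c i) * (F y - h y)) = 0"
  shows "(\<lambda>y. if 0 \<le> gap c \<rho> i y then F y else h y + reflect i (\<lambda>y. F y - h y) y)
           holomorphic_on {y. \<bar>gap c \<rho> i y\<bar> < e / 2}"
proof -
  let ?S = "strip (width \<rho> i e)" and ?ch = "chart c \<rho> i"
  define u where "u y = F y - h y" for y
  define R where "R y = (if 0 \<le> gap c \<rho> i y then u y else reflect i u y)" for y
  have \<rho>: "0 < \<rho> i" using radius_pos[OF i] .
  have oA: "open {y. \<bar>gap c \<rho> i y\<bar> < t}" for t
    by (intro open_Collect_less continuous_intros)
  have sub0: "?ch ` (?S \<inter> {w. 0 < Im w}) \<subseteq> collar n c \<rho> 0" using chart_in_domain(1)[OF i e] by blast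
  have sub1: "?ch ` (?S \<inter> {w. 0 \<le> Im w}) \<subseteq> closed_collar n c \<rho> 0" using chart_in_domain(2)[OF i e] by blast
  have subA: "?ch ` ?S \<subseteq> {y. \<bar>gap c \<rho> i y\<bar> < e}" using abs_gap_chart_less[OF i e(1)] by blast
  have "(\<lambda>w. if 0 \<le> Im w then chart_pull i u w else cnj (chart_pull i u (cnj w))) holomorphic_on ?S"
  proof (rule Schwarz_reflection[OF open_strip])
    show "cnj ` ?S \<subseteq> ?S" using cnj_strip by blast
    have "(\<lambda>w. F (?ch w)) holomorphic_on ?S \<inter> {w. 0 < Im w}"
      using holomorphic_on_compose_gen[OF holomorphic_on_chart F sub0] by (simp add: o_def)
    moreover have "(\<lambda>w. h (?ch w)) holomorphic_on ?S"
      using holomorphic_on_compose_gen[OF holomorphic_on_chart h subA] by (simp add: o_def)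
    ultimately show "chart_pull i u holomorphic_on ?S \<inter> {w. 0 < Im w}"
      unfolding chart_pull_def u_def
      by (intro holomorphic_intros holomorphic_on_chart) (auto intro: holomorphic_on_subset)
    have "continuous_on (?S \<inter> {w. 0 \<le> Im w}) (\<lambda>w. F (?ch w))"
      using continuous_on_compose2[OF contF continuous_on_chart sub1] .
    moreover have "continuous_on (?S \<inter> {w. 0 \<le> Im w}) (\<lambda>w. h (?ch w))"
      using subA by (intro continuous_on_compose2[OF holomorphic_on_imp_continuous_on[OF h] continuous_on_chart]) auto
    ultimately show "continuous_on (?S \<inter> {w. 0 \<le> Im w}) (chart_pull i u)"
      unfolding chart_pull_def u_def by (intro continuous_intros continuous_on_chart)
    show "chart_pull i u w \<in> \<real>" if "w \<in> ?S" "w \<in> \<real>" for w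
    proof -
      have "gap c \<rho> i (?ch w) = 0" using that by (intro gap_chart_real[OF i]) (simp add: complex_is_Real_iff)
      from bc[OF this] have "Re ((?ch w - c i) * u (?ch w)) = 0" by (simp add: u_def)
      moreover have "chart_pull i u w = of_real (- side i) * (\<i> * ((?ch w - c i) * u (?ch w)))"
        by (simp add: chart_pull_def)
      ultimately show ?thesis by (simp add: complex_is_Real_iff)
    qed
  qed
  then have "(\<lambda>w. (if 0 \<le> Im w then chart_pull i u w else cnj (chart_pull i u (cnj w)))
      / (- \<i> * of_real (side i) * (?ch w - c i))) holomorphic_on ?S"
    using chart_minus_nonzero[of \<rho> i c, OF \<rho>]
    by (intro holomorphic_intros holomorphic_on_chart) (auto simp: side_def)
  moreover have "(if 0 \<le> Im w then chart_pull i u w else cnj (chart_pull i u (cnj w)))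
      / (- \<i> * of_real (side i) * (?ch w - c i)) = R (?ch w)" for w
  proof -
    define \<eta> where "\<eta> = ?ch w - c i"
    have \<eta>: "\<eta> \<noteq> 0" using chart_minus_nonzero[of \<rho> i c, OF \<rho>] by (simp add: \<eta>_def)
    have s: "complex_of_real (side i) \<noteq> 0" by (simp add: side_def)
    show ?thesis
    proof (cases "0 \<le> Im w")
      case True
      then show ?thesis
        using \<eta> s gap_chart_pos_iff(2)[OF i, of w]
        by (simp add: R_def chart_pull_def flip: \<eta>_def)
    next
      case False
      then have "\<not> 0 \<le> gap c \<rho> i (?ch w)" using gap_chart_pos_iff(2)[OF i, of w] by simp
      then have a1: "R (?ch w) = - ((of_real (\<rho> i))\<^sup>2 / \<eta>\<^sup>2) * cnj (u (?ch (cnj w)))"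
        unfolding R_def reflect_def chart_cnj[of \<rho> i c w, OF \<rho>] \<eta>_def by simp
      have "chart_pull i u (cnj w) = u (?ch (cnj w)) * (- \<i> * of_real (side i) * ((of_real (\<rho> i))\<^sup>2 / cnj \<eta>))"
        unfolding chart_pull_def by (subst (2) chart_cnj[of \<rho> i c w, OF \<rho>]) (simp add: \<eta>_def)
      then have a2: "cnj (chart_pull i u (cnj w)) = cnj (u (?ch (cnj w))) * (\<i> * of_real (side i) * ((of_real (\<rho> i))\<^sup>2 / \<eta>))"
        by simp
      show ?thesis
        unfolding \<eta>_def[symmetric] if_not_P[OF False] a1 a2
        using \<eta> s by (simp add: field_simps power2_eq_square)
    qed
  qed
  ultimately have "(\<lambda>w. R (?ch w)) holomorphic_on ?S" by simp
  then have "R holomorphic_on {y. \<bar>gap c \<rho> i y\<bar> < e / 2}"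
  proof (rule holomorphic_on_chart_image[where g = R and \<rho> = \<rho> and i = i and c = c, OF \<rho> _ open_strip oA])
    show "{y. \<bar>gap c \<rho> i y\<bar> < e / 2} \<subseteq> ?ch ` ?S" using chart_surj[OF i e] by blast
  qed
  moreover have "h holomorphic_on {y. \<bar>gap c \<rho> i y\<bar> < e / 2}"
    by (rule holomorphic_on_subset[OF h]) (use e in auto)
  ultimately have "(\<lambda>y. h y + R y) holomorphic_on {y. \<bar>gap c \<rho> i y\<bar> < e / 2}"
    by (intro holomorphic_intros)
  moreover have "(\<lambda>y. h y + R y) = (\<lambda>y. if 0 \<le> gap c \<rho> i y then F y else h y + reflect i (\<lambda>y. F y - h y) y)"
    by (auto simp: R_def u_def[abs_def])
  ultimately show ?thesis by simp
qed

text \<open>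
  The factor \<open>4\<close> bounds \<open>(\<rho> / |y - c|)\<^sup>2\<close>: a point within half a radius of the circle is at least half
  a radius away from the centre.
\<close>
lemma reflect_bound:
  assumes i: "i \<le> n" and e: "0 < e" "e \<le> d" and y: "- e / 2 < gap c \<rho> i y" "gap c \<rho> i y < 0"
    and u: "\<And>x. 0 < gap c \<rho> i x \<Longrightarrow> gap c \<rho> i x < e \<Longrightarrow> cmod (u x) \<le> B"
  shows "cmod (reflect i u y) \<le> 4 * B"
proof -
  have \<rho>: "0 < \<rho> i" "e \<le> \<rho> i" using radius_pos radius_ge i e by fastforce+
  obtain w where w: "w \<in> strip (width \<rho> i e)" "chart c \<rho> i w = y"
    using chart_surj[OF i e, of y] y by (auto simp: abs_less_iff)
  have "Im w < 0" using gap_chart_pos_iff(2)[OF i, of w] w y by simp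
  then have "0 < gap c \<rho> i (chart c \<rho> i (cnj w))"
    using gap_chart_pos_iff(1)[OF i, of "cnj w"] by simp
  moreover have "gap c \<rho> i (chart c \<rho> i (cnj w)) < e"
    using abs_gap_chart_less[OF i e(1) cnj_strip[OF w(1)]] by (simp add: abs_less_iff)
  ultimately have "cmod (u (chart c \<rho> i (cnj w))) \<le> B" by (rule u)
  then have uB: "cmod (u (c i + (of_real (\<rho> i))\<^sup>2 / cnj (y - c i))) \<le> B"
    unfolding chart_cnj[of \<rho> i c w, OF \<rho>(1)] w(2) .
  have \<eta>: "\<rho> i / 2 \<le> cmod (y - c i)"
    using y \<rho> by (auto simp: gap_def split: if_splits)
  have "\<rho> i / cmod (y - c i) \<le> 2" using \<eta> \<rho> by (simp add: divide_le_eq)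
  then have "(\<rho> i / cmod (y - c i))\<^sup>2 \<le> 2\<^sup>2" using \<rho> by (intro power_mono) auto
  then have "cmod ((of_real (\<rho> i))\<^sup>2 / (y - c i)\<^sup>2) \<le> 4"
    using \<rho> by (simp add: norm_divide norm_power power_divide)
  then show ?thesis
    unfolding reflect_def norm_mult norm_minus_cancel complex_mod_cnj
    using uB by (intro mult_mono) (auto intro: order_trans)
qed

text \<open>
  At most one gap is negative at a given point, so the reflections across different circles do not interfere.
  The constant is \<open>1 + 4\<close>, from \<open>h\<close> and from the reflected \<open>F - h\<close>.
\<close>
lemma domain_extension:
  assumes e: "0 < e" "e \<le> d"
    and F: "F holomorphic_on collar n c \<rho> 0" and contF: "continuous_on (closed_collar n c \<rho> 0) F"
    and h: "\<And>i. i \<le> n \<Longrightarrow> h i holomorphic_on {y. \<bar>gap c \<rho> i y\<bar> < e}"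
    and bc: "\<And>i y. i \<le> n \<Longrightarrow> gap c \<rho> i y = 0 \<Longrightarrow> Re ((y - c i) * (F y - h i y)) = 0"
    and M: "\<And>y. y \<in> closed_collar n c \<rho> 0 \<Longrightarrow> cmod (F y) \<le> M"
    and B: "\<And>i y. i \<le> n \<Longrightarrow> \<bar>gap c \<rho> i y\<bar> < e \<Longrightarrow> cmod (h i y) \<le> B"
  obtains F' where "F' holomorphic_on collar n c \<rho> (e / 2)"
    "\<And>y. y \<in> closed_collar n c \<rho> 0 \<Longrightarrow> F' y = F y"
    "\<And>y. y \<in> collar n c \<rho> (e / 2) \<Longrightarrow> cmod (F' y) \<le> 5 * (M + B)"
proof -
  let ?A = "\<lambda>i. {y. \<bar>gap c \<rho> i y\<bar> < e / 2}"
  define bad where "bad y = (SOME i. i \<le> n \<and> gap c \<rho> i y < 0)" for y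
  define R where "R i y = h i y + reflect i (\<lambda>y. F y - h i y) y" for i y
  define F' where "F' y = (if y \<in> closed_collar n c \<rho> 0 then F y else R (bad y) y)" for y
  have bad: "bad y = i" if "i \<le> n" "gap c \<rho> i y < 0" for i y
    unfolding bad_def
  proof (rule some_equality)
    show "j = i" if "j \<le> n \<and> gap c \<rho> j y < 0" for j
      using other_gap[OF \<open>i \<le> n\<close>, of j y 0] that \<open>gap c \<rho> i y < 0\<close> d_pos by (cases "j = i") auto
  qed (use that in simp)
  have F'_eq: "F' y = (if 0 \<le> gap c \<rho> i y then F y else R i y)" if "i \<le> n" "\<bar>gap c \<rho> i y\<bar> < e / 2" for i y
  proof (cases "0 \<le> gap c \<rho> i y")
    case True
    then have "y \<in> closed_collar n c \<rho> 0"
      using near_circle_closed_collar[OF that(1), of 0 y] that e d_pos by (simp add: abs_less_iff)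
    then show ?thesis using True by (simp add: F'_def)
  next
    case False
    then have "y \<notin> closed_collar n c \<rho> 0" using that by (force simp: closed_collar_def)
    then show ?thesis using False bad[OF that(1), of y] by (simp add: F'_def)
  qed
  have inA: "\<exists>i\<le>n. y \<in> ?A i \<and> gap c \<rho> i y < 0" if y: "y \<in> collar n c \<rho> (e / 2)" and ny: "y \<notin> closed_collar n c \<rho> 0" for y
  proof -
    obtain i where i: "i \<le> n" "gap c \<rho> i y < 0" using ny by (auto simp: closed_collar_def not_le)
    moreover have "- (e / 2) < gap c \<rho> i y" using y i by (simp add: collar_def)
    ultimately show ?thesis by (intro exI[of _ i]) auto
  qed
  have cov: "collar n c \<rho> (e / 2) \<subseteq> collar n c \<rho> 0 \<union> (\<Union>i\<in>{..n}. ?A i)"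
  proof
    fix y assume y: "y \<in> collar n c \<rho> (e / 2)"
    show "y \<in> collar n c \<rho> 0 \<union> (\<Union>i\<in>{..n}. ?A i)"
    proof (cases "y \<in> collar n c \<rho> 0")
      case False
      then obtain i where i: "i \<le> n" "gap c \<rho> i y \<le> 0" by (auto simp: collar_def not_less)
      moreover have "- (e / 2) < gap c \<rho> i y" using y i by (simp add: collar_def)
      ultimately have "\<bar>gap c \<rho> i y\<bar> < e / 2" using e by linarith
      then show ?thesis using i by blast
    qed simp
  qed
  have "F' holomorphic_on (\<Union>i\<in>{..n}. ?A i)"
  proof (rule holomorphic_on_UN_open)
    fix i assume i: "i \<in> {..n}"
    show "open (?A i)" by (intro open_Collect_less continuous_intros)
    have "(\<lambda>y. if 0 \<le> gap c \<rho> i y then F y else R i y) holomorphic_on ?A i"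
      unfolding R_def using i by (intro reflect_holomorphic e F contF h bc) auto
    then show "F' holomorphic_on ?A i"
      by (rule holomorphic_transform) (use i F'_eq in auto)
  qed
  moreover have "F' holomorphic_on collar n c \<rho> 0"
    by (rule holomorphic_transform[OF F])
       (use collar_subset_closed_collar[of 0 0 n c \<rho>] in \<open>auto simp: F'_def\<close>)
  ultimately have "F' holomorphic_on collar n c \<rho> 0 \<union> (\<Union>i\<in>{..n}. ?A i)"
    by (intro holomorphic_on_Un open_collar open_UN ballI open_Collect_less continuous_intros)
  then have 1: "F' holomorphic_on collar n c \<rho> (e / 2)"
    using cov holomorphic_on_subset by blast
  have 2: "cmod (F' y) \<le> 5 * (M + B)" if y: "y \<in> collar n c \<rho> (e / 2)" for y
  proof -
    have "gap c \<rho> 0 (of_real (\<rho> 0)) = 0" using radius_pos[of 0] c0 by (simp add: gap_def)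
    then have "cmod (F (of_real (\<rho> 0))) \<le> M" "cmod (h 0 (of_real (\<rho> 0))) \<le> B"
      using e circle_point_in_closed_collar[of 0] by (auto intro!: M B)
    then have MB: "0 \<le> M" "0 \<le> B" by (meson norm_ge_zero order_trans)+
    show ?thesis
    proof (cases "y \<in> closed_collar n c \<rho> 0")
      case True
      then have "cmod (F' y) \<le> M" using M by (simp add: F'_def)
      also have "M \<le> 5 * (M + B)" using MB by (simp add: distrib_left)
      finally show ?thesis .
    next
      case False
      then obtain i where i: "i \<le> n" "gap c \<rho> i y < 0" "\<bar>gap c \<rho> i y\<bar> < e / 2"
        using inA[OF y False] by auto
      have u: "cmod (F x - h i x) \<le> M + B" if "0 < gap c \<rho> i x" "gap c \<rho> i x < e" for x
      proof -
        have "x \<in> closed_collar n c \<rho> 0"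
          using near_circle_closed_collar[OF i(1), of 0 x] that e d_pos by simp
        then show ?thesis
          using M[of x] B[OF i(1), of x] that norm_triangle_ineq4[of "F x" "h i x"] by simp
      qed
      have "cmod (F' y) \<le> cmod (h i y) + cmod (reflect i (\<lambda>y. F y - h i y) y)"
        using i F'_eq[OF i(1,3)] norm_triangle_ineq by (simp add: R_def)
      also have "\<dots> \<le> B + 4 * (M + B)"
        using i e by (intro add_mono B reflect_bound[OF i(1) e] u) (auto simp: abs_less_iff)
      also have "\<dots> \<le> 5 * (M + B)" using MB by (simp add: algebra_simps)
      finally show ?thesis .
    qed
  qed
  show ?thesis using that[OF 1 _ 2] by (simp add: F'_def)
qed

text \<open>
  Uniqueness for the homogeneous Neumann problem. Where a maximising sequence of \<open>f\<close> accumulates at a point of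
  a circle, the even reflection of \<open>f\<close>, which in the chart is the real part of one holomorphic function,
  has an interior maximum. Thus the open mapping theorem serves in the interior and on the boundary alike, and
  connectedness does the rest.
\<close>
lemma homogeneous_neumann_zero:
  assumes s: "0 < s" "s \<le> d"
    and F: "F holomorphic_on collar n c \<rho> s" and pot: "potential_on (collar n c \<rho> 0) f F"
    and bc: "\<And>i y. i \<le> n \<Longrightarrow> gap c \<rho> i y = 0 \<Longrightarrow> Re ((y - c i) * F y) = 0"
    and y: "y \<in> closed_collar n c \<rho> 0"
  shows "F y = 0"
proof -
  let ?E = "collar n c \<rho> 0" and ?K = "closed_collar n c \<rho> 0"
  have Ks: "?K \<subseteq> collar n c \<rho> s" using s by (intro closed_collar_subset_collar) auto
  have Es: "?E \<subseteq> collar n c \<rho> s" using s by (intro collar_mono) auto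
  have contK: "continuous_on ?K F"
    using holomorphic_on_imp_continuous_on[OF F] Ks continuous_on_subset by blast
  have Ene: "?E \<noteq> {}"
    using y closure_domain by (metis closure_empty empty_iff)
  obtain M where M: "\<And>x. x \<in> ?K \<Longrightarrow> cmod (F x) \<le> M"
    using compact_imp_bounded[OF compact_continuous_image[OF contK compact_closed_collar]]
    unfolding bounded_iff by blast
  have EK: "?E \<subseteq> ?K" by (rule collar_subset_closed_collar) simp
  have osc: "\<bar>f x - f w\<bar> \<le> M * \<rho> 0 * (10 * 2 ^ n)" if "x \<in> ?E" "w \<in> ?E" for x w
    by (rule oscillation_bound[OF pot _ that]) (use M EK in blast)
  obtain x0 where x0: "x0 \<in> ?E" using Ene by blast
  have bdd: "bdd_above (f ` ?E)"
    by (rule bdd_aboveI[of _ "f x0 + M * \<rho> 0 * (10 * 2 ^ n)"]) (use osc x0 in \<open>force simp: abs_le_iff\<close>)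
  define S where "S = (SUP x\<in>?E. f x)"
  have le: "f x \<le> S" if "x \<in> ?E" for x unfolding S_def using bdd that by (rule cSUP_upper2) auto
  have "\<exists>x\<in>?E. S - 1 / real (Suc k) < f x" for k
    using less_cSUP_iff[OF Ene bdd, of "S - 1 / real (Suc k)"] by (simp add: S_def)
  then obtain x where x: "\<And>k. x k \<in> ?E" "\<And>k. S - 1 / real (Suc k) < f (x k)" by metis
  have fx: "(\<lambda>k. f (x k)) \<longlonglongrightarrow> S"
  proof (rule tendsto_sandwich[of "\<lambda>k. S - 1 / real (Suc k)" _ _ "\<lambda>_. S", OF always_eventually always_eventually])
    show "(\<lambda>k. S - 1 / real (Suc k)) \<longlonglongrightarrow> S"
      using tendsto_diff[OF tendsto_const LIMSEQ_Suc[OF lim_1_over_n]] by simp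
    show "\<forall>k. S - 1 / real (Suc k) \<le> f (x k)" using x(2) less_imp_le by blast
    show "\<forall>k. f (x k) \<le> S" using le x(1) by blast
  qed simp
  obtain p r where p: "p \<in> ?K" and r: "strict_mono r" "(x \<circ> r) \<longlonglongrightarrow> p"
    using compact_closed_collar x(1) EK unfolding compact_eq_seq_compact_metric seq_compact_def by (metis subsetD)
  have fr: "(\<lambda>k. f (x (r k))) \<longlonglongrightarrow> S" using LIMSEQ_subseq_LIMSEQ[OF fx r(1)] by (simp add: o_def)
  have xr: "(\<lambda>k. x (r k)) \<longlonglongrightarrow> p" using r(2) by (simp add: o_def)
  have "\<exists>U. open U \<and> U \<noteq> {} \<and> U \<subseteq> ?E \<and> (\<forall>x\<in>U. F x = 0)"
  proof (cases "p \<in> ?E")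
    case True
    then obtain \<epsilon> where \<epsilon>: "\<epsilon> > 0" "ball p \<epsilon> \<subseteq> ?E" using open_collar openE by blast
    have "F holomorphic_on ball p \<epsilon>" using F \<epsilon> Es holomorphic_on_subset by blast
    then obtain Q where Q: "\<And>w. w \<in> ball p \<epsilon> \<Longrightarrow> (Q has_field_derivative F w) (at w)"
      and potQ: "potential_on (ball p \<epsilon>) (\<lambda>w. Re (Q w)) F"
      using primitive_convex[OF _ convex_ball open_ball] by metis
    obtain k where k: "\<And>w. w \<in> ball p \<epsilon> \<Longrightarrow> f w = Re (Q w) + k"
      using potential_unique[OF potential_on_subset[OF pot \<epsilon>(2)] potQ convex_ball] by blast
    have "isCont f p" using potential_onD[OF pot True] has_derivative_continuous by blast
    then have "f p = S"
      using LIMSEQ_unique[OF fr] isCont_tendsto_compose[OF _ xr] by blast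
    then have "Re (Q w) \<le> Re (Q p)" if "w \<in> ball p \<epsilon>" for w
      using k[OF that] k[of p] le[of w] that \<epsilon> by auto
    then have "F w = 0" if "w \<in> ball p \<epsilon>" for w
      using \<epsilon>(1) by (intro Re_max_imp_derivative_zero[where p = p, OF Q open_ball connected_ball _ _ that]) auto
    then show ?thesis using \<epsilon> by (intro exI[of _ "ball p \<epsilon>"]) auto
  next
    case False
    then obtain i where i: "i \<le> n" "gap c \<rho> i p = 0"
      using p by (force simp: collar_def closed_collar_def not_less)
    let ?S = "strip (width \<rho> i s)"
    obtain Q where Q: "\<And>w. w \<in> ?S \<Longrightarrow> (Q has_field_derivative chart_pull i F w) (at w)"
      and fQ: "\<And>w. w \<in> ?S \<Longrightarrow> 0 < Im w \<Longrightarrow> f (chart c \<rho> i w) = Re (Q w)"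
      using chart_pull_potential[OF i(1) s F pot] by blast
    have contQ: "continuous_on ?S Q" using Q DERIV_isCont continuous_at_imp_continuous_on by blast
    \<comment> \<open>The one-form is real on the real axis, hence symmetric, hence so is the real part of its primitive.\<close>
    have hol: "chart_pull i F holomorphic_on ?S"
      using Q open_strip holomorphic_on_open
      by (metis derivative_is_holomorphic)
    have sym: "Re (Q (cnj w)) = Re (Q w)" if w: "w \<in> ?S" for w
    proof -
      have Qc: "((cnj \<circ> Q \<circ> cnj) has_field_derivative cnj (chart_pull i F (cnj w))) (at w)" if "w \<in> ?S" for w
        using has_field_derivative_cnj_cnj[of Q "chart_pull i F (cnj w)" w] Q[OF cnj_strip[OF that]] by simp
      have hc: "(\<lambda>w. cnj (chart_pull i F (cnj w))) holomorphic_on ?S"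
        using Qc open_strip by (rule derivative_is_holomorphic[rotated])
      have real: "cnj (chart_pull i F (cnj w)) - chart_pull i F w = 0" if "w \<in> ?S" for w
      proof (rule analytic_continuation[of "\<lambda>w. cnj (chart_pull i F (cnj w)) - chart_pull i F w" ?S "{w \<in> ?S. w \<in> \<real>}" 0])
        show "(\<lambda>w. cnj (chart_pull i F (cnj w)) - chart_pull i F w) holomorphic_on ?S"
          by (intro holomorphic_intros hc hol)
        have b: "0 < width \<rho> i s" using width_pos i(1) s by blast
        show "0 \<in> ?S" using b by (simp add: strip_def)
        show "0 islimpt {w \<in> ?S. w \<in> \<real>}"
          unfolding islimpt_approachable
        proof (intro allI impI)
          fix \<epsilon> :: real assume "\<epsilon> > 0"
          then show "\<exists>x'\<in>{w \<in> ?S. w \<in> \<real>}. x' \<noteq> 0 \<and> dist x' 0 < \<epsilon>"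
            using b by (intro bexI[of _ "of_real (\<epsilon> / 2)"]) (auto simp: strip_def)
        qed
        show "cnj (chart_pull i F (cnj w)) - chart_pull i F w = 0" if "w \<in> {w \<in> ?S. w \<in> \<real>}" for w
        proof -
          have "gap c \<rho> i (chart c \<rho> i w) = 0" using that by (intro gap_chart_real[OF i(1)]) (simp add: complex_is_Real_iff)
          from bc[OF i(1) this] have "Re ((chart c \<rho> i w - c i) * F (chart c \<rho> i w)) = 0" .
          moreover have "chart_pull i F w = of_real (- side i) * (\<i> * ((chart c \<rho> i w - c i) * F (chart c \<rho> i w)))"
            by (simp add: chart_pull_def)
          ultimately have "chart_pull i F w \<in> \<real>" by (simp add: complex_is_Real_iff)
          moreover have "cnj w = w" using that by (simp add: Reals_cnj_iff)
          ultimately show ?thesis by (simp add: Reals_cnj_iff)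
        qed
      qed (use that open_strip convex_connected[OF convex_strip] in auto)
      have "potential_on ?S (\<lambda>w. Re ((cnj \<circ> Q \<circ> cnj) w)) (chart_pull i F)"
      proof (rule potential_on_Re_primitive)
        show "((cnj \<circ> Q \<circ> cnj) has_field_derivative chart_pull i F w) (at w)" if "w \<in> ?S" for w
          using Qc[OF that] real[OF that] by simp
      qed
      moreover have "potential_on ?S (\<lambda>w. Re (Q w)) (chart_pull i F)"
        by (rule potential_on_Re_primitive[OF Q])
      ultimately obtain k where k: "\<And>w. w \<in> ?S \<Longrightarrow> Re ((cnj \<circ> Q \<circ> cnj) w) = Re (Q w) + k"
        using potential_unique[OF _ _ convex_strip] by blast
      have "0 \<in> ?S" using width_pos[OF i(1) s(1)] by (simp add: strip_def)
      from k[OF this] k[OF w] show ?thesis by simp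
    qed
    have upper: "Re (Q w) \<le> S" if w: "w \<in> ?S" "0 \<le> Im w" for w
    proof -
      obtain W where W: "\<And>k. W k \<in> ?S" "\<And>k. 0 < Im (W k)" "W \<longlonglongrightarrow> w"
        using strip_upper_limit[OF w] by blast
      have "Re (Q (W k)) \<le> S" for k
        using fQ[OF W(1,2)] le[OF chart_in_domain(1)[OF i(1) s W(1,2)]] by metis
      moreover have "(\<lambda>k. Re (Q (W k))) \<longlonglongrightarrow> Re (Q w)"
        using isCont_tendsto_compose[OF DERIV_isCont[OF Q[OF w(1)]] W(3)] by (rule tendsto_Re)
      ultimately show ?thesis by (metis LIMSEQ_le_const2)
    qed
    then have all: "Re (Q w) \<le> S" if w: "w \<in> ?S" for w
      using upper[of w] upper[of "cnj w"] sym[OF w] cnj_strip w by (cases "0 \<le> Im w") auto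
    obtain w0 where w0: "w0 \<in> ?S" "chart c \<rho> i w0 = p" "0 \<le> Im w0"
      using chart_surj_nonneg[OF i(1) s, of p] i s by auto
    have Iw0: "Im w0 = 0" using gap_chart_pos_iff(1)[OF i(1), of w0] w0 i by simp
    \<comment> \<open>The maximising sequence lifts to the chart.\<close>
    have "Re (Q w0) = S"
    proof -
      have pc: "p \<noteq> c i" using chart_minus_nonzero[of \<rho> i c w0] radius_pos[OF i(1)] w0 by auto
      obtain W where W: "W p = w0" "(W has_field_derivative (\<i> * of_real (side i) / (p - c i))) (at p)"
        and chW: "\<And>y. y \<noteq> c i \<Longrightarrow> chart c \<rho> i (W y) = y"
        using chart_local_inverse[of \<rho> i c w0, OF radius_pos[OF i(1)]] unfolding w0(2) by metis
      have lim: "(\<lambda>k. W (x (r k))) \<longlonglongrightarrow> w0"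
        using isCont_tendsto_compose[OF DERIV_isCont[OF W(2)] xr] unfolding W(1) .
      have "eventually (\<lambda>k. x (r k) \<noteq> c i) sequentially"
        using tendsto_imp_eventually_ne[OF xr pc] .
      moreover have "eventually (\<lambda>k. W (x (r k)) \<in> ?S) sequentially"
        using topological_tendstoD[OF lim open_strip w0(1)] .
      ultimately have "eventually (\<lambda>k. Re (Q (W (x (r k)))) = f (x (r k))) sequentially"
      proof eventually_elim
        case (elim k)
        have "0 < gap c \<rho> i (x (r k))" using x(1)[of "r k"] i by (auto simp: collar_def)
        then have "0 < Im (W (x (r k)))"
          using gap_chart_pos_iff(1)[OF i(1), of "W (x (r k))"] chW elim by simp
        from fQ[OF elim(2) this] show ?case using chW[OF elim(1)] by simp
      qed
      note ev = this
      have l: "(\<lambda>k. Re (Q (W (x (r k))))) \<longlonglongrightarrow> Re (Q w0)"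
        using isCont_tendsto_compose[OF DERIV_isCont[OF Q[OF w0(1)]] lim] by (rule tendsto_Re)
      show ?thesis by (rule LIMSEQ_unique[OF Lim_transform_eventually[OF l ev] fr])
    qed
    then have zero: "chart_pull i F w = 0" if "w \<in> ?S" for w
      using all by (intro Re_max_imp_derivative_zero[OF Q open_strip convex_connected[OF convex_strip] w0(1) _ that]) auto
    have z: "F x = 0" if gx: "\<bar>gap c \<rho> i x\<bar> < s / 2" for x
    proof -
      obtain w where w: "w \<in> ?S" "chart c \<rho> i w = x" using chart_surj[OF i(1) s gx] by blast
      then show ?thesis
        using zero[OF w(1)] chart_minus_nonzero[of \<rho> i c w] radius_pos[OF i(1)]
        by (auto simp: chart_pull_def side_def split: if_splits)
    qed
    let ?U = "ball p (s / 2) \<inter> ?E"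
    have "p \<in> closure ?E" using p closure_domain by simp
    then have "?U \<noteq> {}"
      using s by (auto simp: closure_approachable dist_commute disjoint_iff dest!: spec[of _ "s / 2"])
    moreover have "\<bar>gap c \<rho> i x\<bar> < s / 2" if "x \<in> ball p (s / 2)" for x
      using gap_lipschitz[of c \<rho> i x p] i(2) that by (simp add: dist_commute)
    ultimately show ?thesis using z open_collar by (intro exI[of _ ?U]) auto
  qed
  then obtain U where U: "open U" "U \<noteq> {}" "U \<subseteq> ?E" "\<And>x. x \<in> U \<Longrightarrow> F x = 0" by blast
  then obtain u where "u \<in> U" by blast
  have "F x = 0" if "x \<in> ?E" for x
    by (rule analytic_continuation[OF holomorphic_on_subset[OF F Es] open_collar connected_domain U(3)
          subsetD[OF U(3) \<open>u \<in> U\<close>] _ U(4) that])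
       (use \<open>u \<in> U\<close> U(1) interior_limit_point interior_open in auto)
  then have "F x = 0" if "x \<in> closure ?E" for x
    using continuous_constant_on_closure[of ?E F 0 x] contK closure_domain that by simp
  then show ?thesis using y closure_domain by simp
qed

end

section \<open>Uniform gradient bounds by compactness\<close>

lemma tendsto_gap:
  assumes "(\<lambda>k. c k i) \<longlonglongrightarrow> c' i" "(\<lambda>k. \<rho> k i) \<longlonglongrightarrow> \<rho>' i" "y \<longlonglongrightarrow> y'"
  shows "(\<lambda>k. gap (c k) (\<rho> k) i (y k)) \<longlonglongrightarrow> gap c' \<rho>' i y'"
  unfolding gap_side by (intro tendsto_intros assms)

lemma eventually_gap_close:
  assumes c: "\<And>i. i \<le> n \<Longrightarrow> (\<lambda>k. c k i) \<longlonglongrightarrow> c' i"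
    and \<rho>: "\<And>i. i \<le> n \<Longrightarrow> (\<lambda>k. \<rho> k i) \<longlonglongrightarrow> \<rho>' i" and \<delta>: "(0::real) < \<delta>"
  shows "eventually (\<lambda>k. \<forall>i\<le>n. \<forall>y. \<bar>gap (c k) (\<rho> k) i y - gap c' \<rho>' i y\<bar> < \<delta>) sequentially"
proof -
  have "eventually (\<lambda>k. \<forall>i\<in>{..n}. \<forall>y. \<bar>gap (c k) (\<rho> k) i y - gap c' \<rho>' i y\<bar> < \<delta>) sequentially"
  proof (rule eventually_ball_finite)
    show "\<forall>i\<in>{..n}. \<forall>\<^sub>F k in sequentially. \<forall>y. \<bar>gap (c k) (\<rho> k) i y - gap c' \<rho>' i y\<bar> < \<delta>"
    proof
      fix i assume "i \<in> {..n}"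
      then have i: "i \<le> n" and \<delta>3: "0 < \<delta> / 3" using \<delta> by auto
      from tendstoD[OF c[OF i] \<delta>3] tendstoD[OF \<rho>[OF i] \<delta>3]
      show "\<forall>\<^sub>F k in sequentially. \<forall>y. \<bar>gap (c k) (\<rho> k) i y - gap c' \<rho>' i y\<bar> < \<delta>"
      proof eventually_elim
        case (elim k)
        show ?case
        proof
          fix y
          have "\<bar>gap (c k) (\<rho> k) i y - gap c' \<rho>' i y\<bar> \<le> \<delta> / 3 + \<delta> / 3"
            using elim by (intro gap_perturb) (auto simp: dist_real_def)
          then show "\<bar>gap (c k) (\<rho> k) i y - gap c' \<rho>' i y\<bar> < \<delta>" using \<delta> by linarith
        qed
      qed
    qed
  qed simp
  then show ?thesis by (auto elim!: eventually_mono)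
qed

text \<open>
  Moving every circle into the domain by \<open>\<delta>\<close> gives a configuration of the same kind, so statements about
  domains apply to shrunken domains.
\<close>
lemma (in circular_config) shrunk_config:
  assumes "0 \<le> \<delta>" "\<delta> < d"
  shows "circular_config n c (\<lambda>i. \<rho> i - side i * (- \<delta>)) (d - \<delta>)"
    and "collar n c (\<lambda>i. \<rho> i - side i * (- \<delta>)) 0 = collar n c \<rho> (- \<delta>)"
proof -
  have g: "gap c (\<lambda>i. \<rho> i - side i * (- \<delta>)) i y = gap c \<rho> i y - \<delta>" for i y
    by (simp add: gap_def side_def)
  show "circular_config n c (\<lambda>i. \<rho> i - side i * (- \<delta>)) (d - \<delta>)"
  proof
    show "d - \<delta> \<le> \<rho> i - side i * - \<delta>" if "i \<le> n" for i
      using radius_ge[OF that] assms by (cases "i = 0") (auto simp: side_def)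
    show "2 * (d - \<delta>) \<le> gap c (\<lambda>i. \<rho> i - side i * - \<delta>) i y + gap c (\<lambda>i. \<rho> i - side i * - \<delta>) j y"
      if "i \<le> n" "j \<le> n" "i \<noteq> j" for i j y
      using gap_sum[OF that, of y] unfolding g by simp
  qed (use assms c0 in auto)
  show "collar n c (\<lambda>i. \<rho> i - side i * (- \<delta>)) 0 = collar n c \<rho> (- \<delta>)"
    unfolding collar_def g by simp
qed

lemma (in circular_config) collar_interior_margin:
  assumes "y \<in> collar n c \<rho> 0"
  obtains \<delta> where "0 < \<delta>" "\<delta> < d" "y \<in> collar n c \<rho> (- \<delta>)"
proof -
  define A where "A = {d} \<union> (\<lambda>i. gap c \<rho> i y) ` {..n}"
  have A: "finite A" "A \<noteq> {}" by (auto simp: A_def)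
  define \<delta> where "\<delta> = Min A / 2"
  have m: "Min A > 0"
    unfolding Min_gr_iff[OF A] using assms d_pos by (auto simp: collar_def A_def)
  have le: "Min A \<le> x" if "x \<in> A" for x using A that by simp
  have "y \<in> collar n c \<rho> (- \<delta>)"
    unfolding collar_def
  proof (intro CollectI allI impI)
    fix i assume "i \<le> n"
    then have "gap c \<rho> i y \<in> A" by (auto simp: A_def)
    from le[OF this] m show "- (- \<delta>) < gap c \<rho> i y" by (simp add: \<delta>_def)
  qed
  moreover have "d \<in> A" by (simp add: A_def)
  from le[OF this] m d_pos have "0 < \<delta>" "\<delta> < d" by (simp_all add: \<delta>_def)
  ultimately show ?thesis using that by blast
qed

lemma uniform_limit_diagonal:
  assumes "uniform_limit K f g sequentially" "continuous_on K g"
    "eventually (\<lambda>k. y k \<in> K) sequentially" "y' \<in> K" "y \<longlonglongrightarrow> y'"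
  shows "(\<lambda>k. f k (y k)) \<longlonglongrightarrow> (g y' :: complex)"
proof -
  have g: "(\<lambda>k. g (y k)) \<longlonglongrightarrow> g y'"
    by (rule continuous_on_tendsto_compose[OF assms(2,5,4,3)])
  have "(\<lambda>k. f k (y k) - g (y k)) \<longlonglongrightarrow> 0"
  proof (rule tendstoI)
    fix \<epsilon> :: real assume "\<epsilon> > 0"
    from uniform_limitD[OF assms(1) this] assms(3)
    show "eventually (\<lambda>k. dist (f k (y k) - g (y k)) 0 < \<epsilon>) sequentially"
      by eventually_elim (auto simp: dist_norm)
  qed
  from tendsto_add[OF this g] show ?thesis by simp
qed

text \<open>
  The oscillation estimate on the shrunken domains makes the potentials, normalised at one point, Cauchy as soon as
  their gradients converge uniformly there. That the limit is again a potential is seen on small balls by comparison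
  with the real part of a primitive of the limit.
\<close>
lemma potential_limit:
  assumes L: "circular_config n c' \<rho>' d"
    and pot: "\<And>\<delta>. 0 < \<delta> \<Longrightarrow> eventually (\<lambda>k. potential_on (collar n c' \<rho>' (- \<delta>)) (f k) (F k)) sequentially"
    and lim: "\<And>\<delta>. 0 < \<delta> \<Longrightarrow> uniform_limit (collar n c' \<rho>' (- \<delta>)) F g sequentially"
    and hol: "g holomorphic_on collar n c' \<rho>' 0"
  shows "\<exists>f'. potential_on (collar n c' \<rho>' 0) f' g"
proof (cases "collar n c' \<rho>' 0 = {}")
  case True
  then show ?thesis by (simp add: potential_on_def)
next
  case False
  interpret L: circular_config n c' \<rho>' d by (rule L)
  let ?E = "collar n c' \<rho>' 0"
  obtain y0 where y0: "y0 \<in> ?E" using False by blast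
  define u where "u k y = f k y - f k y0" for k y
  have "Cauchy (\<lambda>k. u k y)" if y: "y \<in> ?E" for y
  proof (rule metric_CauchyI)
    fix \<epsilon> :: real assume \<epsilon>: "\<epsilon> > 0"
    obtain \<delta>1 where \<delta>1: "0 < \<delta>1" "\<delta>1 < d" "y \<in> collar n c' \<rho>' (- \<delta>1)" by (rule L.collar_interior_margin[OF y])
    obtain \<delta>2 where \<delta>2: "0 < \<delta>2" "\<delta>2 < d" "y0 \<in> collar n c' \<rho>' (- \<delta>2)" by (rule L.collar_interior_margin[OF y0])
    define \<delta> where "\<delta> = min \<delta>1 \<delta>2"
    have \<delta>: "0 < \<delta>" "\<delta> < d" using \<delta>1 \<delta>2 by (auto simp: \<delta>_def)
    have "y \<in> collar n c' \<rho>' (- \<delta>)" "y0 \<in> collar n c' \<rho>' (- \<delta>)"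
      using \<delta>1(3) \<delta>2(3) collar_mono[of "- \<delta>1" "- \<delta>" n c' \<rho>'] collar_mono[of "- \<delta>2" "- \<delta>" n c' \<rho>']
      by (auto simp: \<delta>_def)
    note yy = this
    interpret D: circular_config n c' "\<lambda>i. \<rho>' i - side i * (- \<delta>)" "d - \<delta>"
      using L.shrunk_config(1) \<delta> by simp
    note eqD = L.shrunk_config(2)[OF less_imp_le[OF \<delta>(1)] \<delta>(2)]
    define C where "C = (\<rho>' 0 - side 0 * (- \<delta>)) * (10 * 2 ^ n)"
    have C: "C > 0" using D.radius_pos[of 0] by (simp add: C_def)
    have "eventually (\<lambda>k. \<forall>x\<in>collar n c' \<rho>' (- \<delta>). dist (F k x) (g x) < \<epsilon> / (4 * C)) sequentially"
      using uniform_limitD[OF lim[OF \<delta>(1)], of "\<epsilon> / (4 * C)"] \<epsilon> C by simp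
    with pot[OF \<delta>(1)] have "eventually (\<lambda>k. potential_on (collar n c' \<rho>' (- \<delta>)) (f k) (F k) \<and>
        (\<forall>x\<in>collar n c' \<rho>' (- \<delta>). dist (F k x) (g x) < \<epsilon> / (4 * C))) sequentially"
      by eventually_elim auto
    then obtain N where N: "\<And>k. k \<ge> N \<Longrightarrow> potential_on (collar n c' \<rho>' (- \<delta>)) (f k) (F k)"
      "\<And>k x. k \<ge> N \<Longrightarrow> x\<in>collar n c' \<rho>' (- \<delta>) \<Longrightarrow> dist (F k x) (g x) < \<epsilon> / (4 * C)"
      unfolding eventually_sequentially by metis
    have "dist (u j y) (u k y) < \<epsilon>" if jk: "j \<ge> N" "k \<ge> N" for j k
    proof -
      have b: "cmod (F j x - F k x) \<le> \<epsilon> / (2 * C)" if "x \<in> collar n c' \<rho>' (- \<delta>)" for x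
      proof -
        have "dist (F j x) (F k x) \<le> \<epsilon> / (4 * C) + \<epsilon> / (4 * C)"
          using N(2)[OF jk(1) that] N(2)[OF jk(2) that] dist_triangle2[of "F j x" "F k x" "g x"] by linarith
        then show ?thesis by (simp add: dist_norm)
      qed
      have "\<bar>(f j y - f k y) - (f j y0 - f k y0)\<bar> \<le> \<epsilon> / (2 * C) * (\<rho>' 0 - side 0 * (- \<delta>)) * (10 * 2 ^ n)"
        using D.oscillation_bound[unfolded eqD, OF potential_on_diff[OF N(1)[OF jk(1)] N(1)[OF jk(2)]] b yy] .
      also have "\<dots> = \<epsilon> / 2" unfolding mult.assoc C_def[symmetric] using C by simp
      finally show ?thesis using \<epsilon> by (simp add: u_def dist_real_def algebra_simps)
    qed
    then show "\<exists>M. \<forall>m\<ge>M. \<forall>n\<ge>M. dist (u m y) (u n y) < \<epsilon>" by blast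
  qed
  then have conv: "(\<lambda>k. u k y) \<longlonglongrightarrow> lim (\<lambda>k. u k y)" if "y \<in> ?E" for y
    using that by (simp add: Cauchy_convergent_iff convergent_LIMSEQ_iff)
  define f' where "f' y = lim (\<lambda>k. u k y)" for y
  have "(f' has_derivative (\<lambda>h. Re (g y * h))) (at y)" if y: "y \<in> ?E" for y
  proof -
    obtain \<delta>1 where \<delta>1: "0 < \<delta>1" "y \<in> collar n c' \<rho>' (- \<delta>1)" by (rule L.collar_interior_margin[OF y])
    define \<delta> where "\<delta> = \<delta>1 / 2"
    have \<delta>: "\<delta> > 0" "y \<in> closed_collar n c' \<rho>' (- (2 * \<delta>))"
      using \<delta>1 collar_subset_closed_collar[of "- \<delta>1" "- \<delta>1" n c' \<rho>'] by (auto simp: \<delta>_def)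
    let ?B = "ball y \<delta>" and ?S = "collar n c' \<rho>' (- \<delta>)"
    have BS: "?B \<subseteq> ?S" using ball_subset_collar[OF \<delta>(2), of \<delta>] by simp
    have SE: "?S \<subseteq> ?E" using \<delta> by (intro collar_mono) simp
    obtain Q where Q: "\<And>w. w \<in> ?B \<Longrightarrow> (Q has_field_derivative g w) (at w)"
      and potQ: "potential_on ?B (\<lambda>w. Re (Q w)) g"
      using primitive_convex[OF holomorphic_on_subset[OF hol order_trans[OF BS SE]] convex_ball open_ball] by metis
    have eq: "f' z = Re (Q z) + (f' y - Re (Q y))" if z: "z \<in> ?B" for z
    proof -
      have "(\<lambda>k. (u k z - Re (Q z)) - (u k y - Re (Q y))) \<longlonglongrightarrow> 0"
      proof (rule tendstoI)
        fix \<epsilon> :: real assume \<epsilon>: "\<epsilon> > 0"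
        have "eventually (\<lambda>k. \<forall>x\<in>?S. dist (F k x) (g x) < \<epsilon> / \<delta>) sequentially"
          using uniform_limitD[OF lim[OF \<delta>(1)], of "\<epsilon> / \<delta>"] \<epsilon> \<delta> by simp
        with pot[OF \<delta>(1)]
        show "eventually (\<lambda>k. dist ((u k z - Re (Q z)) - (u k y - Re (Q y))) 0 < \<epsilon>) sequentially"
        proof eventually_elim
          case (elim k)
          have "\<bar>(f k z - Re (Q z)) - (f k y - Re (Q y))\<bar> \<le> \<epsilon> / \<delta> * cmod (z - y)"
            by (rule potential_lipschitz[OF potential_on_diff[OF potential_on_subset[OF elim(1) BS] potQ] convex_ball])
               (use elim(2) BS z \<delta> in \<open>force simp: dist_norm\<close>)+
          also have "\<dots> < \<epsilon> / \<delta> * \<delta>"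
            using z \<epsilon> \<delta> by (intro mult_strict_left_mono) (auto simp: dist_norm norm_minus_commute)
          also have "\<dots> = \<epsilon>" using \<delta> by simp
          finally show ?case by (simp add: u_def dist_real_def)
        qed
      qed
      moreover have "(\<lambda>k. (u k z - Re (Q z)) - (u k y - Re (Q y))) \<longlonglongrightarrow> (f' z - Re (Q z)) - (f' y - Re (Q y))"
        unfolding f'_def using z BS SE y by (intro tendsto_intros conv) auto
      ultimately have "(f' z - Re (Q z)) - (f' y - Re (Q y)) = 0" using LIMSEQ_unique by blast
      then show ?thesis by simp
    qed
    have "((\<lambda>z. Re (Q z) + (f' y - Re (Q y))) has_derivative (\<lambda>h. Re (g y * h))) (at y)"
      using has_derivative_add[OF potential_onD[OF potQ, of y] has_derivative_const] \<delta> by simp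
    then show ?thesis
      by (rule has_derivative_transform_within_open[of _ _ _ _ ?B]) (auto simp: \<delta>(1) intro: eq[symmetric])
  qed
  then show ?thesis unfolding potential_on_def by blast
qed

text \<open>
  A sequence of gradients of sup norm one, on converging configurations and with inhomogeneities tending to zero, is
  impossible: by reflection and Montel's theorem a subsequence converges uniformly near the limiting closed domain, the limit
  solves the homogeneous problem, and the points where the modulus is one converge to a point where the
  limit does not vanish.
\<close>
lemma no_concentrating_sequence:
  fixes c :: "nat \<Rightarrow> nat \<Rightarrow> complex" and \<rho> :: "nat \<Rightarrow> nat \<Rightarrow> real"
  assumes config: "\<And>k. circular_config n (c k) (\<rho> k) d"
    and c: "\<And>i. i \<le> n \<Longrightarrow> (\<lambda>k. c k i) \<longlonglongrightarrow> c' i"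
    and \<rho>: "\<And>i. i \<le> n \<Longrightarrow> (\<lambda>k. \<rho> k i) \<longlonglongrightarrow> \<rho>' i"
    and e: "0 < e" "e \<le> d"
    and F: "\<And>k. F k holomorphic_on collar n (c k) (\<rho> k) 0"
    and contF: "\<And>k. continuous_on (closed_collar n (c k) (\<rho> k) 0) (F k)"
    and pot: "\<And>k. potential_on (collar n (c k) (\<rho> k) 0) (f k) (F k)"
    and h: "\<And>k i. i \<le> n \<Longrightarrow> h k i holomorphic_on {y. \<bar>gap (c k) (\<rho> k) i y\<bar> < e}"
    and hB: "\<And>k i y. i \<le> n \<Longrightarrow> \<bar>gap (c k) (\<rho> k) i y\<bar> < e \<Longrightarrow> cmod (h k i y) \<le> B k"
    and B: "B \<longlonglongrightarrow> 0"
    and bc: "\<And>k i y. i \<le> n \<Longrightarrow> gap (c k) (\<rho> k) i y = 0 \<Longrightarrow> Re ((y - c k i) * (F k y - h k i y)) = 0"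
    and F1: "\<And>k y. y \<in> closed_collar n (c k) (\<rho> k) 0 \<Longrightarrow> cmod (F k y) \<le> 1"
    and x: "\<And>k. x k \<in> closed_collar n (c k) (\<rho> k) 0" "\<And>k. cmod (F k (x k)) = 1"
  shows False
proof -
  interpret L: circular_config n c' \<rho>' d
  proof
    show "0 < d" using circular_config.d_pos[OF config] .
    have "(\<lambda>k. c k 0) \<longlonglongrightarrow> 0" using circular_config.c0[OF config] by simp
    then show "c' 0 = 0" using c[of 0] LIMSEQ_unique by blast
    show "d \<le> \<rho>' i" if "i \<le> n" for i
      using circular_config.radius_ge[OF config that] LIMSEQ_le_const[OF \<rho>[OF that]] by blast
    show "2 * d \<le> gap c' \<rho>' i y + gap c' \<rho>' j y" if "i \<le> n" "j \<le> n" "i \<noteq> j" for i j y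
    proof -
      have "(\<lambda>k. gap (c k) (\<rho> k) i y + gap (c k) (\<rho> k) j y) \<longlonglongrightarrow> gap c' \<rho>' i y + gap c' \<rho>' j y"
        using that by (intro tendsto_add tendsto_gap c \<rho> tendsto_const) auto
      then show ?thesis
        using circular_config.gap_sum[OF config that, where y = y] LIMSEQ_le_const by blast
    qed
  qed
  obtain B0 where B0: "\<And>k. B k \<le> B0"
    using convergent_imp_Bseq[of B] B unfolding convergent_def Bseq_def by (metis abs_le_D1 real_norm_def)
  define C where "C = 5 * (1 + B0)"
  have "\<forall>k. \<exists>F'. F' holomorphic_on collar n (c k) (\<rho> k) (e / 2) \<and>
      (\<forall>y\<in>closed_collar n (c k) (\<rho> k) 0. F' y = F k y) \<and>
      (\<forall>y\<in>collar n (c k) (\<rho> k) (e / 2). cmod (F' y) \<le> C)"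
  proof
    fix k
    interpret K: circular_config n "c k" "\<rho> k" d by (rule config)
    obtain F' where "F' holomorphic_on collar n (c k) (\<rho> k) (e / 2)"
      "\<And>y. y \<in> closed_collar n (c k) (\<rho> k) 0 \<Longrightarrow> F' y = F k y"
      "\<And>y. y \<in> collar n (c k) (\<rho> k) (e / 2) \<Longrightarrow> cmod (F' y) \<le> 5 * (1 + B k)"
      using K.domain_extension[OF e F contF h bc F1 hB] by metis
    moreover have "5 * (1 + B k) \<le> C" using B0[of k] by (simp add: C_def)
    ultimately show "\<exists>F'. F' holomorphic_on collar n (c k) (\<rho> k) (e / 2) \<and>
      (\<forall>y\<in>closed_collar n (c k) (\<rho> k) 0. F' y = F k y) \<and>
      (\<forall>y\<in>collar n (c k) (\<rho> k) (e / 2). cmod (F' y) \<le> C)" by (meson order_trans)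
  qed
  then obtain Fe where Fe: "\<And>k. Fe k holomorphic_on collar n (c k) (\<rho> k) (e / 2)"
    "\<And>k y. y \<in> closed_collar n (c k) (\<rho> k) 0 \<Longrightarrow> Fe k y = F k y"
    "\<And>k y. y \<in> collar n (c k) (\<rho> k) (e / 2) \<Longrightarrow> cmod (Fe k y) \<le> C" by metis
  let ?U = "collar n c' \<rho>' (e / 4)" and ?K2 = "closed_collar n c' \<rho>' (e / 8)"
  have K2U: "?K2 \<subseteq> ?U" using e by (intro closed_collar_subset_collar) simp
  have "eventually (\<lambda>k. \<forall>i\<le>n. \<forall>y. \<bar>gap (c k) (\<rho> k) i y - gap c' \<rho>' i y\<bar> < e / 8) sequentially"
    by (rule eventually_gap_close[OF c \<rho>]) (use e in auto)
  then obtain N where N': "\<forall>k\<ge>N. \<forall>i\<le>n. \<forall>y. \<bar>gap (c k) (\<rho> k) i y - gap c' \<rho>' i y\<bar> < e / 8"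
    unfolding eventually_sequentially by blast
  have N: "\<bar>gap (c k) (\<rho> k) i y - gap c' \<rho>' i y\<bar> < e / 8" if "k \<ge> N" "i \<le> n" for k i y
    using N' that by blast
  have UN: "?U \<subseteq> collar n (c k) (\<rho> k) (e / 2)" if "k \<ge> N" for k
    unfolding collar_def
  proof (intro Collect_mono impI allI)
    fix y i assume *: "\<forall>i\<le>n. - (e / 4) < gap c' \<rho>' i y" "i \<le> n"
    then have "- (e / 4) < gap c' \<rho>' i y" by blast
    then show "- (e / 2) < gap (c k) (\<rho> k) i y" using N[OF that *(2), of y] e(1) by linarith
  qed
  have KN: "closed_collar n (c k) (\<rho> k) 0 \<subseteq> ?K2" if "k \<ge> N" for k
    unfolding closed_collar_def
  proof (intro Collect_mono impI allI)
    fix y i assume *: "\<forall>i\<le>n. - 0 \<le> gap (c k) (\<rho> k) i y" "i \<le> n"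
    then have "0 \<le> gap (c k) (\<rho> k) i y" by auto
    then show "- (e / 8) \<le> gap c' \<rho>' i y" using N[OF that *(2), of y] by linarith
  qed
  obtain g r where g: "g holomorphic_on ?U" and r: "strict_mono (r :: nat \<Rightarrow> nat)"
    and ul: "\<And>K. compact K \<Longrightarrow> K \<subseteq> ?U \<Longrightarrow> uniform_limit K ((\<lambda>k. Fe (k + N)) \<circ> r) g sequentially"
  proof (rule Montel[of ?U "{g. g holomorphic_on ?U \<and> (\<forall>z\<in>?U. cmod (g z) \<le> C)}" "\<lambda>k. Fe (k + N)"])
    show "range (\<lambda>k. Fe (k + N)) \<subseteq> {g. g holomorphic_on ?U \<and> (\<forall>z\<in>?U. cmod (g z) \<le> C)}"
      using Fe(1,3) UN holomorphic_on_subset by (fastforce simp: subset_iff)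
    show "\<exists>B. \<forall>h\<in>{g. g holomorphic_on ?U \<and> (\<forall>z\<in>?U. cmod (g z) \<le> C)}. \<forall>z\<in>K. cmod (h z) \<le> B"
      if "K \<subseteq> ?U" for K
      using that by (intro exI[of _ C]) auto
  qed (auto simp: open_collar)
  have contg: "continuous_on ?K2 g"
    using holomorphic_on_imp_continuous_on[OF g] K2U continuous_on_subset by blast
  have "x (r k + N) \<in> ?K2" for k by (rule subsetD[OF KN x(1)]) simp
  then obtain p r2 where p: "p \<in> ?K2" and r2: "strict_mono r2" "((\<lambda>k. x (r k + N)) \<circ> r2) \<longlonglongrightarrow> p"
    using compact_closed_collar[of n c' \<rho>' "e / 8"] unfolding compact_eq_seq_compact_metric seq_compact_def by metis
  define \<sigma> where "\<sigma> k = r (r2 k) + N" for k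
  have \<sigma>: "filterlim \<sigma> at_top sequentially"
  proof -
    have "strict_mono \<sigma>" using r r2 by (simp add: strict_mono_def \<sigma>_def)
    then show ?thesis by (rule filterlim_subseq)
  qed
  have \<sigma>N: "\<sigma> k \<ge> N" for k by (simp add: \<sigma>_def)
  have c\<sigma>: "(\<lambda>k. c (\<sigma> k) i) \<longlonglongrightarrow> c' i" and \<rho>\<sigma>: "(\<lambda>k. \<rho> (\<sigma> k) i) \<longlonglongrightarrow> \<rho>' i" if "i \<le> n" for i
    using filterlim_compose[OF c[OF that] \<sigma>] filterlim_compose[OF \<rho>[OF that] \<sigma>] by auto
  have B\<sigma>: "(\<lambda>k. B (\<sigma> k)) \<longlonglongrightarrow> 0" using filterlim_compose[OF B \<sigma>] .
  have ul: "uniform_limit ?K2 (\<lambda>k. Fe (\<sigma> k)) g sequentially"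
    using filterlim_compose[OF ul[OF compact_closed_collar K2U] filterlim_subseq[OF r2(1)]]
    by (simp add: o_def \<sigma>_def)
  have xp: "(\<lambda>k. x (\<sigma> k)) \<longlonglongrightarrow> p" using r2(2) by (simp add: o_def \<sigma>_def)
  have "(\<lambda>k. Fe (\<sigma> k) (x (\<sigma> k))) \<longlonglongrightarrow> g p"
    using x(1) KN[OF \<sigma>N] by (intro uniform_limit_diagonal[OF ul contg _ p xp] always_eventually) auto
  moreover have "cmod (Fe (\<sigma> k) (x (\<sigma> k))) = 1" for k using Fe(2) x by simp
  ultimately have gp: "cmod (g p) = 1"
    using LIMSEQ_unique[OF tendsto_norm, of "\<lambda>k. Fe (\<sigma> k) (x (\<sigma> k))" "g p" 1] by simp
  have pK: "p \<in> closed_collar n c' \<rho>' 0"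
    unfolding closed_collar_def
  proof (intro CollectI allI impI)
    fix i assume i: "i \<le> n"
    have "0 \<le> gap (c (\<sigma> k)) (\<rho> (\<sigma> k)) i (x (\<sigma> k))" for k
      using x(1)[of "\<sigma> k"] i by (auto simp: closed_collar_def)
    then show "- 0 \<le> gap c' \<rho>' i p"
      using LIMSEQ_le_const[OF tendsto_gap[where c = "\<lambda>k. c (\<sigma> k)" and \<rho> = "\<lambda>k. \<rho> (\<sigma> k)" and c' = c' and \<rho>' = \<rho>' and i = i,
          OF c\<sigma>[OF i] \<rho>\<sigma>[OF i] xp]] by auto
  qed
  have bcg: "Re ((y - c' i) * g y) = 0" if i: "i \<le> n" and y: "gap c' \<rho>' i y = 0" for i y
  proof -
    \<comment> \<open>The boundary condition is transported to the limit along points of the moving circles that tend to \<open>y\<close>.\<close>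
    define Y where "Y k = c (\<sigma> k) i + of_real (\<rho> (\<sigma> k) i / \<rho>' i) * (y - c' i)" for k
    have \<rho>'0: "0 < \<rho>' i" using L.radius_pos[OF i] .
    have ny: "cmod (y - c' i) = \<rho>' i" using y by (auto simp: gap_def split: if_splits)
    have \<rho>k: "0 < \<rho> k i" for k using circular_config.radius_pos[OF config i] .
    have nY: "cmod (Y k - c (\<sigma> k) i) = \<rho> (\<sigma> k) i" for k
      using \<rho>k[of "\<sigma> k"] \<rho>'0 by (simp add: Y_def norm_mult norm_divide ny)
    have gY: "gap (c (\<sigma> k)) (\<rho> (\<sigma> k)) i (Y k) = 0" for k using nY by (simp add: gap_side)
    have YK: "Y k \<in> closed_collar n (c (\<sigma> k)) (\<rho> (\<sigma> k)) 0" for k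
      using circular_config.circle_point_in_closed_collar[OF config i gY] .
    have "(\<lambda>k. complex_of_real (\<rho> (\<sigma> k) i / \<rho>' i)) \<longlonglongrightarrow> of_real (\<rho>' i / \<rho>' i)"
      using \<rho>'0 by (intro tendsto_intros \<rho>\<sigma> i) auto
    from tendsto_add[OF c\<sigma>[OF i] tendsto_mult[OF this tendsto_const]]
    have "Y \<longlonglongrightarrow> c' i + of_real (\<rho>' i / \<rho>' i) * (y - c' i)"
      unfolding Y_def[abs_def] .
    then have Yy: "Y \<longlonglongrightarrow> y" using \<rho>'0 by simp
    have yK2: "y \<in> ?K2"
      using L.circle_point_in_closed_collar[OF i y] e unfolding closed_collar_def by fastforce
    have "(\<lambda>k. Fe (\<sigma> k) (Y k)) \<longlonglongrightarrow> g y"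
      using YK KN[OF \<sigma>N] by (intro uniform_limit_diagonal[OF ul contg _ yK2 Yy] always_eventually) auto
    then have 1: "(\<lambda>k. Re ((Y k - c (\<sigma> k) i) * Fe (\<sigma> k) (Y k))) \<longlonglongrightarrow> Re ((y - c' i) * g y)"
      by (intro tendsto_intros Yy c\<sigma> i)
    have 2: "(\<lambda>k. Re ((Y k - c (\<sigma> k) i) * Fe (\<sigma> k) (Y k))) \<longlonglongrightarrow> 0"
    proof (rule Lim_null_comparison[OF always_eventually])
      show "(\<lambda>k. \<rho> (\<sigma> k) i * B (\<sigma> k)) \<longlonglongrightarrow> 0"
        using tendsto_mult[OF \<rho>\<sigma>[OF i] B\<sigma>] by simp
      show "\<forall>k. norm (Re ((Y k - c (\<sigma> k) i) * Fe (\<sigma> k) (Y k))) \<le> \<rho> (\<sigma> k) i * B (\<sigma> k)"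
      proof
        fix k
        have "Re ((Y k - c (\<sigma> k) i) * Fe (\<sigma> k) (Y k)) = Re ((Y k - c (\<sigma> k) i) * h (\<sigma> k) i (Y k))"
          using bc[OF i gY[of k]] Fe(2)[OF YK[of k]] by (simp add: algebra_simps)
        moreover have "\<bar>Re ((Y k - c (\<sigma> k) i) * h (\<sigma> k) i (Y k))\<bar> \<le> \<rho> (\<sigma> k) i * cmod (h (\<sigma> k) i (Y k))"
          using norm_Re_mult_le[of "Y k - c (\<sigma> k) i" "h (\<sigma> k) i (Y k)"] nY[of k] by simp
        moreover have "\<rho> (\<sigma> k) i * cmod (h (\<sigma> k) i (Y k)) \<le> \<rho> (\<sigma> k) i * B (\<sigma> k)"
          using \<rho>k[of "\<sigma> k"] gY[of k] e by (intro mult_left_mono hB i) auto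
        ultimately show "norm (Re ((Y k - c (\<sigma> k) i) * Fe (\<sigma> k) (Y k))) \<le> \<rho> (\<sigma> k) i * B (\<sigma> k)" by simp
      qed
    qed
    show ?thesis using LIMSEQ_unique[OF 1 2] .
  qed
  have sub: "collar n c' \<rho>' (- \<delta>) \<subseteq> ?K2" if "0 < \<delta>" for \<delta>
    using that e by (intro collar_subset_closed_collar) simp
  have "\<exists>f'. potential_on (collar n c' \<rho>' 0) f' g"
  proof (rule potential_limit[OF L.circular_config_axioms, of "\<lambda>k. f (\<sigma> k)" "\<lambda>k. Fe (\<sigma> k)"])
    fix \<delta> :: real assume \<delta>: "0 < \<delta>"
    show "uniform_limit (collar n c' \<rho>' (- \<delta>)) (\<lambda>k. Fe (\<sigma> k)) g sequentially"
      using uniform_limit_on_subset[OF ul sub[OF \<delta>]] .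
    have "eventually (\<lambda>k. \<forall>i\<le>n. \<forall>y. \<bar>gap (c (\<sigma> k)) (\<rho> (\<sigma> k)) i y - gap c' \<rho>' i y\<bar> < \<delta>) sequentially"
      by (rule eventually_gap_close[OF c\<sigma> \<rho>\<sigma> \<delta>])
    then show "\<forall>\<^sub>F k in sequentially. potential_on (collar n c' \<rho>' (- \<delta>)) (f (\<sigma> k)) (Fe (\<sigma> k))"
    proof eventually_elim
      case (elim k)
      have "collar n c' \<rho>' (- \<delta>) \<subseteq> collar n (c (\<sigma> k)) (\<rho> (\<sigma> k)) 0"
        unfolding collar_def
      proof (intro Collect_mono impI allI)
        fix y i assume *: "\<forall>i\<le>n. - (- \<delta>) < gap c' \<rho>' i y" "i \<le> n"
        then have "\<delta> < gap c' \<rho>' i y" by simp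
        moreover have "\<bar>gap (c (\<sigma> k)) (\<rho> (\<sigma> k)) i y - gap c' \<rho>' i y\<bar> < \<delta>" using elim *(2) by blast
        ultimately show "- 0 < gap (c (\<sigma> k)) (\<rho> (\<sigma> k)) i y" by linarith
      qed
      from potential_on_subset[OF pot this]
      show ?case
        using Fe(2)[of _ "\<sigma> k"] collar_subset_closed_collar[of 0 0 n "c (\<sigma> k)" "\<rho> (\<sigma> k)"]
          \<open>collar n c' \<rho>' (- \<delta>) \<subseteq> _\<close>
        unfolding potential_on_def by (metis order_refl subsetD)
    qed
  next
    show "g holomorphic_on collar n c' \<rho>' 0"
      using e by (intro holomorphic_on_subset[OF g] collar_mono) simp
  qed
  then obtain f' where "potential_on (collar n c' \<rho>' 0) f' g" by blast
  then have "g p = 0"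
    using L.homogeneous_neumann_zero[of "e / 4" g f' p] e g bcg pK by simp
  then show False using gp by simp
qed

text \<open>
  Dividing by the maximum of the modulus turns a failure of the bound into a sequence that concentrates; compactness of
  \<open>T\<close> makes its configurations converge.
\<close>
theorem uniform_gradient_bound:
  fixes c :: "real \<Rightarrow> nat \<Rightarrow> complex" and \<rho> :: "real \<Rightarrow> nat \<Rightarrow> real"
  assumes T: "compact T"
    and config: "\<And>t. t \<in> T \<Longrightarrow> circular_config n (c t) (\<rho> t) d"
    and c: "\<And>i. i \<le> n \<Longrightarrow> continuous_on T (\<lambda>t. c t i)"
    and \<rho>: "\<And>i. i \<le> n \<Longrightarrow> continuous_on T (\<lambda>t. \<rho> t i)"
    and e: "0 < e" "e \<le> d"
    and F: "\<And>t. t \<in> T \<Longrightarrow> F t holomorphic_on collar n (c t) (\<rho> t) 0"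
    and contF: "\<And>t. t \<in> T \<Longrightarrow> continuous_on (closed_collar n (c t) (\<rho> t) 0) (F t)"
    and pot: "\<And>t. t \<in> T \<Longrightarrow> potential_on (collar n (c t) (\<rho> t) 0) (f t) (F t)"
    and h: "\<And>t i. t \<in> T \<Longrightarrow> i \<le> n \<Longrightarrow> h t i holomorphic_on {y. \<bar>gap (c t) (\<rho> t) i y\<bar> < e}"
    and hB: "\<And>t i y. t \<in> T \<Longrightarrow> i \<le> n \<Longrightarrow> \<bar>gap (c t) (\<rho> t) i y\<bar> < e \<Longrightarrow> cmod (h t i y) \<le> B"
    and bc: "\<And>t i y. t \<in> T \<Longrightarrow> i \<le> n \<Longrightarrow> gap (c t) (\<rho> t) i y = 0 \<Longrightarrow> Re ((y - c t i) * (F t y - h t i y)) = 0"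
  shows "\<exists>M. \<forall>t\<in>T. \<forall>y\<in>closed_collar n (c t) (\<rho> t) 0. cmod (F t y) \<le> M"
proof (rule ccontr)
  assume contra: "\<not> ?thesis"
  have "\<forall>k. \<exists>t x. t \<in> T \<and> x \<in> closed_collar n (c t) (\<rho> t) 0 \<and> real (Suc k) < cmod (F t x) \<and>
      (\<forall>y\<in>closed_collar n (c t) (\<rho> t) 0. cmod (F t y) \<le> cmod (F t x))"
  proof
    fix k
    obtain t y where t: "t \<in> T" "y \<in> closed_collar n (c t) (\<rho> t) 0" "real (Suc k) < cmod (F t y)"
      using contra by (meson not_le)
    have "\<exists>x\<in>closed_collar n (c t) (\<rho> t) 0. \<forall>y\<in>closed_collar n (c t) (\<rho> t) 0. cmod (F t y) \<le> cmod (F t x)"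
      using t by (intro continuous_attains_sup compact_closed_collar continuous_on_norm contF) auto
    with t show "\<exists>t x. t \<in> T \<and> x \<in> closed_collar n (c t) (\<rho> t) 0 \<and> real (Suc k) < cmod (F t x) \<and>
      (\<forall>y\<in>closed_collar n (c t) (\<rho> t) 0. cmod (F t y) \<le> cmod (F t x))"
      by (meson less_le_trans)
  qed
  then obtain s x where s: "\<And>k. s k \<in> T" and x: "\<And>k. x k \<in> closed_collar n (c (s k)) (\<rho> (s k)) 0"
    "\<And>k. real (Suc k) < cmod (F (s k) (x k))"
    "\<And>k y. y \<in> closed_collar n (c (s k)) (\<rho> (s k)) 0 \<Longrightarrow> cmod (F (s k) y) \<le> cmod (F (s k) (x k))"
    by metis
  obtain t r where t: "t \<in> T" and r: "strict_mono r" "(s \<circ> r) \<longlonglongrightarrow> t"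
    using T s unfolding compact_eq_seq_compact_metric seq_compact_def by metis
  define \<tau> where "\<tau> k = s (r k)" for k
  have \<tau>: "\<tau> k \<in> T" for k using s by (simp add: \<tau>_def)
  have \<tau>t: "\<tau> \<longlonglongrightarrow> t" using r(2) by (simp add: \<tau>_def[abs_def] o_def)
  define m where "m k = cmod (F (\<tau> k) (x (r k)))" for k
  have mk: "real k < m k" for k
  proof -
    have "real k \<le> real (r k)" using seq_suble[OF r(1)] by simp
    also have "\<dots> < m k" using x(2)[of "r k"] by (simp add: m_def \<tau>_def)
    finally show ?thesis .
  qed
  have m0: "0 < m k" for k using mk[of k] by (meson le_less_trans of_nat_0_le_iff)
  show False
  proof (rule no_concentrating_sequence[where c = "\<lambda>k. c (\<tau> k)" and \<rho> = "\<lambda>k. \<rho> (\<tau> k)" and c' = "c t" and \<rho>' = "\<rho> t"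
        and F = "\<lambda>k y. of_real (inverse (m k)) * F (\<tau> k) y" and f = "\<lambda>k y. inverse (m k) * f (\<tau> k) y"
        and h = "\<lambda>k i y. of_real (inverse (m k)) * h (\<tau> k) i y" and B = "\<lambda>k. inverse (m k) * B"
        and x = "\<lambda>k. x (r k)", OF config[OF \<tau>] _ _ e])
    show "(\<lambda>k. c (\<tau> k) i) \<longlonglongrightarrow> c t i" if "i \<le> n" for i
      by (rule continuous_on_tendsto_compose[OF c[OF that] \<tau>t t]) (simp add: \<tau>)
    show "(\<lambda>k. \<rho> (\<tau> k) i) \<longlonglongrightarrow> \<rho> t i" if "i \<le> n" for i
      by (rule continuous_on_tendsto_compose[OF \<rho>[OF that] \<tau>t t]) (simp add: \<tau>)
    show "(\<lambda>k. inverse (m k) * B) \<longlonglongrightarrow> 0"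
    proof -
      have "filterlim m at_top sequentially"
        by (rule filterlim_at_top_mono[OF filterlim_real_sequentially]) (auto intro!: always_eventually less_imp_le mk)
      then have "(\<lambda>k. inverse (m k)) \<longlonglongrightarrow> 0" by (rule tendsto_inverse_0_at_top)
      from tendsto_mult_left_zero[OF this] show ?thesis .
    qed
    show "cmod (of_real (inverse (m k)) * F (\<tau> k) y) \<le> 1"
      if "y \<in> closed_collar n (c (\<tau> k)) (\<rho> (\<tau> k)) 0" for k y
    proof -
      have "cmod (F (\<tau> k) y) \<le> m k" using x(3)[of y "r k"] that by (simp add: m_def \<tau>_def)
      then have "inverse (m k) * cmod (F (\<tau> k) y) \<le> 1" using m0[of k] by (simp add: field_simps)
      then show ?thesis using m0[of k] by (simp add: norm_mult norm_inverse)
    qed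
    show "cmod (of_real (inverse (m k)) * F (\<tau> k) (x (r k))) = 1" for k
      using m0[of k] by (simp add: norm_mult norm_inverse flip: m_def)
    show "x (r k) \<in> closed_collar n (c (\<tau> k)) (\<rho> (\<tau> k)) 0" for k using x(1) by (simp add: \<tau>_def)
    show "cmod (of_real (inverse (m k)) * h (\<tau> k) i y) \<le> inverse (m k) * B"
      if "i \<le> n" "\<bar>gap (c (\<tau> k)) (\<rho> (\<tau> k)) i y\<bar> < e" for k i y
      using hB[OF \<tau> that] m0[of k] by (simp add: norm_mult norm_inverse)
    show "Re ((y - c (\<tau> k) i) * (of_real (inverse (m k)) * F (\<tau> k) y - of_real (inverse (m k)) * h (\<tau> k) i y)) = 0"
      if "i \<le> n" "gap (c (\<tau> k)) (\<rho> (\<tau> k)) i y = 0" for k i y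
    proof -
      have "(y - c (\<tau> k) i) * (of_real (inverse (m k)) * F (\<tau> k) y - of_real (inverse (m k)) * h (\<tau> k) i y)
          = of_real (inverse (m k)) * ((y - c (\<tau> k) i) * (F (\<tau> k) y - h (\<tau> k) i y))"
        by (simp add: algebra_simps)
      moreover have "Re (of_real a * z) = a * Re z" for a z by simp
      ultimately show ?thesis using bc[OF \<tau> that] by (simp only: mult_zero_right)
    qed
    show "potential_on (collar n (c (\<tau> k)) (\<rho> (\<tau> k)) 0) (\<lambda>y. inverse (m k) * f (\<tau> k) y)
        (\<lambda>y. of_real (inverse (m k)) * F (\<tau> k) y)" for k
      by (rule potential_on_cmult[OF pot[OF \<tau>]])
  qed (use \<tau> in \<open>auto intro!: holomorphic_intros F h continuous_intros contF\<close>)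
qed

section \<open>The stream function near the boundary\<close>

text \<open>
  Bounds at a single point, closed under products and compositions with explicit constants. These constants are what
  the uniformity in time of the final estimate rests on.
\<close>
definition deriv_bounded :: "(complex \<Rightarrow> 'b::real_normed_vector) \<Rightarrow> complex \<Rightarrow> real \<Rightarrow> real \<Rightarrow> bool" where
  "deriv_bounded f y A B \<longleftrightarrow>
     norm (f y) \<le> A \<and> (\<exists>f'. (f has_derivative f') (at y) \<and> (\<forall>h. norm (f' h) \<le> B * norm h))"

lemma deriv_boundedI:
  "norm (f y) \<le> A \<Longrightarrow> (f has_derivative f') (at y) \<Longrightarrow> (\<And>h. norm (f' h) \<le> B * norm h) \<Longrightarrow> deriv_bounded f y A B"
  unfolding deriv_bounded_def by blast

lemma deriv_bounded_nonneg:
  assumes "deriv_bounded f y A B" shows "0 \<le> A" "0 \<le> B"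
proof -
  show "0 \<le> A" using assms norm_ge_zero order_trans unfolding deriv_bounded_def by blast
  obtain f' where "(f has_derivative f') (at y)" "\<And>h. norm (f' h) \<le> B * norm h"
    using assms unfolding deriv_bounded_def by blast
  from this(2)[of 1] show "0 \<le> B" by (simp add: order_trans[OF norm_ge_zero])
qed

lemma deriv_bounded_mono:
  assumes "deriv_bounded f y A B" "A \<le> A'" "B \<le> B'" shows "deriv_bounded f y A' B'"
proof -
  obtain f' where f': "norm (f y) \<le> A" "(f has_derivative f') (at y)" "\<And>h. norm (f' h) \<le> B * norm h"
    using assms(1) unfolding deriv_bounded_def by blast
  show ?thesis
  proof (rule deriv_boundedI[OF _ f'(2)])
    show "norm (f' h) \<le> B' * norm h" for h
      by (rule order_trans[OF f'(3) mult_right_mono[OF assms(3) norm_ge_zero]])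
  qed (use f'(1) assms(2) in simp)
qed

lemma deriv_bounded_sharpen:
  "deriv_bounded f y A B \<Longrightarrow> norm (f y) \<le> A' \<Longrightarrow> deriv_bounded f y A' B"
  unfolding deriv_bounded_def by blast

lemma deriv_bounded_add:
  assumes "deriv_bounded f y A B" "deriv_bounded g y A' B'"
  shows "deriv_bounded (\<lambda>y. f y + g y) y (A + A') (B + B')"
proof -
  obtain f' where f': "norm (f y) \<le> A" "(f has_derivative f') (at y)" "\<And>h. norm (f' h) \<le> B * norm h"
    using assms(1) unfolding deriv_bounded_def by blast
  obtain g' where g': "norm (g y) \<le> A'" "(g has_derivative g') (at y)" "\<And>h. norm (g' h) \<le> B' * norm h"
    using assms(2) unfolding deriv_bounded_def by blast
  show ?thesis
  proof (rule deriv_boundedI[OF _ has_derivative_add[OF f'(2) g'(2)]])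
    show "norm (f y + g y) \<le> A + A'" using f' g' norm_triangle_mono by blast
    show "norm (f' h + g' h) \<le> (B + B') * norm h" for h
      using norm_triangle_mono[OF f'(3) g'(3)] by (simp add: distrib_right)
  qed
qed

lemma deriv_bounded_mult:
  fixes f g :: "complex \<Rightarrow> 'b::real_normed_algebra"
  assumes "deriv_bounded f y A B" "deriv_bounded g y A' B'"
  shows "deriv_bounded (\<lambda>y. f y * g y) y (A * A') (A * B' + B * A')"
proof -
  obtain f' where f': "norm (f y) \<le> A" "(f has_derivative f') (at y)" "\<And>h. norm (f' h) \<le> B * norm h"
    using assms(1) unfolding deriv_bounded_def by blast
  obtain g' where g': "norm (g y) \<le> A'" "(g has_derivative g') (at y)" "\<And>h. norm (g' h) \<le> B' * norm h"
    using assms(2) unfolding deriv_bounded_def by blast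
  note nn = deriv_bounded_nonneg[OF assms(1)] deriv_bounded_nonneg[OF assms(2)]
  show ?thesis
  proof (rule deriv_boundedI[OF _ has_derivative_mult[OF f'(2) g'(2)]])
    show "norm (f y * g y) \<le> A * A'"
      using f'(1) g'(1) nn by (intro order_trans[OF norm_mult_ineq] mult_mono) auto
    show "norm (f y * g' h + f' h * g y) \<le> (A * B' + B * A') * norm h" for h
    proof -
      have "norm (f y * g' h) \<le> A * (B' * norm h)"
        using f'(1) g'(3) nn by (intro order_trans[OF norm_mult_ineq] mult_mono) auto
      moreover have "norm (f' h * g y) \<le> (B * norm h) * A'"
        using f'(3) g'(1) nn by (intro order_trans[OF norm_mult_ineq] mult_mono) auto
      ultimately show ?thesis
        using norm_triangle_mono by (fastforce simp: algebra_simps)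
    qed
  qed
qed

lemma deriv_bounded_linear:
  assumes "deriv_bounded f y A B" "bounded_linear L" "\<And>x. norm (L x) \<le> k * norm x" "0 \<le> k"
  shows "deriv_bounded (\<lambda>y. L (f y)) y (k * A) (k * B)"
proof -
  obtain f' where f': "norm (f y) \<le> A" "(f has_derivative f') (at y)" "\<And>h. norm (f' h) \<le> B * norm h"
    using assms(1) unfolding deriv_bounded_def by blast
  show ?thesis
  proof (rule deriv_boundedI[OF _ bounded_linear.has_derivative[OF assms(2) f'(2)]])
    show "norm (L (f y)) \<le> k * A" using assms(3)[of "f y"] mult_left_mono[OF f'(1) assms(4)] by linarith
    show "norm (L (f' h)) \<le> k * B * norm h" for h
      using assms(3)[of "f' h"] mult_left_mono[OF f'(3)[of h] assms(4)] by (simp add: mult.assoc)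
  qed
qed

lemma deriv_bounded_of_real:
  "deriv_bounded u y A B \<Longrightarrow> deriv_bounded (\<lambda>y. complex_of_real (u y)) y A B"
  using deriv_bounded_linear[of u y A B complex_of_real 1] bounded_linear_of_real by auto

lemma deriv_bounded_neg_Im:
  "deriv_bounded g y A B \<Longrightarrow> deriv_bounded (\<lambda>y. - Im (g y)) y A B"
  using deriv_bounded_linear[of g y A B "\<lambda>z. - Im z" 1] abs_Im_le_cmod
    bounded_linear_minus[OF bounded_linear_Im] by auto

lemma deriv_bounded_cnj:
  "deriv_bounded g y A B \<Longrightarrow> deriv_bounded (\<lambda>y. cnj (g y)) y A B"
  using deriv_bounded_linear[of g y A B cnj 1] bounded_linear_cnj by auto

lemma deriv_bounded_real_compose:
  assumes "deriv_bounded u y A B" "(g has_real_derivative g') (at (u y))" "\<bar>g (u y)\<bar> \<le> A'" "\<bar>g'\<bar> \<le> B'"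
  shows "deriv_bounded (\<lambda>y. g (u y)) y A' (B' * B)"
proof -
  obtain u' where u': "(u has_derivative u') (at y)" "\<And>h. norm (u' h) \<le> B * norm h"
    using assms(1) unfolding deriv_bounded_def by blast
  show ?thesis
  proof (rule deriv_boundedI[OF _ has_derivative_compose[OF u'(1) assms(2)[unfolded has_field_derivative_def]]])
    show "norm (g (u y)) \<le> A'" using assms by simp
    show "norm (g' * u' h) \<le> B' * B * norm h" for h
      using mult_mono[OF assms(4) u'(2)[of h]] assms(4) by (simp add: abs_mult mult.assoc)
  qed
qed

lemma deriv_bounded_complex_compose:
  assumes "deriv_bounded u y A B" "(g has_field_derivative g') (at (u y))" "cmod (g (u y)) \<le> A'" "cmod g' \<le> B'"
  shows "deriv_bounded (\<lambda>y. g (u y)) y A' (B' * B)"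
proof -
  obtain u' where u': "(u has_derivative u') (at y)" "\<And>h. norm (u' h) \<le> B * norm h"
    using assms(1) unfolding deriv_bounded_def by blast
  show ?thesis
  proof (rule deriv_boundedI[OF _ has_derivative_compose[OF u'(1) assms(2)[unfolded has_field_derivative_def]]])
    show "norm (g (u y)) \<le> A'" using assms by simp
    show "norm (g' * u' h) \<le> B' * B * norm h" for h
      using mult_mono[OF assms(4) u'(2)[of h]] norm_ge_zero[of g'] assms(4)
      by (simp add: norm_mult mult.assoc order_trans[OF norm_ge_zero])
  qed
qed

lemma deriv_bounded_field:
  assumes "(g has_field_derivative g') (at y)" "cmod (g y) \<le> A" "cmod g' \<le> B"
  shows "deriv_bounded g y A B"
  by (rule deriv_boundedI[OF assms(2) assms(1)[unfolded has_field_derivative_def]])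
     (simp add: norm_mult mult_right_mono assms(3))

lemma deriv_bounded_const: "deriv_bounded (\<lambda>y. k) y (norm k) 0"
  by (rule deriv_boundedI[OF _ has_derivative_const]) auto

lemma deriv_bounded_norm:
  assumes "y \<noteq> p" "cmod (y - p) \<le> R" shows "deriv_bounded (\<lambda>y. cmod (y - p)) y R 1"
proof (rule deriv_boundedI)
  have "((\<lambda>y. y - p) has_derivative (\<lambda>h. h)) (at y)" by (auto intro!: derivative_eq_intros)
  from has_derivative_compose[OF this has_derivative_norm] assms(1)
  show "((\<lambda>y. cmod (y - p)) has_derivative (\<lambda>h. inner h (sgn (y - p)))) (at y)" by simp
  show "norm (inner h (sgn (y - p))) \<le> 1 * norm h" for h
    using Cauchy_Schwarz_ineq2[of h "sgn (y - p)"] assms(1) by (simp add: norm_sgn)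
qed (use assms in simp)

lemma deriv_bounded_sgn:
  assumes a: "0 < a" "a \<le> cmod (y - p)" and R: "cmod (y - p) \<le> R"
  shows "deriv_bounded (\<lambda>y. sgn (y - p)) y 1 (R / a\<^sup>2 + 1 / a)"
proof -
  have ne: "y \<noteq> p" using a by auto
  let ?N = "cmod (y - p)"
  have i: "inverse ?N \<le> 1 / a" using a le_imp_inverse_le[of a ?N] by (simp add: inverse_eq_divide)
  have "deriv_bounded (\<lambda>y. inverse (cmod (y - p))) y (1 / a) (1 / a\<^sup>2 * 1)"
  proof (rule deriv_bounded_real_compose[OF deriv_bounded_norm[OF ne R]])
    show "(inverse has_real_derivative - (inverse ?N)\<^sup>2) (at ?N)"
      using DERIV_inverse[of ?N] ne by (simp add: numeral_2_eq_2)
    show "\<bar>inverse ?N\<bar> \<le> 1 / a" using i by simp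
    have "(inverse ?N)\<^sup>2 \<le> (1 / a)\<^sup>2" using i by (intro power_mono) auto
    then show "\<bar>- (inverse ?N)\<^sup>2\<bar> \<le> 1 / a\<^sup>2" by (simp add: power_divide)
  qed
  moreover have "deriv_bounded (\<lambda>y. y - p) y R 1"
    by (rule deriv_bounded_field[where g' = 1]) (use R in \<open>auto intro!: derivative_eq_intros\<close>)
  ultimately have "deriv_bounded (\<lambda>y. (y - p) * of_real (inverse (cmod (y - p)))) y (R * (1 / a)) (R * (1 / a\<^sup>2 * 1) + 1 * (1 / a))"
    by (intro deriv_bounded_mult deriv_bounded_of_real)
  moreover have "(\<lambda>y. (y - p) * of_real (inverse (cmod (y - p)))) = (\<lambda>y. sgn (y - p))"
    by (rule ext) (simp add: sgn_eq divide_inverse)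
  ultimately have "deriv_bounded (\<lambda>y. sgn (y - p)) y (R * (1 / a)) (R / a\<^sup>2 + 1 / a)" by simp
  then show ?thesis by (rule deriv_bounded_sharpen) (simp add: norm_sgn)
qed

text \<open>
  The data of the stream function at one time: \<open>f\<close> is the second potential, \<open>F\<close> its complex gradient,
  already extended across the circles, and \<open>D k\<close> is the \<open>k\<close>-th derivative of the cutoff.
\<close>
locale stream_config = circular_config +
  fixes f :: "complex \<Rightarrow> real" and F :: "complex \<Rightarrow> complex" and s :: real
    and \<zeta> :: "real \<Rightarrow> real" and D :: "nat \<Rightarrow> real \<Rightarrow> real"
  assumes s: "0 < s" "s \<le> d"
    and F: "F holomorphic_on collar n c \<rho> s"
    and pot: "potential_on (collar n c \<rho> 0) f F"
    and contf: "continuous_on (closed_collar n c \<rho> 0) f"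
    and D0: "D 0 = \<zeta>"
    and D: "\<And>k x. 0 \<le> x \<Longrightarrow> (D k has_real_derivative D (Suc k) x) (at x within {0..})"
    and \<zeta>1: "\<And>x. 1 \<le> x \<Longrightarrow> \<zeta> x = 0"
begin

definition proj :: "nat \<Rightarrow> complex \<Rightarrow> complex" where
  "proj i y = c i + of_real (\<rho> i) * sgn (y - c i)"

text \<open>
  The derivative of \<open>f\<close> with respect to the angle, on the circle.
\<close>
definition torque :: "nat \<Rightarrow> complex \<Rightarrow> real" where
  "torque i y = - Im ((y - c i) * F y)"

definition depth :: "nat \<Rightarrow> complex \<Rightarrow> real" where
  "depth i y = gap c \<rho> i y / (d / 2)"

text \<open>
  The gradient of \<open>\<zeta> (depth i y) * f (proj i y)\<close>, the term subtracted from \<open>f\<close> near the circle: the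
  first summand is tangential, the second one radial.
\<close>
definition correction :: "nat \<Rightarrow> complex \<Rightarrow> complex" where
  "correction i y =
     of_real (\<zeta> (depth i y)) * (of_real (torque i (proj i y)) * cnj (- \<i> / (y - c i)))
     + of_real (f (proj i y) * (D 1 (depth i y) * (2 / d * side i))) * sgn (y - c i)"

text \<open>
  With the factor \<open>3 / 4\<close> the shells overlap the region where all gaps exceed \<open>d / 2\<close> and the cutoff
  vanishes, and they stay at distance at least \<open>d / 4\<close> from the centres.
\<close>
definition shell :: "nat \<Rightarrow> complex set" where
  "shell i = {y. 0 < gap c \<rho> i y \<and> gap c \<rho> i y < 3 * d / 4}"

abbreviation \<psi> :: "complex \<Rightarrow> real" where "\<psi> \<equiv> stream_fun n c \<rho> d \<zeta> f"

lemma open_shell: "open (shell i)"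
  unfolding shell_def by (intro open_Collect_conj open_Collect_less continuous_intros)

lemma shell_nonzero:
  assumes "i \<le> n" "y \<in> shell i" shows "y \<noteq> c i" "d / 4 \<le> cmod (y - c i)"
  using cmod_pos_near_circle[OF assms(1), of y] assms d_pos by (auto simp: shell_def)

lemma gap_proj: "i \<le> n \<Longrightarrow> y \<noteq> c i \<Longrightarrow> gap c \<rho> i (proj i y) = 0"
  using radius_pos[of i] by (simp add: gap_side proj_def norm_mult norm_sgn)

lemma proj_in_closed: "i \<le> n \<Longrightarrow> y \<noteq> c i \<Longrightarrow> proj i y \<in> closed_collar n c \<rho> 0"
  using circle_point_in_closed_collar gap_proj by blast

lemma proj_fixed: "i \<le> n \<Longrightarrow> gap c \<rho> i y = 0 \<Longrightarrow> proj i y = y"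
  using radius_pos[of i] by (auto simp: gap_side proj_def sgn_eq side_def split: if_splits)

lemma proj_chart: "i \<le> n \<Longrightarrow> proj i (chart c \<rho> i w) = chart c \<rho> i (of_real (Re w))"
proof -
  assume i: "i \<le> n"
  have \<rho>: "0 < \<rho> i" using radius_pos i by simp
  define E where "E = - \<i> * of_real (side i) * w"
  have E: "E = of_real (side i * Im w) + (- \<i> * of_real (side i) * of_real (Re w))"
    unfolding E_def by (subst complex_eq[of w]) (simp add: algebra_simps)
  have e: "exp E = of_real (exp (side i * Im w)) * exp (- \<i> * of_real (side i) * of_real (Re w))"
    unfolding E exp_add by (simp only: exp_of_real)
  have n1: "cmod (exp (- \<i> * of_real (side i) * of_real (Re w))) = 1" by simp
  have "sgn (chart c \<rho> i w - c i) = exp (- \<i> * of_real (side i) * of_real (Re w))"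
    unfolding chart_minus E_def[symmetric] e
    using \<rho> n1 by (simp add: sgn_mult sgn_of_real) (simp add: sgn_eq)
  then show ?thesis by (simp add: proj_def chart_def)
qed

text \<open>
  In the chart the projection is \<open>w \<mapsto> Re w\<close>, and \<open>f\<close> up to the real axis is the real part of a holomorphic function
  on the strip. So the boundary values of \<open>f\<close> are smooth along the circle, although \<open>f\<close> is only known to be
  continuous there.
\<close>
lemma proj_value_derivative:
  assumes i: "i \<le> n" and y1: "y1 \<noteq> c i"
  shows "((\<lambda>y. f (proj i y)) has_derivative (\<lambda>h. torque i (proj i y1) * Im (h / (y1 - c i)))) (at y1)"
proof -
  have \<rho>: "0 < \<rho> i" using radius_pos i by simp
  obtain Q where Q: "\<And>w. w \<in> strip (width \<rho> i s) \<Longrightarrow> (Q has_field_derivative chart_pull i F w) (at w)"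
    and f: "\<And>w. w \<in> strip (width \<rho> i s) \<Longrightarrow> 0 \<le> Im w \<Longrightarrow> f (chart c \<rho> i w) = Re (Q w)"
    using chart_pull_potential_closed[OF i s F pot contf] by blast
  have real_strip: "of_real x \<in> strip (width \<rho> i s)" for x
    using width_pos[OF i s(1)] by (simp add: strip_def)
  obtain w1 where w1: "chart c \<rho> i w1 = y1" using chart_surjective[of \<rho> i y1 c] \<rho> y1 by blast
  obtain W where W: "W y1 = w1" "(W has_field_derivative (\<i> * of_real (side i) / (y1 - c i))) (at y1)"
    "\<And>y. y \<noteq> c i \<Longrightarrow> chart c \<rho> i (W y) = y"
    using chart_local_inverse[of \<rho> i c w1, OF \<rho>] unfolding w1 by metis
  have eq: "f (proj i y) = Re (Q (of_real (Re (W y))))" if "y \<noteq> c i" for y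
    using f[OF real_strip, of "Re (W y)"] proj_chart[OF i, of "W y"] W(3)[OF that] by simp
  have k: "chart_pull i F (of_real (Re w1)) = F (proj i y1) * (- \<i> * of_real (side i) * (proj i y1 - c i))"
    using proj_chart[OF i, of w1] by (simp add: chart_pull_def w1)
  have d1: "((\<lambda>y. complex_of_real (Re (W y))) has_derivative
      (\<lambda>h. of_real (Re (\<i> * of_real (side i) / (y1 - c i) * h)))) (at y1)"
    using W(2) unfolding has_field_derivative_def by (intro derivative_intros)
  have d2: "(Q has_derivative (\<lambda>h. chart_pull i F (of_real (Re w1)) * h)) (at (of_real (Re (W y1))))"
    using Q[OF real_strip, of "Re w1"] W(1) unfolding has_field_derivative_def by simp
  have "((\<lambda>y. Re (Q (of_real (Re (W y))))) has_derivative
      (\<lambda>h. Re (chart_pull i F (of_real (Re w1)) * of_real (Re (\<i> * of_real (side i) / (y1 - c i) * h))))) (at y1)"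
    by (rule has_derivative_Re[OF has_derivative_compose[OF d1 d2]])
  moreover have "Re (chart_pull i F (of_real (Re w1)) * of_real (Re (\<i> * of_real (side i) / (y1 - c i) * h)))
      = torque i (proj i y1) * Im (h / (y1 - c i))" for h
  proof -
    have e1: "\<i> * of_real (side i) / (y1 - c i) * h = of_real (side i) * (\<i> * (h / (y1 - c i)))" by simp
    have r: "Re (of_real x * z) = x * Re z" "Re (\<i> * z) = - Im z" for x z by simp_all
    have a: "Re (\<i> * of_real (side i) / (y1 - c i) * h) = - (side i * Im (h / (y1 - c i)))"
      unfolding e1 r by simp
    have "chart_pull i F (of_real (Re w1)) = of_real (side i) * (- \<i> * ((proj i y1 - c i) * F (proj i y1)))"
      unfolding k by simp
    then have b: "Re (chart_pull i F (of_real (Re w1))) = - (side i * torque i (proj i y1))"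
      unfolding torque_def by simp
    have r2: "Re (z * of_real x) = Re z * x" for z x by simp
    have "- (side i * p) * - (side i * q) = p * q" for p q by (simp add: side_def)
    then show ?thesis unfolding r2 a b .
  qed
  ultimately have "((\<lambda>y. Re (Q (of_real (Re (W y))))) has_derivative
      (\<lambda>h. torque i (proj i y1) * Im (h / (y1 - c i)))) (at y1)" by simp
  then show ?thesis
    by (rule has_derivative_transform_within_open[of _ _ _ _ "- {c i}"]) (use y1 eq in auto)
qed

lemma stream_fun_far:
  assumes "y \<in> closed_collar n c \<rho> (- (d / 2))" shows "\<psi> y = f y"
proof -
  have "d / 2 \<le> infdist y (frontier (circular_domain n c \<rho>))"
    using infdist_frontier_ge[OF assms] domain_eq_collar by simp
  then have "1 \<le> infdist y (frontier (circular_domain n c \<rho>)) / (d / 2)" using d_pos by simp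
  then show ?thesis by (simp add: stream_fun_def \<zeta>1)
qed

text \<open>
  In the outer part of the shell the projection of the stream function may be undefined; there the cutoff vanishes.
\<close>
lemma stream_fun_near:
  assumes i: "i \<le> n" and y: "y \<in> shell i"
  shows "\<psi> y = f y - \<zeta> (depth i y) * f (proj i y)"
proof -
  have g: "0 < gap c \<rho> i y" "gap c \<rho> i y < d" using y d_pos by (auto simp: shell_def)
  have dep: "infdist y (frontier (circular_domain n c \<rho>)) / (d / 2) = depth i y"
    using infdist_frontier_eq[OF i, of y] g domain_eq_collar by (simp add: depth_def)
  show ?thesis
  proof (cases "gap c \<rho> i y < d / 2")
    case False
    then have "1 \<le> depth i y" using d_pos by (simp add: depth_def)
    then show ?thesis unfolding stream_fun_def dep by (simp add: \<zeta>1)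
  next
    case True
    have other: "\<not> gap c \<rho> j y < d / 2" if "j \<le> n" "j \<noteq> i" for j
      using other_gap[OF i that(1), of y "d / 2"] that True d_pos by auto
    have cav: "cmod (y - c j) < \<rho> j + d / 2 \<longleftrightarrow> gap c \<rho> j y < d / 2" if "j \<in> {1..n}" for j
      using that by (auto simp: gap_def)
    have "circle_proj n c \<rho> d y = proj i y"
    proof (cases "i = 0")
      case True
      have "\<not> (\<exists>j\<in>{1..n}. cmod (y - c j) < \<rho> j + d / 2)"
        using cav other True by auto
      moreover have "cmod y > \<rho> 0 - d / 2"
        using \<open>gap c \<rho> i y < d / 2\<close> True c0 by (simp add: gap_def)
      ultimately show ?thesis using True c0 by (simp add: circle_proj_def proj_def sgn_eq)
    next
      case False
      then have i1: "i \<in> {1..n}" using i by auto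
      then have ex: "\<exists>j\<in>{1..n}. cmod (y - c j) < \<rho> j + d / 2" using cav True by blast
      have the: "(THE j. j \<in> {1..n} \<and> cmod (y - c j) < \<rho> j + d / 2) = i"
      proof (rule the_equality)
        show "j = i" if "j \<in> {1..n} \<and> cmod (y - c j) < \<rho> j + d / 2" for j
          using cav[of j] other[of j] that by auto
      qed (use i1 cav True in blast)
      show ?thesis unfolding circle_proj_def Let_def the if_P[OF ex] proj_def sgn_eq ..
    qed
    then show ?thesis unfolding stream_fun_def dep by simp
  qed
qed

lemma depth_pos: "y \<in> shell i \<Longrightarrow> 0 < depth i y" "y \<in> shell i \<Longrightarrow> depth i y < 2"
  using d_pos by (auto simp: shell_def depth_def divide_less_eq)

lemma D_at: "0 < x \<Longrightarrow> (D k has_real_derivative D (Suc k) x) (at x)"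
  using has_field_derivative_subset[OF D[where k = k and x = x], of "{0<..}"] at_within_open[of x "{0<..}"]
  by (auto simp: subset_eq)

lemma depth_derivative:
  assumes "y \<noteq> c i"
  shows "(depth i has_derivative (\<lambda>h. 2 / d * side i * inner h (sgn (y - c i)))) (at y)"
proof -
  have "((\<lambda>y. y - c i) has_derivative (\<lambda>h. h)) (at y)" by (auto intro!: derivative_eq_intros)
  from has_derivative_compose[OF this has_derivative_norm] assms
  have n: "((\<lambda>y. cmod (y - c i)) has_derivative (\<lambda>h. inner h (sgn (y - c i)))) (at y)" by simp
  have "((\<lambda>y. 2 / d * side i * (cmod (y - c i) - \<rho> i)) has_derivative
      (\<lambda>h. 2 / d * side i * inner h (sgn (y - c i)))) (at y)"
    using has_derivative_mult_right[OF has_derivative_diff[OF n has_derivative_const[of "\<rho> i"]], of "2 / d * side i"]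
    by (simp only: diff_zero)
  moreover have "depth i = (\<lambda>y. 2 / d * side i * (cmod (y - c i) - \<rho> i))"
    using d_pos by (simp add: fun_eq_iff depth_def gap_side)
  ultimately show ?thesis by simp
qed

lemma shell_in_domain: "i \<le> n \<Longrightarrow> shell i \<subseteq> collar n c \<rho> 0"
  using near_circle_collar[of i 0] d_pos by (auto simp: shell_def)

lemma stream_fun_derivative_near:
  assumes i: "i \<le> n" and y: "y \<in> shell i"
  shows "(\<psi> has_derivative (\<lambda>h. Re (cnj (cnj (F y) - correction i y) * h))) (at y)"
proof -
  have ne: "y \<noteq> c i" by (rule shell_nonzero[OF i y])
  have "(D 0 has_derivative (\<lambda>h. D 1 (depth i y) * h)) (at (depth i y))"
    using D_at[OF depth_pos(1)[OF y], of 0] unfolding has_field_derivative_def by simp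
  then have z: "((\<lambda>y. \<zeta> (depth i y)) has_derivative
      (\<lambda>h. D 1 (depth i y) * (2 / d * side i * inner h (sgn (y - c i))))) (at y)"
    using has_derivative_compose[OF depth_derivative[OF ne]] D0 by metis
  have "((\<lambda>y. f y - \<zeta> (depth i y) * f (proj i y)) has_derivative
      (\<lambda>h. Re (F y * h) - (\<zeta> (depth i y) * (torque i (proj i y) * Im (h / (y - c i)))
        + D 1 (depth i y) * (2 / d * side i * inner h (sgn (y - c i))) * f (proj i y)))) (at y)"
    using shell_in_domain[OF i] y
    by (intro has_derivative_diff has_derivative_mult potential_onD[OF pot] z proj_value_derivative[OF i ne]) auto
  moreover have "Re (F y * h) - (\<zeta> (depth i y) * (torque i (proj i y) * Im (h / (y - c i)))
        + D 1 (depth i y) * (2 / d * side i * inner h (sgn (y - c i))) * f (proj i y))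
      = Re (cnj (cnj (F y) - correction i y) * h)" for h
  proof -
    define S where "S = sgn (y - c i)"
    have in1: "inner h S = Re (cnj S * h)" by (simp add: inner_complex_def algebra_simps)
    have im1: "Im (h / (y - c i)) = Re (- \<i> / (y - c i) * h)"
    proof -
      have e1: "- \<i> / (y - c i) * h = - \<i> * (h / (y - c i))" by simp
      have r: "Re (- \<i> * z) = Im z" for z by simp
      show ?thesis unfolding e1 r ..
    qed
    have "cnj (cnj (F y) - correction i y) * h = F y * h
       - (of_real (\<zeta> (depth i y) * torque i (proj i y)) * (- \<i> / (y - c i) * h)
          + of_real (f (proj i y) * (D 1 (depth i y) * (2 / d * side i))) * (cnj S * h))"
      unfolding correction_def S_def[symmetric] by (simp add: algebra_simps)
    moreover have "Re (of_real x * z) = x * Re z" for x z by simp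
    ultimately show ?thesis
      unfolding S_def[symmetric] in1 im1 by (simp only: minus_complex.simps plus_complex.simps) (simp add: algebra_simps add_divide_distrib)
  qed
  ultimately have "((\<lambda>y. f y - \<zeta> (depth i y) * f (proj i y)) has_derivative
      (\<lambda>h. Re (cnj (cnj (F y) - correction i y) * h))) (at y)" by simp
  then show ?thesis
    by (rule has_derivative_transform_within_open[OF _ open_shell y]) (use stream_fun_near[OF i] in auto)
qed

lemma stream_fun_derivative_far:
  assumes y: "y \<in> collar n c \<rho> (- (d / 2))"
  shows "(\<psi> has_derivative (\<lambda>h. Re (cnj (cnj (F y)) * h))) (at y)"
proof -
  have "y \<in> collar n c \<rho> 0" using y collar_mono[of "- (d / 2)" 0 n c \<rho>] d_pos by auto
  from potential_onD[OF pot this] have "(f has_derivative (\<lambda>h. Re (cnj (cnj (F y)) * h))) (at y)" by simp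
  then show ?thesis
    by (rule has_derivative_transform_within_open[OF _ open_collar y])
       (use stream_fun_far collar_subset_closed_collar[of "- (d / 2)" "- (d / 2)" n c \<rho>] in auto)
qed

lemma domain_cover:
  assumes "y \<in> collar n c \<rho> 0"
  obtains i where "i \<le> n" "y \<in> shell i" | "y \<in> collar n c \<rho> (- (d / 2))"
proof (cases "y \<in> collar n c \<rho> (- (d / 2))")
  case False
  then obtain i where i: "i \<le> n" "gap c \<rho> i y \<le> d / 2" by (auto simp: collar_def not_less)
  then have "y \<in> shell i" using assms d_pos by (auto simp: shell_def collar_def)
  then show ?thesis using that(1) i by blast
qed (use that in blast)

lemma stream_fun_differentiable: "y \<in> collar n c \<rho> 0 \<Longrightarrow> \<psi> differentiable (at y)"
  by (erule domain_cover)
     (auto intro: differentiableI stream_fun_derivative_near stream_fun_derivative_far)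

lemma grad_stream_near: "i \<le> n \<Longrightarrow> y \<in> shell i \<Longrightarrow> grad \<psi> y = cnj (F y) - correction i y"
  by (rule grad_eqI[OF stream_fun_derivative_near])

lemma grad_stream_far: "y \<in> collar n c \<rho> (- (d / 2)) \<Longrightarrow> grad \<psi> y = cnj (F y)"
  by (rule grad_eqI[OF stream_fun_derivative_far])

end

text \<open>
  The constant delivered by the product and chain rules in the next lemma, written out because it must depend
  on nothing but these six numbers.
\<close>
definition stream_const :: "real \<Rightarrow> real \<Rightarrow> real \<Rightarrow> real \<Rightarrow> real \<Rightarrow> real \<Rightarrow> real" where
  "stream_const d R C0 C1 C2 Z =
     (let a = d / 4; Be = R / a\<^sup>2 + 1 / a; Bm = (C1 + R * C2) * (R * Be);
          I0 = (R * C1) * (1 / a); I1 = (R * C1) * (1 / a\<^sup>2) + Bm * (1 / a);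
          J0 = C0 * (Z * (2 / d)); J1 = C0 * (Z * (2 / d) * (2 / d)) + (R * C1 / a) * (Z * (2 / d))
      in (Z * I1 + (Z * (2 / d)) * I0) + (J0 * Be + J1 * 1))"

context stream_config begin

lemma correction_deriv_bounded:
  assumes i: "i \<le> n" and y: "y \<in> shell i" and R: "2 * \<rho> 0 \<le> R"
    and C0: "\<And>y. y \<in> closed_collar n c \<rho> 0 \<Longrightarrow> \<bar>f y\<bar> \<le> C0"
    and C1: "\<And>y. y \<in> closed_collar n c \<rho> 0 \<Longrightarrow> cmod (F y) \<le> C1"
    and C2: "\<And>y. y \<in> closed_collar n c \<rho> 0 \<Longrightarrow> cmod (deriv F y) \<le> C2"
    and Z: "\<And>k x. k \<le> 2 \<Longrightarrow> 0 \<le> x \<Longrightarrow> x \<le> 2 \<Longrightarrow> \<bar>D k x\<bar> \<le> Z"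
  shows "\<exists>A. deriv_bounded (correction i) y A (stream_const d R C0 C1 C2 Z)"
proof -
  define a where "a = d / 4"
  have a: "0 < a" "a \<le> cmod (y - c i)" "y \<noteq> c i"
    using shell_nonzero[OF i y] d_pos by (auto simp: a_def)
  have yK: "y \<in> closed_collar n c \<rho> 0" and yE: "y \<in> collar n c \<rho> 0"
    using shell_in_domain[OF i] y collar_subset_closed_collar[of 0 0 n c \<rho>] by auto
  have ball: "cmod x \<le> \<rho> 0" if "x \<in> closed_collar n c \<rho> 0" for x
    using that c0 by (auto simp: closed_collar_def gap_def dest: spec[of _ 0])
  have ci: "cmod (c i) \<le> \<rho> 0"
    using gap_sum[of 0 i "c i"] i d_pos radius_pos[of 0] radius_pos[OF i] c0
    by (cases "i = 0") (auto simp: gap_def)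
  have R': "cmod (x - c i) \<le> R" if "x \<in> closed_collar n c \<rho> 0" for x
    using norm_triangle_ineq4[of x "c i"] ball[OF that] ci R by linarith
  have \<rho>R: "\<rho> i \<le> R" using radius_le[OF i] radius_pos[of 0] R d_pos by (cases "i = 0") auto
  have q: "proj i y \<in> closed_collar n c \<rho> 0" by (rule proj_in_closed[OF i a(3)])
  have qs: "proj i y \<in> collar n c \<rho> s" using q closed_collar_subset_collar[of 0 s n c \<rho>] s by auto
  note C0' = C0[OF q] and C1' = C1[OF q] and C2' = C2[OF q]
  have pos: "0 \<le> R" "0 \<le> C1" "0 \<le> C2" "0 \<le> Z" "0 \<le> C0"
    using order_trans[OF norm_ge_zero R'[OF q]] order_trans[OF norm_ge_zero C1'] order_trans[OF norm_ge_zero C2']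
      order_trans[OF abs_ge_zero Z[of 0 0]] order_trans[OF abs_ge_zero C0'] by auto
  define Be where "Be = R / a\<^sup>2 + 1 / a"
  have Be: "0 \<le> Be" using pos a by (simp add: Be_def)
  have e: "deriv_bounded (\<lambda>y. sgn (y - c i)) y 1 Be"
    unfolding Be_def by (rule deriv_bounded_sgn[OF a(1,2) R'[OF yK]])
  have q1: "deriv_bounded (proj i) y (norm (c i) + norm (complex_of_real (\<rho> i)) * 1) (0 + (norm (complex_of_real (\<rho> i)) * Be + 0 * 1))"
    unfolding proj_def[abs_def]
    by (intro deriv_bounded_add deriv_bounded_mult deriv_bounded_const e)
  have q2: "deriv_bounded (proj i) y (norm (c i) + norm (complex_of_real (\<rho> i)) * 1) (R * Be)"
    by (rule deriv_bounded_mono[OF q1 order_refl])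
       (use \<rho>R Be radius_pos[OF i] in \<open>auto intro: mult_right_mono\<close>)
  have m: "deriv_bounded (\<lambda>y. torque i (proj i y)) y (R * C1) ((C1 + R * C2) * (R * Be))"
    unfolding torque_def
  proof (intro deriv_bounded_neg_Im deriv_bounded_complex_compose[OF q2, where g = "\<lambda>y. (y - c i) * F y"])
    show "((\<lambda>y. (y - c i) * F y) has_field_derivative F (proj i y) + (proj i y - c i) * deriv F (proj i y)) (at (proj i y))"
      by (auto intro!: derivative_eq_intros holomorphic_derivI[OF F open_collar qs])
    show "cmod ((proj i y - c i) * F (proj i y)) \<le> R * C1"
      unfolding norm_mult using R'[OF q] C1' pos by (intro mult_mono) auto
    show "cmod (F (proj i y) + (proj i y - c i) * deriv F (proj i y)) \<le> C1 + R * C2"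
      using C1' R'[OF q] C2' pos
      by (intro norm_triangle_mono) (auto simp: norm_mult intro: mult_mono)
  qed
  have w: "deriv_bounded (\<lambda>y. cnj (- \<i> / (y - c i))) y (1 / a) (1 / a\<^sup>2)"
  proof (rule deriv_bounded_cnj, rule deriv_bounded_field)
    show "((\<lambda>y. - \<i> / (y - c i)) has_field_derivative \<i> / (y - c i)\<^sup>2) (at y)"
      using a(3) by (auto intro!: derivative_eq_intros simp: power2_eq_square)
    show "cmod (- \<i> / (y - c i)) \<le> 1 / a"
      using a by (simp add: norm_divide field_simps)
    have "a\<^sup>2 \<le> (cmod (y - c i))\<^sup>2" using a by (intro power_mono) auto
    then show "cmod (\<i> / (y - c i)\<^sup>2) \<le> 1 / a\<^sup>2"
      using a by (simp add: norm_divide norm_power field_simps)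
  qed
  have dep: "deriv_bounded (depth i) y 2 (2 / d)"
  proof (rule deriv_boundedI[OF _ depth_derivative[OF a(3)]])
    show "norm (depth i y) \<le> 2" using depth_pos[OF y] by simp
    show "norm (2 / d * side i * inner h (sgn (y - c i))) \<le> 2 / d * norm h" for h
      using Cauchy_Schwarz_ineq2[of h "sgn (y - c i)"] a(3) d_pos
      by (simp add: abs_mult norm_sgn divide_right_mono mult_left_mono)
  qed
  have Dk: "deriv_bounded (\<lambda>y. D k (depth i y)) y Z (Z * (2 / d))" if "k \<le> 1" for k
    using depth_pos[OF y] that
    by (intro deriv_bounded_real_compose[OF dep D_at] Z) auto
  have z0: "deriv_bounded (\<lambda>y. \<zeta> (depth i y)) y Z (Z * (2 / d))" using Dk[of 0] D0 by simp
  have z1: "deriv_bounded (\<lambda>y. D 1 (depth i y) * (2 / d * side i)) y (Z * (2 / d)) (Z * (2 / d) * (2 / d))"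
  proof -
    have nk: "norm (2 / d * side i) = 2 / d" using d_pos by (simp add: abs_mult)
    have "deriv_bounded (\<lambda>y. D 1 (depth i y) * (2 / d * side i)) y (Z * norm (2 / d * side i))
        (Z * 0 + Z * (2 / d) * norm (2 / d * side i))"
      by (intro deriv_bounded_mult Dk deriv_bounded_const) simp
    then show ?thesis unfolding nk by (simp only: mult_zero_right add_0_left)
  qed
  have b: "deriv_bounded (\<lambda>y. f (proj i y)) y C0 (R * C1 / a)"
  proof (rule deriv_boundedI[OF _ proj_value_derivative[OF i a(3)]])
    show "norm (f (proj i y)) \<le> C0" using C0' by simp
    show "norm (torque i (proj i y) * Im (h / (y - c i))) \<le> R * C1 / a * norm h" for h
    proof -
      have "\<bar>torque i (proj i y)\<bar> \<le> R * C1" using m unfolding deriv_bounded_def by simp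
      moreover have "\<bar>Im (h / (y - c i))\<bar> \<le> norm h / a"
        using abs_Im_le_cmod[of "h / (y - c i)"] a
          divide_left_mono[of a "cmod (y - c i)" "norm h"] by (simp add: norm_divide)
      ultimately have "\<bar>torque i (proj i y)\<bar> * \<bar>Im (h / (y - c i))\<bar> \<le> (R * C1) * (norm h / a)"
        using pos by (intro mult_mono) auto
      then show ?thesis by (simp add: abs_mult)
    qed
  qed
  show ?thesis
    unfolding correction_def[abs_def] stream_const_def Let_def a_def[symmetric] Be_def[symmetric]
    by (rule exI, rule deriv_bounded_add[OF deriv_bounded_mult[OF deriv_bounded_of_real[OF z0]
          deriv_bounded_mult[OF deriv_bounded_of_real[OF m] w]]
        deriv_bounded_mult[OF deriv_bounded_of_real[OF deriv_bounded_mult[OF b z1]] e]])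
qed

text \<open>
  At the circle the radial part of the correction disappears with the derivative of the cutoff, and the tangential part
  becomes the tangential derivative of \<open>f\<close>.
\<close>
lemma correction_boundary_limit:
  assumes i: "i \<le> n" and Y: "gap c \<rho> i Y = 0" and \<zeta>0: "\<zeta> 0 = 1" and D10: "D 1 0 = 0"
  shows "(correction i \<longlongrightarrow> of_real (torque i Y) * cnj (- \<i> / (Y - c i))) (at Y within collar n c \<rho> 0)"
proof -
  let ?E = "collar n c \<rho> 0"
  have Yc: "Y \<noteq> c i" using Y radius_pos[OF i] by (auto simp: gap_side side_def split: if_splits)
  have YK: "Y \<in> closed_collar n c \<rho> 0" by (rule circle_point_in_closed_collar[OF i Y])
  have Ys: "Y \<in> collar n c \<rho> s" using YK closed_collar_subset_collar[of 0 s n c \<rho>] s by auto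
  have id: "((\<lambda>y. y) \<longlongrightarrow> Y) (at Y within ?E)" by (rule tendsto_ident_at)
  have sg: "((\<lambda>y. sgn (y - c i)) \<longlongrightarrow> sgn (Y - c i)) (at Y within ?E)"
    using Yc by (intro tendsto_sgn tendsto_intros id) auto
  have pr: "(proj i \<longlongrightarrow> Y) (at Y within ?E)"
  proof -
    have "(proj i \<longlongrightarrow> proj i Y) (at Y within ?E)"
      unfolding proj_def[abs_def] by (intro tendsto_intros sg)
    then show ?thesis using proj_fixed[OF i Y] by simp
  qed
  have near: "eventually (\<lambda>y. y \<noteq> c i) (at Y within ?E)"
    using tendsto_imp_eventually_ne[OF id Yc] .
  have fp: "((\<lambda>y. f (proj i y)) \<longlongrightarrow> f Y) (at Y within ?E)"
    by (rule continuous_on_tendsto_compose[OF contf pr YK])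
       (use near in eventually_elim, auto intro: proj_in_closed[OF i])
  have contF: "isCont F Y"
    using F open_collar Ys by (meson holomorphic_on_imp_differentiable_at field_differentiable_imp_continuous_at)
  have tq: "((\<lambda>y. torque i (proj i y)) \<longlongrightarrow> torque i Y) (at Y within ?E)"
    unfolding torque_def using isCont_tendsto_compose[OF contF pr] by (intro tendsto_intros pr)
  have dep: "(depth i \<longlongrightarrow> 0) (at Y within ?E)"
  proof -
    have "(depth i \<longlongrightarrow> depth i Y) (at Y within ?E)"
      unfolding depth_def[abs_def]
      using d_pos isCont_gap[where c = c and \<rho> = \<rho> and i = i and y = Y] by (intro tendsto_intros) (auto simp: isCont_def intro: tendsto_within_subset)
    then show ?thesis using Y by (simp add: depth_def)
  qed
  have dpos: "eventually (\<lambda>y. depth i y \<in> {0..}) (at Y within ?E)"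
    unfolding eventually_at_filter using d_pos i by (auto simp: depth_def collar_def intro!: always_eventually less_imp_le)
  have Dc: "((\<lambda>y. D k (depth i y)) \<longlongrightarrow> D k 0) (at Y within ?E)" for k
  proof -
    have "continuous_on {0..} (D k)"
      by (rule DERIV_continuous_on[where D = "D (Suc k)"]) (use D in auto)
    from continuous_on_tendsto_compose[OF this dep _ dpos] show ?thesis by simp
  qed
  have z: "((\<lambda>y. \<zeta> (depth i y)) \<longlongrightarrow> \<zeta> 0) (at Y within ?E)" using Dc[of 0] D0 by simp
  have "(correction i \<longlongrightarrow> of_real (\<zeta> 0) * (of_real (torque i Y) * cnj (- \<i> / (Y - c i)))
      + of_real (f Y * (D 1 0 * (2 / d * side i))) * sgn (Y - c i)) (at Y within ?E)"
    unfolding correction_def[abs_def] using Yc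
    by (intro tendsto_intros z Dc tq fp sg id) auto
  then show ?thesis using \<zeta>0 D10 by simp
qed

end

section \<open>The velocity field at a fixed time\<close>

lemma deriv_bounded_transform:
  assumes "deriv_bounded f y A B" "open S" "y \<in> S" "\<And>x. x \<in> S \<Longrightarrow> f x = g x"
  shows "deriv_bounded g y A B"
proof -
  obtain f' where f': "norm (f y) \<le> A" "(f has_derivative f') (at y)" "\<And>h. norm (f' h) \<le> B * norm h"
    using assms(1) unfolding deriv_bounded_def by blast
  show ?thesis
    by (rule deriv_boundedI[OF _ has_derivative_transform_within_open[OF f'(2) assms(2,3,4)] f'(3)])
       (use f'(1) assms(3,4) in auto)
qed

lemma deriv_bounded_diff:
  assumes "deriv_bounded f y A B" "deriv_bounded g y A' B'"
  shows "deriv_bounded (\<lambda>y. f y - g y) y (A + A') (B + B')"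
proof -
  have "deriv_bounded (\<lambda>y. - g y) y (1 * A') (1 * B')"
    by (rule deriv_bounded_linear[OF assms(2)]) (auto intro: bounded_linear_minus bounded_linear_ident)
  from deriv_bounded_add[OF assms(1) this] show ?thesis by simp
qed

lemma deriv_bounded_onorm:
  assumes "deriv_bounded f y A B" shows "f differentiable (at y)" "onorm (frechet_derivative f (at y)) \<le> B"
proof -
  obtain f' where f': "(f has_derivative f') (at y)" "\<And>h. norm (f' h) \<le> B * norm h"
    using assms(1) unfolding deriv_bounded_def by blast
  show "f differentiable (at y)" using f'(1) by (rule differentiableI)
  show "onorm (frechet_derivative f (at y)) \<le> B"
    unfolding frechet_derivative_at[OF f'(1), symmetric] by (rule onorm_le[OF f'(2)])
qed

lemma onorm_plane_lipschitz:
  "onorm (\<lambda>h. Re h *\<^sub>R a + Im h *\<^sub>R b)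
     \<le> onorm (\<lambda>h. Re h *\<^sub>R a' + Im h *\<^sub>R b') + (norm (a - a') + norm (b - b'))"
  for a b a' b' :: "'b::real_normed_vector"
proof -
  have bl: "bounded_linear (\<lambda>h. Re h *\<^sub>R a + Im h *\<^sub>R b)" for a b :: 'b
    by (intro bounded_linear_add bounded_linear_scaleR_const bounded_linear_Re bounded_linear_Im)
  have eq: "(\<lambda>h. Re h *\<^sub>R a + Im h *\<^sub>R b) = (\<lambda>h. (Re h *\<^sub>R a' + Im h *\<^sub>R b') + (Re h *\<^sub>R (a - a') + Im h *\<^sub>R (b - b')))"
    by (simp add: fun_eq_iff algebra_simps)
  have "onorm (\<lambda>h. Re h *\<^sub>R (a - a') + Im h *\<^sub>R (b - b')) \<le> norm (a - a') + norm (b - b')"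
  proof (rule onorm_le)
    fix h :: complex
    have "norm (Re h *\<^sub>R (a - a') + Im h *\<^sub>R (b - b')) \<le> \<bar>Re h\<bar> * norm (a - a') + \<bar>Im h\<bar> * norm (b - b')"
      using norm_triangle_ineq[of "Re h *\<^sub>R (a - a')" "Im h *\<^sub>R (b - b')"] by simp
    also have "\<dots> \<le> cmod h * norm (a - a') + cmod h * norm (b - b')"
      by (intro add_mono mult_right_mono abs_Re_le_cmod abs_Im_le_cmod) auto
    finally show "norm (Re h *\<^sub>R (a - a') + Im h *\<^sub>R (b - b')) \<le> (norm (a - a') + norm (b - b')) * norm h"
      by (simp add: algebra_simps)
  qed
  then show ?thesis
    unfolding eq using onorm_triangle[OF bl[of a' b'] bl[of "a - a'" "b - b'"]] by linarith
qed

text \<open>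
  The directional derivatives are pointwise limits of difference quotients, and the operator norm is a continuous
  function of the images of the two basis vectors.
\<close>
lemma measurable_onorm_frechet_derivative:
  fixes f :: "complex \<Rightarrow> complex"
  assumes S: "open S" and f: "\<And>y. y \<in> S \<Longrightarrow> f differentiable (at y)"
  shows "(\<lambda>y. onorm (frechet_derivative f (at y))) \<in> borel_measurable (lebesgue_on S)"
proof -
  define f0 where "f0 y = indicator S y *\<^sub>R f y" for y
  have contf: "continuous_on S f"
    using f by (meson differentiable_imp_continuous_within continuous_at_imp_continuous_on)
  have f0: "f0 \<in> borel_measurable borel"
    unfolding f0_def using S contf by (intro borel_measurable_continuous_on_indicator) auto
  have deriv: "(\<lambda>y. frechet_derivative f (at y) e) \<in> borel_measurable (lebesgue_on S)" for e
  proof (rule borel_measurable_LIMSEQ_metric)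
    define u where "u k y = real (Suc k) *\<^sub>R (f0 (y + (1 / real (Suc k)) *\<^sub>R e) - f0 y)" for k y
    show "u k \<in> borel_measurable (lebesgue_on S)" for k
    proof -
      have "(\<lambda>y. f0 (y + (1 / real (Suc k)) *\<^sub>R e)) \<in> borel_measurable borel"
        by (rule measurable_compose[OF _ f0]) simp
      then have "u k \<in> borel_measurable borel" unfolding u_def using f0 by measurable
      then show ?thesis by (intro measurable_restrict_space1 measurable_completion) simp
    qed
    fix y assume "y \<in> space (lebesgue_on S)"
    then have y: "y \<in> S" by simp
    have D: "(f has_derivative frechet_derivative f (at y)) (at y)"
      using f[OF y] frechet_derivative_works by blast
    have "((\<lambda>x. y + x *\<^sub>R e) has_derivative (\<lambda>h. h *\<^sub>R e)) (at 0)"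
      by (auto intro!: derivative_eq_intros)
    from has_derivative_compose[OF this, of f "frechet_derivative f (at y)"] D
    have "((\<lambda>x. f (y + x *\<^sub>R e)) has_derivative (\<lambda>h. frechet_derivative f (at y) (h *\<^sub>R e))) (at 0)" by simp
    then have lim: "((\<lambda>h. norm (f (y + h *\<^sub>R e) - f y - h *\<^sub>R frechet_derivative f (at y) e) / norm h) \<longlongrightarrow> 0) (at 0)"
      using linear_scale[OF has_derivative_linear[OF D]] by (simp add: has_derivative_at)
    have "filterlim (\<lambda>k. 1 / real (Suc k)) (at 0) sequentially"
      unfolding filterlim_at using LIMSEQ_Suc[OF lim_1_over_n] by auto
    from filterlim_compose[OF lim this]
    have "(\<lambda>k. norm (real (Suc k) *\<^sub>R (f (y + (1 / real (Suc k)) *\<^sub>R e) - f y) - frechet_derivative f (at y) e)) \<longlonglongrightarrow> 0"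
    proof (rule Lim_transform_eventually[OF _ always_eventually], intro allI)
      fix k
      let ?h = "1 / real (Suc k)"
      have "real (Suc k) *\<^sub>R (f (y + ?h *\<^sub>R e) - f y) - frechet_derivative f (at y) e
          = real (Suc k) *\<^sub>R (f (y + ?h *\<^sub>R e) - f y - ?h *\<^sub>R frechet_derivative f (at y) e)"
        by (simp add: scaleR_diff_right del: of_nat_Suc)
      then show "norm (f (y + ?h *\<^sub>R e) - f y - ?h *\<^sub>R frechet_derivative f (at y) e) / norm ?h
          = norm (real (Suc k) *\<^sub>R (f (y + ?h *\<^sub>R e) - f y) - frechet_derivative f (at y) e)"
        by (simp add: mult.commute del: of_nat_Suc)
    qed
    then have "(\<lambda>k. real (Suc k) *\<^sub>R (f (y + (1 / real (Suc k)) *\<^sub>R e) - f y)) \<longlonglongrightarrow> frechet_derivative f (at y) e"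
      by (rule LIM_zero_cancel[OF tendsto_norm_zero_cancel])
    moreover have "eventually (\<lambda>k. y + (1 / real (Suc k)) *\<^sub>R e \<in> S) sequentially"
    proof -
      have "(\<lambda>k. y + (1 / real (Suc k)) *\<^sub>R e) \<longlonglongrightarrow> y + 0 *\<^sub>R e"
        using LIMSEQ_Suc[OF lim_1_over_n] by (intro tendsto_intros)
      then show ?thesis using topological_tendstoD[OF _ S] y by simp
    qed
    then have "eventually (\<lambda>k. real (Suc k) *\<^sub>R (f (y + (1 / real (Suc k)) *\<^sub>R e) - f y) = u k y) sequentially"
      by eventually_elim (use y in \<open>simp add: u_def f0_def\<close>)
    ultimately show "(\<lambda>k. u k y) \<longlonglongrightarrow> frechet_derivative f (at y) e"
      by (rule Lim_transform_eventually)
  qed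
  define N where "N p = onorm (\<lambda>h. Re h *\<^sub>R fst p + Im h *\<^sub>R snd p)" for p :: "complex \<times> complex"
  have "2-lipschitz_on UNIV N"
  proof (rule lipschitz_onI)
    fix p q :: "complex \<times> complex"
    have "norm (fst p - fst q) \<le> dist p q" "norm (snd p - snd q) \<le> dist p q"
      using dist_fst_le[of p q] dist_snd_le[of p q] by (auto simp: dist_norm)
    then show "dist (N p) (N q) \<le> 2 * dist p q"
      using onorm_plane_lipschitz[of "fst p" "snd p" "fst q" "snd q"] onorm_plane_lipschitz[of "fst q" "snd q" "fst p" "snd p"]
      by (simp add: N_def dist_real_def norm_minus_commute abs_le_iff)
  qed simp
  then have "continuous_on UNIV N" by (rule lipschitz_on_continuous_on)
  then have "(\<lambda>y. N (frechet_derivative f (at y) 1, frechet_derivative f (at y) \<i>)) \<in> borel_measurable (lebesgue_on S)"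
    by (rule borel_measurable_continuous_on) (intro borel_measurable_Pair deriv)
  moreover have "N (frechet_derivative f (at y) 1, frechet_derivative f (at y) \<i>) = onorm (frechet_derivative f (at y))"
    if "y \<in> S" for y
  proof -
    have "linear (frechet_derivative f (at y))"
      using f[OF that] by (simp add: linear_frechet_derivative)
    note l = linear_add[OF this] linear_scale[OF this]
    have h: "Re h *\<^sub>R 1 + Im h *\<^sub>R \<i> = h" for h by (simp add: complex_eq_iff)
    have "Re h *\<^sub>R frechet_derivative f (at y) 1 + Im h *\<^sub>R frechet_derivative f (at y) \<i> = frechet_derivative f (at y) h" for h
      unfolding l[symmetric] h ..
    then show ?thesis unfolding N_def fst_conv snd_conv by presburger
  qed
  ultimately show ?thesis
    by (subst measurable_cong[where g = "\<lambda>y. N (frechet_derivative f (at y) 1, frechet_derivative f (at y) \<i>)"]) auto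
qed

text \<open>
  The classical notion of solution translated to \<open>F = f\<^sub>x - i f\<^sub>y\<close>, with \<open>F\<close> continuous up to the boundary;
  boundary derivatives in a direction \<open>e\<close> become \<open>Re (F e)\<close>.
\<close>
definition complex_gradient ::
  "nat \<Rightarrow> (nat \<Rightarrow> complex) \<Rightarrow> (nat \<Rightarrow> real) \<Rightarrow> (complex \<Rightarrow> real) \<Rightarrow> (complex \<Rightarrow> complex) \<Rightarrow> bool" where
  "complex_gradient n c \<rho> f F \<longleftrightarrow>
     F holomorphic_on collar n c \<rho> 0 \<and> continuous_on (closed_collar n c \<rho> 0) F \<and>
     potential_on (collar n c \<rho> 0) f F \<and> continuous_on (closed_collar n c \<rho> 0) f \<and>
     (\<forall>y\<in>collar n c \<rho> 0. grad f y = cnj (F y)) \<and>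
     (\<forall>y\<in>closed_collar n c \<rho> 0. \<forall>e. bdry_deriv (collar n c \<rho> 0) f e y = Re (F y * e)) \<and>
     (f has_integral 0) (collar n c \<rho> 0)"

lemma integral_zero_imp_nonpos:
  fixes f :: "complex \<Rightarrow> real"
  assumes S: "open S" "S \<noteq> {}" and f: "continuous_on S f" "(f has_integral 0) S"
  shows "\<exists>x\<in>S. f x \<le> 0"
proof (rule ccontr)
  assume "\<not> ?thesis"
  then have pos: "\<And>x. x \<in> S \<Longrightarrow> 0 < f x" by force
  obtain y where y: "y \<in> S" using S by blast
  obtain a b where ab: "cbox a b \<subseteq> S" "y \<in> box a b" using open_contains_cbox[OF S(1) y] by metis
  have cont: "continuous_on (cbox a b) f" using f(1) ab(1) continuous_on_subset by blast
  have int: "(f has_integral integral (cbox a b) f) (cbox a b)"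
    using integrable_continuous[OF cont] by (rule integrable_integral)
  have nonneg: "0 \<le> f x" if "x \<in> S" for x using pos[OF that] by simp
  have "integral (cbox a b) f \<le> 0"
    by (rule has_integral_subset_le[OF ab(1) int f(2)]) (simp add: nonneg)
  moreover have "0 \<le> integral (cbox a b) f"
    by (rule integral_nonneg[OF integrable_continuous[OF cont]]) (use nonneg ab(1) in blast)
  ultimately have "(f has_integral 0) (cbox a b)" using int by simp
  moreover have "y \<in> cbox a b" using ab(2) box_subset_cbox by blast
  moreover have "0 \<le> f x" if "x \<in> box a b" for x
    using nonneg ab(1) box_subset_cbox[of a b] that by blast
  ultimately have "f y = 0"
    using ab(2) by (intro has_integral_0_cbox_imp_0[OF cont]) auto
  then show False using pos[OF y] by simp
qed

context circular_config begin

lemma domain_nonempty: "collar n c \<rho> 0 \<noteq> {}"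
proof -
  have "gap c \<rho> 0 (of_real (\<rho> 0)) = 0" using radius_pos[of 0] c0 by (simp add: gap_def)
  then have "closed_collar n c \<rho> 0 \<noteq> {}" using circle_point_in_closed_collar[of 0] by blast
  then show ?thesis using closure_domain by (metis closure_empty)
qed

lemma circle_polar:
  assumes "i \<le> n" "gap c \<rho> i y = 0"
  obtains \<theta> where "y = c i + of_real (\<rho> i) * cis \<theta>" "\<theta> \<in> {0..2 * pi}"
proof -
  have "cmod (y - c i) = \<rho> i" using assms by (auto simp: gap_def split: if_splits)
  then have "y - c i = of_real (\<rho> i) * cis (Arg2pi (y - c i))"
    using Arg2pi_eq[of "y - c i"] by (simp add: cis_conv_exp)
  then show ?thesis using that[of "Arg2pi (y - c i)"] Arg2pi_lt_2pi[of "y - c i"] Arg2pi_ge_0[of "y - c i"]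
    by (auto simp: algebra_simps less_imp_le)
qed

lemma gap_polar: "i \<le> n \<Longrightarrow> gap c \<rho> i (c i + of_real (\<rho> i) * cis \<theta>) = 0"
  using radius_pos[of i] by (simp add: gap_side norm_mult)

lemma neumann_gradient:
  assumes sol: "neumann_solution n c \<rho> g f"
  shows "\<exists>F. complex_gradient n c \<rho> f F
    \<and> (\<forall>i\<le>n. \<forall>\<theta>. Re (F (c i + of_real (\<rho> i) * cis \<theta>) * cis \<theta>) = g i \<theta>)"
proof -
  let ?E = "collar n c \<rho> 0" and ?K = "closed_collar n c \<rho> 0"
  have C2: "C2_on ?E f" and C1: "C1_closure ?E f" and harm: "\<And>y. y \<in> ?E \<Longrightarrow> laplacian f y = 0"
    and bd: "\<And>i \<theta>. i \<le> n \<Longrightarrow> bdry_deriv ?E f (cis \<theta>) (c i + of_real (\<rho> i) * cis \<theta>) = g i \<theta>"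
    and int: "(f has_integral 0) ?E"
    using sol unfolding neumann_solution_def Let_def domain_eq_collar by auto
  obtain G where G: "continuous_on ?K G" "\<And>y. y \<in> ?E \<Longrightarrow> G y = grad f y"
    using C1 unfolding C1_closure_def closure_domain by blast
  have contf: "continuous_on ?K f" using C1 unfolding C1_closure_def closure_domain by blast
  have EK: "?E \<subseteq> ?K" by (rule collar_subset_closed_collar) simp
  define F where "F y = cnj (G y)" for y
  have dif: "f differentiable (at y)" "grad f differentiable (at y)" if "y \<in> ?E" for y
    using C2 that unfolding C2_on_def by auto
  have 1: "F holomorphic_on ?E"
    by (rule holomorphic_transform[OF holomorphic_cnj_grad[OF open_collar dif harm]])
       (simp_all add: F_def G(2))
  have 2: "continuous_on ?K F" unfolding F_def by (intro continuous_intros G)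
  have 3: "potential_on ?E f F"
    unfolding potential_on_def
  proof
    fix y assume y: "y \<in> ?E"
    show "(f has_derivative (\<lambda>h. Re (F y * h))) (at y)"
      using has_derivative_grad[OF dif(1)[OF y]] by (simp add: F_def G(2)[OF y])
  qed
  have 5: "grad f y = cnj (F y)" if "y \<in> ?E" for y using that by (simp add: F_def G)
  have 6: "bdry_deriv ?E f e y = Re (F y * e)" if y: "y \<in> ?K" for y e
  proof -
    have "y islimpt ?E"
    proof (cases "y \<in> ?E")
      case True then show ?thesis using interior_limit_point interior_open[OF open_collar] by metis
    next
      case False then show ?thesis using y closure_domain by (auto simp: closure_def)
    qed
    then have nt: "\<not> trivial_limit (at y within ?E)" by (simp add: trivial_limit_within)
    have "(G \<longlongrightarrow> G y) (at y within ?E)"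
      using G(1) y EK by (auto simp: continuous_on_def intro: tendsto_within_subset)
    moreover have "eventually (\<lambda>x. G x = grad f x) (at y within ?E)"
      unfolding eventually_at_filter using G(2) by (auto intro: always_eventually)
    ultimately have "(grad f \<longlongrightarrow> G y) (at y within ?E)" by (rule Lim_transform_eventually)
    then have "Lim (at y within ?E) (grad f) = G y" by (rule tendsto_Lim[OF nt])
    then show ?thesis by (simp add: bdry_deriv_def F_def inner_complex_def)
  qed
  have 7: "Re (F (c i + of_real (\<rho> i) * cis \<theta>) * cis \<theta>) = g i \<theta>" if "i \<le> n" for i \<theta>
    using bd[OF that, of \<theta>] 6[OF circle_point_in_closed_collar[OF that gap_polar[OF that]]] by metis
  show ?thesis
    unfolding complex_gradient_def using 1 2 3 contf 5 6 7 int by (intro exI[of _ F]) blast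
qed

text \<open>
  A function of mean zero takes values of both signs, so it is bounded by its oscillation.
\<close>
lemma mean_zero_bound:
  assumes pot: "potential_on (collar n c \<rho> 0) f F" and cont: "continuous_on (closed_collar n c \<rho> 0) f"
    and F: "\<And>y. y \<in> collar n c \<rho> 0 \<Longrightarrow> cmod (F y) \<le> M"
    and int: "(f has_integral 0) (collar n c \<rho> 0)"
    and y: "y \<in> closed_collar n c \<rho> 0"
  shows "\<bar>f y\<bar> \<le> M * \<rho> 0 * (10 * 2 ^ n)"
proof -
  let ?E = "collar n c \<rho> 0"
  have cE: "continuous_on ?E f" by (rule potential_continuous_on[OF pot])
  obtain x1 where x1: "x1 \<in> ?E" "f x1 \<le> 0"
    using integral_zero_imp_nonpos[OF open_collar domain_nonempty cE int] by blast
  obtain x2 where x2: "x2 \<in> ?E" "f x2 \<ge> 0"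
    using integral_zero_imp_nonpos[OF open_collar domain_nonempty, of "\<lambda>y. - f y"] cE has_integral_neg[OF int]
    by (auto intro: continuous_on_minus)
  have "\<bar>f y\<bar> \<le> M * \<rho> 0 * (10 * 2 ^ n)" if "y \<in> ?E" for y
    using oscillation_bound[OF pot F that x1(1)] oscillation_bound[OF pot F that x2(1)] x1 x2 by (auto simp: abs_le_iff)
  then have "norm (f y) \<le> M * \<rho> 0 * (10 * 2 ^ n)" if "y \<in> closure ?E" for y
    using cont closure_domain that by (intro continuous_on_closure_norm_le[of ?E f]) auto
  then show ?thesis using y closure_domain by simp
qed

lemma deriv_bound_closed:
  assumes s: "0 < s" and F: "F holomorphic_on collar n c \<rho> s"
    and M: "\<And>y. y \<in> collar n c \<rho> s \<Longrightarrow> cmod (F y) \<le> M" and y: "y \<in> closed_collar n c \<rho> 0"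
  shows "cmod (deriv F y) \<le> M / (s / 2)"
proof -
  have "ball y s \<subseteq> collar n c \<rho> s" using ball_subset_collar[OF y, of s] by simp
  moreover have "cball y (s / 2) \<subseteq> ball y s" using s by (auto)
  ultimately have sub: "cball y (s / 2) \<subseteq> collar n c \<rho> s" by blast
  have "norm ((deriv ^^ 1) F y) \<le> fact 1 * M / (s / 2) ^ 1"
  proof (rule Cauchy_inequality)
    show "F holomorphic_on ball y (s / 2)" using F sub ball_subset_cball holomorphic_on_subset by blast
    show "continuous_on (cball y (s / 2)) F"
      using holomorphic_on_imp_continuous_on[OF F] sub continuous_on_subset by blast
    show "norm (F x) \<le> M" if "norm (y - x) = s / 2" for x
      using that sub by (intro M) (auto simp: dist_norm subset_iff)
  qed (use s in simp)
  then show ?thesis by simp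
qed

end

context stream_config begin

lemma grad_stream_deriv_bounded:
  assumes y: "y \<in> collar n c \<rho> 0" and R: "2 * \<rho> 0 \<le> R"
    and C0: "\<And>y. y \<in> closed_collar n c \<rho> 0 \<Longrightarrow> \<bar>f y\<bar> \<le> C0"
    and C1: "\<And>y. y \<in> closed_collar n c \<rho> 0 \<Longrightarrow> cmod (F y) \<le> C1"
    and C2: "\<And>y. y \<in> closed_collar n c \<rho> 0 \<Longrightarrow> cmod (deriv F y) \<le> C2"
    and Z: "\<And>k x. k \<le> 2 \<Longrightarrow> 0 \<le> x \<Longrightarrow> x \<le> 2 \<Longrightarrow> \<bar>D k x\<bar> \<le> Z"
  shows "\<exists>A. deriv_bounded (grad \<psi>) y A (C2 + \<bar>stream_const d R C0 C1 C2 Z\<bar>)"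
proof -
  have yK: "y \<in> closed_collar n c \<rho> 0" using y collar_subset_closed_collar[of 0 0 n c \<rho>] by auto
  have ys: "y \<in> collar n c \<rho> s" using yK closed_collar_subset_collar[of 0 s n c \<rho>] s by auto
  have dF: "deriv_bounded (\<lambda>y. cnj (F y)) y C1 C2"
    by (intro deriv_bounded_cnj deriv_bounded_field[OF holomorphic_derivI[OF F open_collar ys]] C1 C2 yK)
  show ?thesis
  proof (rule domain_cover[OF y])
    fix i assume i: "i \<le> n" and sh: "y \<in> shell i"
    obtain A where "deriv_bounded (correction i) y A (stream_const d R C0 C1 C2 Z)"
      using correction_deriv_bounded[OF i sh R C0 C1 C2 Z] by blast
    from deriv_bounded_diff[OF dF this]
    have "deriv_bounded (\<lambda>y. cnj (F y) - correction i y) y (C1 + A) (C2 + \<bar>stream_const d R C0 C1 C2 Z\<bar>)"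
      by (rule deriv_bounded_mono) auto
    then have "deriv_bounded (grad \<psi>) y (C1 + A) (C2 + \<bar>stream_const d R C0 C1 C2 Z\<bar>)"
      by (rule deriv_bounded_transform[OF _ open_shell sh]) (simp add: grad_stream_near[OF i])
    then show ?thesis by blast
  next
    assume far: "y \<in> collar n c \<rho> (- (d / 2))"
    have "deriv_bounded (\<lambda>y. cnj (F y)) y C1 (C2 + \<bar>stream_const d R C0 C1 C2 Z\<bar>)"
      by (rule deriv_bounded_mono[OF dF]) auto
    then have "deriv_bounded (grad \<psi>) y C1 (C2 + \<bar>stream_const d R C0 C1 C2 Z\<bar>)"
      by (rule deriv_bounded_transform[OF _ open_collar far]) (simp add: grad_stream_far)
    then show ?thesis by blast
  qed
qed

text \<open>
  Multiplied by \<open>cnj (Y - c i)\<close>, the limit of the velocity is \<open>cnj (\<eta> G) - i cnj (\<eta> F) + Im (\<eta> F)\<close> with \<open>\<eta> = Y - c i\<close>.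
  The last term cancels the part of the second one that comes from the tangential derivative of \<open>f\<close>, and by \<open>bcF\<close>
  the remainder of the second one cancels the tangential part \<open>Im (\<eta> G)\<close> of the first.
\<close>
lemma velocity_boundary_limit:
  assumes i: "i \<le> n" and Y: "gap c \<rho> i Y = 0" and \<zeta>0: "\<zeta> 0 = 1" and D10: "D 1 0 = 0"
    and contG: "continuous_on (closed_collar n c \<rho> 0) G"
    and grad: "\<And>y. y \<in> collar n c \<rho> 0 \<Longrightarrow> grad \<phi> y = cnj (G y)"
    and bcG: "Re ((Y - c i) * G Y) = \<kappa>"
    and bcF: "Re ((Y - c i) * F Y) = Re (\<i> * ((Y - c i) * G Y))"
  shows "((\<lambda>y. grad \<phi> y + perp_grad \<psi> y) \<longlongrightarrow> of_real \<kappa> / cnj (Y - c i)) (at Y within collar n c \<rho> 0)"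
proof -
  let ?E = "collar n c \<rho> 0"
  have YK: "Y \<in> closed_collar n c \<rho> 0" by (rule circle_point_in_closed_collar[OF i Y])
  have Ys: "Y \<in> collar n c \<rho> s" using YK closed_collar_subset_collar[of 0 s n c \<rho>] s by auto
  have Yc: "Y - c i \<noteq> 0" using Y radius_pos[OF i] by (auto simp: gap_side side_def split: if_splits)
  have EK: "?E \<subseteq> closed_collar n c \<rho> 0" by (rule collar_subset_closed_collar) simp
  have G: "(G \<longlongrightarrow> G Y) (at Y within ?E)"
    using contG YK EK by (auto simp: continuous_on_def intro: tendsto_within_subset)
  have "isCont F Y"
    using F open_collar Ys by (meson holomorphic_on_imp_differentiable_at field_differentiable_imp_continuous_at)
  then have F': "(F \<longlongrightarrow> F Y) (at Y within ?E)"
    by (auto simp: isCont_def intro: tendsto_within_subset)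
  have lim: "((\<lambda>y. cnj (G y) + - \<i> * (cnj (F y) - correction i y)) \<longlongrightarrow>
      cnj (G Y) + - \<i> * (cnj (F Y) - of_real (torque i Y) * cnj (- \<i> / (Y - c i)))) (at Y within ?E)"
    by (intro tendsto_intros G F' correction_boundary_limit[OF i Y \<zeta>0 D10])
  have val: "cnj (G Y) + - \<i> * (cnj (F Y) - of_real (torque i Y) * cnj (- \<i> / (Y - c i))) = of_real \<kappa> / cnj (Y - c i)"
  proof -
    define \<eta> where "\<eta> = Y - c i"
    define X where "X = cnj (G Y) + - \<i> * (cnj (F Y) - of_real (torque i Y) * cnj (- \<i> / \<eta>))"
    have \<eta>: "\<eta> \<noteq> 0" using Yc by (simp add: \<eta>_def)
    have "cnj \<eta> * X
        = cnj (\<eta> * G Y) - \<i> * cnj (\<eta> * F Y) - of_real (torque i Y)"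
      using \<eta> by (simp add: X_def algebra_simps)
    also have "\<dots> = of_real \<kappa>"
      using bcG bcF by (simp add: complex_eq_iff torque_def flip: \<eta>_def)
    finally have "X = of_real \<kappa> / cnj \<eta>" using \<eta> by (simp add: nonzero_eq_divide_eq mult.commute)
    then show ?thesis unfolding X_def \<eta>_def .
  qed
  have "eventually (\<lambda>y. y \<in> shell i \<union> {y. gap c \<rho> i y \<le> 0}) (at Y within ?E)"
  proof -
    have "eventually (\<lambda>y. y \<in> {y. gap c \<rho> i y < 3 * d / 4}) (at Y within ?E)"
      using Y d_pos by (intro topological_tendstoD[OF tendsto_ident_at] open_Collect_less continuous_intros) auto
    then show ?thesis by eventually_elim (auto simp: shell_def)
  qed
  moreover have "eventually (\<lambda>y. y \<in> ?E) (at Y within ?E)"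
    unfolding eventually_at_filter by (auto intro: always_eventually)
  ultimately have "eventually (\<lambda>y. cnj (G y) + - \<i> * (cnj (F y) - correction i y) = grad \<phi> y + perp_grad \<psi> y) (at Y within ?E)"
  proof eventually_elim
    case (elim y)
    then have "y \<in> shell i" using i by (auto simp: collar_def)
    then show ?case using grad[of y] elim grad_stream_near[OF i] by (simp add: perp_grad_eq)
  qed
  from Lim_transform_eventually[OF lim this] show ?thesis unfolding val .
qed

end

lemma dist_gt_if_cballs_disjoint:
  fixes a b :: complex
  assumes "cball a r \<inter> cball b s = {}" "0 \<le> r" "0 \<le> s"
  shows "r + s < dist a b"
proof (rule ccontr)
  assume "\<not> r + s < dist a b"
  then have le: "dist a b \<le> r + s" by simp
  show False
  proof (cases "r + s = 0")
    case True
    then have "r = 0" "s = 0" using assms by linarith+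
    then show False using le assms by simp
  next
    case False
    then have rs: "0 < r + s" using assms by simp
    define p where "p = a + (r / (r + s)) *\<^sub>R (b - a)"
    have 1: "dist a p = r / (r + s) * dist a b"
      using rs assms by (simp add: p_def dist_norm norm_minus_commute)
    have "b - p = (1 - r / (r + s)) *\<^sub>R (b - a)" by (simp add: p_def algebra_simps)
    moreover have "1 - r / (r + s) = s / (r + s)" using rs by (simp add: field_simps)
    ultimately have 2: "dist b p = s / (r + s) * dist a b"
      using rs assms by (simp add: dist_norm norm_minus_commute)
    have "dist a p \<le> r" "dist b p \<le> s"
      unfolding 1 2 using rs assms mult_left_mono[OF le, of r] mult_left_mono[OF le, of s]
      by (simp_all add: divide_le_eq)
    then have "p \<in> cball a r \<inter> cball b s" by simp
    then show False using assms by simp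
  qed
qed

lemma circular_configI:
  assumes d: "0 < d" and c0: "c 0 = 0" and n: "1 \<le> n"
    and r: "\<And>i. i \<in> {1..n} \<Longrightarrow> d \<le> \<rho> i"
    and disj: "disjoint_family_on (\<lambda>i. cball (c i) (\<rho> i + d)) {1..n}"
    and sub: "\<And>i. i \<in> {1..n} \<Longrightarrow> cball (c i) (\<rho> i + d) \<subseteq> ball 0 (\<rho> 0 - d)"
  shows "circular_config n c \<rho> d"
proof
  have out: "cmod (c i) + \<rho> i + d < \<rho> 0 - d" if "i \<in> {1..n}" for i
    using sub[OF that] r[OF that] d unfolding cball_subset_ball_iff by (auto simp: dist_norm)
  show "d \<le> \<rho> i" if "i \<le> n" for i
  proof (cases "i = 0")
    case True
    have "cmod (c 1) + \<rho> 1 + d < \<rho> 0 - d" "d \<le> \<rho> 1" using out[of 1] r[of 1] n by auto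
    then have "d \<le> \<rho> 0" using norm_ge_zero[of "c 1"] d by linarith
    then show ?thesis using True by simp
  qed (use r[of i] that in auto)
  have outer: "2 * d \<le> gap c \<rho> 0 y + gap c \<rho> j y" if "j \<in> {1..n}" for j y
    using out[OF that] norm_triangle_ineq2[of y "c j"] c0 that by (auto simp: gap_def)
  have inner: "2 * d \<le> gap c \<rho> i y + gap c \<rho> j y" if "i \<in> {1..n}" "j \<in> {1..n}" "i \<noteq> j" for i j y
  proof -
    have "cball (c i) (\<rho> i + d) \<inter> cball (c j) (\<rho> j + d) = {}"
      using disj that unfolding disjoint_family_on_def by blast
    then have "(\<rho> i + d) + (\<rho> j + d) < dist (c i) (c j)"
      using r[OF that(1)] r[OF that(2)] d by (intro dist_gt_if_cballs_disjoint) auto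
    moreover have "dist (c i) (c j) \<le> cmod (y - c i) + cmod (y - c j)"
      using dist_triangle3[of "c i" "c j" y] by (simp add: dist_norm)
    ultimately show ?thesis using that by (simp add: gap_def)
  qed
  show "2 * d \<le> gap c \<rho> i y + gap c \<rho> j y" if "i \<le> n" "j \<le> n" "i \<noteq> j" for i j y
    using inner[of i j y] outer[of i y] outer[of j y] that
    by (cases "i = 0"; cases "j = 0") (auto simp: add.commute)
qed (use d c0 in auto)

section \<open>Uniformity in time and the velocity field of the evolution\<close>

text \<open>
  The uniform bound on the closed domains makes the bound for the extensions uniform as well.
\<close>
lemma uniform_extension:
  fixes c :: "real \<Rightarrow> nat \<Rightarrow> complex" and \<rho> :: "real \<Rightarrow> nat \<Rightarrow> real"
  assumes T: "compact T"
    and config: "\<And>t. t \<in> T \<Longrightarrow> circular_config n (c t) (\<rho> t) d"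
    and c: "\<And>i. i \<le> n \<Longrightarrow> continuous_on T (\<lambda>t. c t i)"
    and \<rho>: "\<And>i. i \<le> n \<Longrightarrow> continuous_on T (\<lambda>t. \<rho> t i)"
    and e: "0 < e" "e \<le> d"
    and F: "\<And>t. t \<in> T \<Longrightarrow> F t holomorphic_on collar n (c t) (\<rho> t) 0"
    and contF: "\<And>t. t \<in> T \<Longrightarrow> continuous_on (closed_collar n (c t) (\<rho> t) 0) (F t)"
    and pot: "\<And>t. t \<in> T \<Longrightarrow> potential_on (collar n (c t) (\<rho> t) 0) (f t) (F t)"
    and h: "\<And>t i. t \<in> T \<Longrightarrow> i \<le> n \<Longrightarrow> h t i holomorphic_on {y. \<bar>gap (c t) (\<rho> t) i y\<bar> < e}"
    and hB: "\<And>t i y. t \<in> T \<Longrightarrow> i \<le> n \<Longrightarrow> \<bar>gap (c t) (\<rho> t) i y\<bar> < e \<Longrightarrow> cmod (h t i y) \<le> B"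
    and bc: "\<And>t i y. t \<in> T \<Longrightarrow> i \<le> n \<Longrightarrow> gap (c t) (\<rho> t) i y = 0 \<Longrightarrow> Re ((y - c t i) * (F t y - h t i y)) = 0"
  shows "\<exists>M F'. \<forall>t\<in>T. F' t holomorphic_on collar n (c t) (\<rho> t) (e / 2) \<and>
    (\<forall>y\<in>closed_collar n (c t) (\<rho> t) 0. F' t y = F t y) \<and>
    (\<forall>y\<in>collar n (c t) (\<rho> t) (e / 2). cmod (F' t y) \<le> M)"
proof -
  obtain M where M: "\<And>t y. t \<in> T \<Longrightarrow> y \<in> closed_collar n (c t) (\<rho> t) 0 \<Longrightarrow> cmod (F t y) \<le> M"
    using uniform_gradient_bound[OF assms] by blast
  have "\<exists>F'. F' holomorphic_on collar n (c t) (\<rho> t) (e / 2) \<and>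
      (\<forall>y\<in>closed_collar n (c t) (\<rho> t) 0. F' y = F t y) \<and>
      (\<forall>y\<in>collar n (c t) (\<rho> t) (e / 2). cmod (F' y) \<le> 5 * (M + B))" if t: "t \<in> T" for t
  proof -
    interpret circular_config n "c t" "\<rho> t" d by (rule config[OF t])
    show ?thesis
      using domain_extension[OF e F[OF t] contF[OF t] h[OF t] bc[OF t] M[OF t] hB[OF t]] by metis
  qed
  then have "\<forall>t\<in>T. \<exists>F'. F' holomorphic_on collar n (c t) (\<rho> t) (e / 2) \<and>
      (\<forall>y\<in>closed_collar n (c t) (\<rho> t) 0. F' y = F t y) \<and>
      (\<forall>y\<in>collar n (c t) (\<rho> t) (e / 2). cmod (F' y) \<le> 5 * (M + B))" by blast
  from bchoice[OF this] show ?thesis by blast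
qed

lemma C1_within_continuous: "C1_within T f \<Longrightarrow> continuous_on T f"
  unfolding C1_within_def continuous_on_eq_continuous_within
  using has_vector_derivative_continuous by blast

context
  fixes R0 lam :: real and n :: nat and a :: "nat \<Rightarrow> complex" and V R :: "nat \<Rightarrow> real"
    and z :: "nat \<Rightarrow> real \<Rightarrow> complex" and L :: "nat \<Rightarrow> real \<Rightarrow> real"
  assumes R0: "R0 > 0" and evo: "attainable_evolution R0 n a V lam z L"
    and R: "\<And>i. i \<in> {1..n} \<Longrightarrow> R i > 0"
begin

text \<open>
  Without cavities the total volume \<open>(lam\<^sup>2 - 1) * pi * R0\<^sup>2\<close> would have to vanish.
\<close>
lemma evolution_nontrivial: "1 < lam" "1 \<le> n"
proof -
  show lam: "1 < lam" using evo by (simp add: attainable_evolution_def)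
  have "(\<Sum>i=1..n. V i) = (lam\<^sup>2 - 1) * pi * R0\<^sup>2" using evo by (simp add: attainable_evolution_def)
  moreover have "0 < (lam\<^sup>2 - 1) * pi * R0\<^sup>2" using lam R0 by simp
  ultimately have "(\<Sum>i=1..n. V i) \<noteq> 0" by linarith
  then show "1 \<le> n" by (cases n) auto
qed

lemma centres_continuous: "i \<le> n \<Longrightarrow> continuous_on {1..lam} (\<lambda>t. centres z t i)"
  using evo C1_within_continuous[of "{1..lam}" "z i"]
  by (cases "i = 0") (auto simp: centres_def attainable_evolution_def)

text \<open>
  What is known to be differentiable is the square of \<open>L i\<close>; the positive \<open>R i\<close> keep the square root away from its
  singularity. The product of radius and derivative, which is what enters the boundary condition, is continuous.
\<close>
lemma radii_derivative:
  assumes "i \<le> n"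
  shows "\<exists>k. continuous_on {1..lam} k \<and> (\<forall>t\<in>{1..lam}.
    ((\<lambda>s. radii R0 R L s i) has_real_derivative k t / radii R0 R L t i) (at t within {1..lam}) \<and> 0 < radii R0 R L t i)"
proof (cases "i = 0")
  case True
  have "((\<lambda>s. s * R0) has_real_derivative R0) (at t within {1..lam})" for t
    by (auto intro!: derivative_eq_intros)
  then show ?thesis
    using True R0 by (intro exI[of _ "\<lambda>t. t * R0 * R0"]) (auto simp: radii_def intro!: continuous_intros)
next
  case False
  then have i: "i \<in> {1..n}" using assms by auto
  then have "C1_within {1..lam} (\<lambda>t. (L i t)\<^sup>2)" using evo by (simp add: attainable_evolution_def)
  then obtain g where g: "\<And>t. t \<in> {1..lam} \<Longrightarrow> ((\<lambda>t. (L i t)\<^sup>2) has_vector_derivative g t) (at t within {1..lam})"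
    "continuous_on {1..lam} g" unfolding C1_within_def by blast
  have "((\<lambda>s. sqrt ((L i s)\<^sup>2 + (R i)\<^sup>2)) has_real_derivative (g t / 2) / sqrt ((L i t)\<^sup>2 + (R i)\<^sup>2)) (at t within {1..lam})"
    "0 < sqrt ((L i t)\<^sup>2 + (R i)\<^sup>2)" if t: "t \<in> {1..lam}" for t
  proof -
    have pos: "0 < (L i t)\<^sup>2 + (R i)\<^sup>2" using R[OF i] by (simp add: add_nonneg_pos)
    have "((\<lambda>s. (L i s)\<^sup>2 + (R i)\<^sup>2) has_real_derivative g t + 0) (at t within {1..lam})"
      using g(1)[OF t] by (intro DERIV_add DERIV_const) (simp add: has_real_derivative_iff_has_vector_derivative)
    from DERIV_chain2[OF DERIV_real_sqrt[OF pos] this]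
    show "((\<lambda>s. sqrt ((L i s)\<^sup>2 + (R i)\<^sup>2)) has_real_derivative (g t / 2) / sqrt ((L i t)\<^sup>2 + (R i)\<^sup>2)) (at t within {1..lam})"
      by (simp add: field_simps)
    show "0 < sqrt ((L i t)\<^sup>2 + (R i)\<^sup>2)" using pos by simp
  qed
  then show ?thesis
    using False g(2) by (intro exI[of _ "\<lambda>t. g t / 2"]) (auto simp: radii_def intro!: continuous_intros)
qed

lemma radii_continuous:
  assumes i: "i \<le> n" shows "continuous_on {1..lam} (\<lambda>t. radii R0 R L t i)"
proof -
  obtain k where "\<And>t. t \<in> {1..lam} \<Longrightarrow>
      ((\<lambda>s. radii R0 R L s i) has_real_derivative k t / radii R0 R L t i) (at t within {1..lam})"
    using radii_derivative[OF i] by blast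
  then show ?thesis by (rule DERIV_continuous_on)
qed

lemma radial_flux_bounded:
  "\<exists>K. \<forall>t\<in>{1..lam}. \<forall>i\<le>n.
     \<bar>radii R0 R L t i * vector_derivative (\<lambda>s. radii R0 R L s i) (at t within {1..lam})\<bar> \<le> K"
proof -
  have "\<exists>K. \<forall>t\<in>{1..lam}. \<bar>radii R0 R L t i * vector_derivative (\<lambda>s. radii R0 R L s i) (at t within {1..lam})\<bar> \<le> K"
    if i: "i \<le> n" for i
  proof -
    obtain k where k: "continuous_on {1..lam} k" "\<And>t. t \<in> {1..lam} \<Longrightarrow>
        ((\<lambda>s. radii R0 R L s i) has_real_derivative k t / radii R0 R L t i) (at t within {1..lam})"
        "\<And>t. t \<in> {1..lam} \<Longrightarrow> 0 < radii R0 R L t i"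
      using radii_derivative[OF i] by blast
    have eq: "radii R0 R L t i * vector_derivative (\<lambda>s. radii R0 R L s i) (at t within {1..lam}) = k t"
      if t: "t \<in> {1..lam}" for t
    proof -
      have "vector_derivative (\<lambda>s. radii R0 R L s i) (at t within {1..lam}) = k t / radii R0 R L t i"
        using k(2)[OF t] t evolution_nontrivial(1)
        by (intro vector_derivative_within_closed_interval) (auto simp: has_real_derivative_iff_has_vector_derivative)
      then show ?thesis using k(3)[OF t] by simp
    qed
    obtain K where "\<And>t. t \<in> {1..lam} \<Longrightarrow> norm (k t) \<le> K"
      using compact_imp_bounded[OF compact_continuous_image[OF k(1) compact_Icc]] unfolding bounded_iff by blast
    then show ?thesis using eq by (intro exI[of _ K]) simp
  qed
  then obtain K where K: "\<And>i t. i \<le> n \<Longrightarrow> t \<in> {1..lam} \<Longrightarrow>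
      \<bar>radii R0 R L t i * vector_derivative (\<lambda>s. radii R0 R L s i) (at t within {1..lam})\<bar> \<le> K i" by metis
  have "K i \<le> Max (K ` {..n})" if "i \<le> n" for i using that by (intro Max_ge) auto
  then show ?thesis using K by (intro exI[of _ "Max (K ` {..n})"]) (meson order_trans)
qed

end

lemma smooth_within_derivatives_bounded:
  assumes D: "\<And>k x. 0 \<le> x \<Longrightarrow> (D k has_real_derivative D (Suc k) x) (at x within {0..})"
  shows "\<exists>Z. \<forall>k\<le>(2::nat). \<forall>x. 0 \<le> x \<and> x \<le> 2 \<longrightarrow> \<bar>D k x\<bar> \<le> Z"
proof -
  have "\<exists>Z. \<forall>x\<in>{0..2}. \<bar>D k x\<bar> \<le> Z" for k
  proof -
    have "continuous_on {0..} (D k)" by (rule DERIV_continuous_on) (use D in auto)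
    then have "continuous_on {0..2} (D k)" by (rule continuous_on_subset) auto
    from compact_imp_bounded[OF compact_continuous_image[OF this compact_Icc]]
    show ?thesis unfolding bounded_iff by auto
  qed
  then obtain Z where Z: "\<And>k x. x \<in> {0..2} \<Longrightarrow> \<bar>D k x\<bar> \<le> Z k" by metis
  have "Z k \<le> Max (Z ` {..2})" if "k \<le> 2" for k using that by (intro Max_ge) auto
  then show ?thesis using Z by (intro exI[of _ "Max (Z ` {..2})"]) (fastforce intro: order_trans)
qed

theorem theorem5p6:
  fixes n :: nat and R0 lam d :: real
    and a :: "nat \<Rightarrow> complex" and V R :: "nat \<Rightarrow> real"
    and z :: "nat \<Rightarrow> real \<Rightarrow> complex" and L :: "nat \<Rightarrow> real \<Rightarrow> real"
    and c :: "real \<Rightarrow> nat \<Rightarrow> complex" and r :: "real \<Rightarrow> nat \<Rightarrow> real"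
    and E :: "real \<Rightarrow> complex set" and \<zeta> :: "real \<Rightarrow> real"
    and \<phi> \<phi>' \<psi> :: "real \<Rightarrow> complex \<Rightarrow> real" and v :: "complex \<Rightarrow> real \<Rightarrow> complex"
  assumes "R0 > 0"
    and "attainable R0 n a V"
    and "attainable_evolution R0 n a V lam z L"
    and "\<And>i. i \<in> {1..n} \<Longrightarrow> R i > 0"
    and c_def: "c = centres z"
    and r_def: "r = radii R0 R L"
    and "\<And>t. t \<in> {1..lam} \<Longrightarrow> disjoint_family_on (\<lambda>i. cball (z i t) (r t i)) {1..n}"
    and "\<And>t i. t \<in> {1..lam} \<Longrightarrow> i \<in> {1..n} \<Longrightarrow> cball (z i t) (r t i) \<subseteq> ball 0 (t * R0)"
    and E_def: "\<And>t. E t = circular_domain n (c t) (r t)"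
    and "d > 0"
    and "\<And>t i. t \<in> {1..lam} \<Longrightarrow> i \<in> {1..n} \<Longrightarrow> r t i \<ge> d"
    and "\<And>t. t \<in> {1..lam} \<Longrightarrow> disjoint_family_on (\<lambda>i. cball (z i t) (r t i + d)) {1..n}"
    and "\<And>t i. t \<in> {1..lam} \<Longrightarrow> i \<in> {1..n} \<Longrightarrow> cball (z i t) (r t i + d) \<subseteq> ball 0 (r t 0 - d)"
    and "smooth_within {0..} \<zeta>" and "\<And>x. x \<ge> 0 \<Longrightarrow> \<zeta> x \<in> {0..1}"
    and "\<zeta> 0 = 1" and "(\<zeta> has_real_derivative 0) (at 0 within {0..})"
    and "\<And>x. x \<ge> 1 \<Longrightarrow> \<zeta> x = 0"
    and "\<And>t. t \<in> {1..lam} \<Longrightarrow>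
           neumann_solution n (c t) (r t)
             (\<lambda>i \<theta>. vector_derivative (\<lambda>s. r s i) (at t within {1..lam})) (\<phi> t)"
    and "\<And>t. t \<in> {1..lam} \<Longrightarrow>
           neumann_solution n (c t) (r t)
             (\<lambda>i \<theta>. bdry_deriv (E t) (\<phi> t) (\<i> * cis \<theta>) (c t i + of_real (r t i) * cis \<theta>)) (\<phi>' t)"
    and \<psi>_def: "\<And>t. \<psi> t = stream_fun n (c t) (r t) d \<zeta> (\<phi>' t)"
    and v_def: "\<And>y t. v y t = grad (\<phi> t) y + perp_grad (\<psi> t) y"
  shows "(\<forall>t\<in>{1..lam}. \<forall>y\<in>E t.
            (\<lambda>x. v x t) differentiable (at y) \<and> divergence (\<lambda>x. v x t) y = 0) \<and>
         (\<forall>t\<in>{1..lam}. \<forall>i\<in>{1..n}. \<forall>\<theta>\<in>{0..2 * pi}.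
            ((\<lambda>x. v x t) \<longlongrightarrow>
               of_real (vector_derivative (\<lambda>s. r s i) (at t within {1..lam})) * cis \<theta>)
              (at (z i t + of_real (r t i) * cis \<theta>) within E t)) \<and>
         (SUP t\<in>{1..lam}. esssup (lebesgue_on (E t))
            (\<lambda>y. ereal (onorm (frechet_derivative (\<lambda>x. v x t) (at y))))) < \<infinity>"
proof -
  let ?T = "{1..lam}"
  let ?D = "\<lambda>t. collar n (c t) (r t)" and ?K = "\<lambda>t. closed_collar n (c t) (r t)"
  let ?rdot = "\<lambda>t i. vector_derivative (\<lambda>s. r s i) (at t within ?T)"
  have d: "0 < d" by fact
  note evo = assms(1,3,4)
  have lam: "1 < lam" and n1: "1 \<le> n" using evolution_nontrivial[OF evo] by auto
  have cz: "c t i = z i t" if "i \<in> {1..n}" for t i using that by (simp add: c_def centres_def)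
  have cfg: "circular_config n (c t) (r t) d" if t: "t \<in> ?T" for t
  proof (rule circular_configI[OF d _ n1])
    show "c t 0 = 0" by (simp add: c_def centres_def)
    show "disjoint_family_on (\<lambda>i. cball (c t i) (r t i + d)) {1..n}"
      using assms(12)[OF t] cz unfolding disjoint_family_on_def by simp
  qed (use assms(11,13)[OF t] cz in auto)
  have E: "E t = ?D t 0" if "t \<in> ?T" for t
    using circular_config.domain_eq_collar[OF cfg[OF that]] E_def by simp
  have cont_c: "continuous_on ?T (\<lambda>t. c t i)" and cont_r: "continuous_on ?T (\<lambda>t. r t i)" if "i \<le> n" for i
    using centres_continuous[OF evo that] radii_continuous[OF evo that] by (simp_all add: c_def r_def)
  obtain K where K: "\<And>t i. t \<in> ?T \<Longrightarrow> i \<le> n \<Longrightarrow> \<bar>r t i * ?rdot t i\<bar> \<le> K"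
    using radial_flux_bounded[where R = R, OF evo] unfolding r_def by blast
  have r0: "r t 0 \<le> lam * R0" if "t \<in> ?T" for t
    using that assms(1) by (simp add: r_def radii_def)

  have "\<forall>t\<in>?T. \<exists>F. complex_gradient n (c t) (r t) (\<phi> t) F
      \<and> (\<forall>i\<le>n. \<forall>\<theta>. Re (F (c t i + of_real (r t i) * cis \<theta>) * cis \<theta>) = ?rdot t i)"
    using circular_config.neumann_gradient[OF cfg assms(19)] by blast
  from bchoice[OF this] obtain F where F: "\<And>t. t \<in> ?T \<Longrightarrow> complex_gradient n (c t) (r t) (\<phi> t) (F t)"
    and F_bc: "\<And>t i \<theta>. t \<in> ?T \<Longrightarrow> i \<le> n \<Longrightarrow> Re (F t (c t i + of_real (r t i) * cis \<theta>) * cis \<theta>) = ?rdot t i"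
    by blast
  have "\<forall>t\<in>?T. \<exists>F'. complex_gradient n (c t) (r t) (\<phi>' t) F'
      \<and> (\<forall>i\<le>n. \<forall>\<theta>. Re (F' (c t i + of_real (r t i) * cis \<theta>) * cis \<theta>) =
           bdry_deriv (E t) (\<phi> t) (\<i> * cis \<theta>) (c t i + of_real (r t i) * cis \<theta>))"
    using circular_config.neumann_gradient[OF cfg assms(20)] by blast
  from bchoice[OF this] obtain H where H: "\<And>t. t \<in> ?T \<Longrightarrow> complex_gradient n (c t) (r t) (\<phi>' t) (H t)"
    and H_bd: "\<And>t i \<theta>. t \<in> ?T \<Longrightarrow> i \<le> n \<Longrightarrow> Re (H t (c t i + of_real (r t i) * cis \<theta>) * cis \<theta>) =
           bdry_deriv (E t) (\<phi> t) (\<i> * cis \<theta>) (c t i + of_real (r t i) * cis \<theta>)"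
    by blast
  have bcF: "Re ((y - c t i) * F t y) = r t i * ?rdot t i"
    and bcH: "Re ((y - c t i) * H t y) = Re (\<i> * ((y - c t i) * F t y))"
    if t: "t \<in> ?T" and i: "i \<le> n" and y: "gap (c t) (r t) i y = 0" for t i y
  proof -
    interpret circular_config n "c t" "r t" d by (rule cfg[OF t])
    obtain \<theta> where \<theta>: "y = c t i + of_real (r t i) * cis \<theta>" by (rule circle_polar[OF i y])
    have yK: "y \<in> ?K t 0" by (rule circle_point_in_closed_collar[OF i y])
    have m: "Re ((y - c t i) * w) = r t i * Re (w * cis \<theta>)" for w
      unfolding \<theta> by (simp add: algebra_simps)
    show "Re ((y - c t i) * F t y) = r t i * ?rdot t i"
      unfolding m using F_bc[OF t i, of \<theta>] \<theta> by simp
    have "Re (H t y * cis \<theta>) = Re (F t y * (\<i> * cis \<theta>))"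
      using H_bd[OF t i, of \<theta>] F[OF t] yK E[OF t] \<theta> unfolding complex_gradient_def by metis
    then have "Re ((y - c t i) * H t y) = r t i * Re (F t y * (\<i> * cis \<theta>))" unfolding m by simp
    also have "\<dots> = Re ((y - c t i) * (\<i> * F t y))" unfolding m by (simp only: mult_ac)
    finally show "Re ((y - c t i) * H t y) = Re (\<i> * ((y - c t i) * F t y))" by (simp only: mult_ac)
  qed

  have "\<exists>M F'. \<forall>t\<in>?T. F' t holomorphic_on ?D t (d / 2 / 2) \<and>
    (\<forall>y\<in>?K t 0. F' t y = F t y) \<and> (\<forall>y\<in>?D t (d / 2 / 2). cmod (F' t y) \<le> M)"
  proof (rule uniform_extension[OF compact_Icc cfg cont_c cont_r, where f = \<phi>
        and h = "\<lambda>t i y. of_real (r t i * ?rdot t i) / (y - c t i)" and B = "K / (d / 2)"])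
    fix t i assume t: "t \<in> ?T" and i: "i \<le> n"
    interpret circular_config n "c t" "r t" d by (rule cfg[OF t])
    have far: "d / 2 \<le> cmod (y - c t i)" if "\<bar>gap (c t) (r t) i y\<bar> < d / 2" for y
    proof -
      have "\<bar>cmod (y - c t i) - r t i\<bar> < d / 2" using that by (simp add: gap_side abs_mult)
      then show ?thesis using radius_ge[OF i] by linarith
    qed
    then show "(\<lambda>y. of_real (r t i * ?rdot t i) / (y - c t i)) holomorphic_on {y. \<bar>gap (c t) (r t) i y\<bar> < d / 2}"
      using d by (intro holomorphic_intros) fastforce
    show "cmod (of_real (r t i * ?rdot t i) / (y - c t i)) \<le> K / (d / 2)"
      if "\<bar>gap (c t) (r t) i y\<bar> < d / 2" for y
      unfolding norm_divide norm_of_real using far[OF that] K[OF t i] d by (intro frac_le) auto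
    show "Re ((y - c t i) * (F t y - of_real (r t i * ?rdot t i) / (y - c t i))) = 0"
      if y: "gap (c t) (r t) i y = 0" for y
    proof -
      have "y - c t i \<noteq> 0" using far[of y] y d by auto
      then have "(y - c t i) * (F t y - of_real (r t i * ?rdot t i) / (y - c t i)) = (y - c t i) * F t y - of_real (r t i * ?rdot t i)"
        by (simp add: right_diff_distrib)
      then show ?thesis using bcF[OF t i y] by (simp only: minus_complex.simps Re_complex_of_real)
    qed
  qed (use d F in \<open>auto simp: complex_gradient_def\<close>)
  moreover have "d / 2 / 2 = d / 4" by simp
  ultimately obtain M F' where "\<forall>t\<in>?T. F' t holomorphic_on ?D t (d / 4) \<and>
    (\<forall>y\<in>?K t 0. F' t y = F t y) \<and> (\<forall>y\<in>?D t (d / 4). cmod (F' t y) \<le> M)"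
    by metis
  then have F': "\<And>t. t \<in> ?T \<Longrightarrow> F' t holomorphic_on ?D t (d / 4)"
    "\<And>t y. t \<in> ?T \<Longrightarrow> y \<in> ?K t 0 \<Longrightarrow> F' t y = F t y"
    "\<And>t y. t \<in> ?T \<Longrightarrow> y \<in> ?D t (d / 4) \<Longrightarrow> cmod (F' t y) \<le> M"
    by blast+
  \<comment> \<open>The extension of the first gradient serves as inhomogeneity for the second one, in the smaller annuli where it is defined.\<close>
  have "\<exists>M H'. \<forall>t\<in>?T. H' t holomorphic_on ?D t (d / 4 / 2) \<and>
    (\<forall>y\<in>?K t 0. H' t y = H t y) \<and> (\<forall>y\<in>?D t (d / 4 / 2). cmod (H' t y) \<le> M)"
  proof (rule uniform_extension[OF compact_Icc cfg cont_c cont_r, where f = \<phi>'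
        and h = "\<lambda>t i y. \<i> * F' t y" and B = M])
    fix t i assume t: "t \<in> ?T" and i: "i \<le> n"
    interpret circular_config n "c t" "r t" d by (rule cfg[OF t])
    have sub: "{y. \<bar>gap (c t) (r t) i y\<bar> < d / 4} \<subseteq> ?D t (d / 4)"
      using near_circle_collar[OF i, of "d / 4"] d by (auto simp: abs_less_iff)
    show "(\<lambda>y. \<i> * F' t y) holomorphic_on {y. \<bar>gap (c t) (r t) i y\<bar> < d / 4}"
      by (intro holomorphic_intros holomorphic_on_subset[OF F'(1)[OF t] sub])
    show "cmod (\<i> * F' t y) \<le> M" if "\<bar>gap (c t) (r t) i y\<bar> < d / 4" for y
      using F'(3)[OF t, of y] sub that by (auto simp: norm_mult)
    show "Re ((y - c t i) * (H t y - \<i> * F' t y)) = 0" if y: "gap (c t) (r t) i y = 0" for y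
    proof -
      have "(y - c t i) * (H t y - \<i> * F t y) = (y - c t i) * H t y - \<i> * ((y - c t i) * F t y)"
        by (simp add: algebra_simps)
      then show ?thesis
        using bcH[OF t i y] F'(2)[OF t circle_point_in_closed_collar[OF i y]] by (simp only: minus_complex.simps)
    qed
  qed (use d H in \<open>auto simp: complex_gradient_def\<close>)
  moreover have "d / 4 / 2 = d / 8" by simp
  ultimately obtain N H' where "\<forall>t\<in>?T. H' t holomorphic_on ?D t (d / 8) \<and>
    (\<forall>y\<in>?K t 0. H' t y = H t y) \<and> (\<forall>y\<in>?D t (d / 8). cmod (H' t y) \<le> N)"
    by metis
  then have H': "\<And>t. t \<in> ?T \<Longrightarrow> H' t holomorphic_on ?D t (d / 8)"
    "\<And>t y. t \<in> ?T \<Longrightarrow> y \<in> ?K t 0 \<Longrightarrow> H' t y = H t y"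
    "\<And>t y. t \<in> ?T \<Longrightarrow> y \<in> ?D t (d / 8) \<Longrightarrow> cmod (H' t y) \<le> N"
    by blast+

  obtain D where D0: "D 0 = \<zeta>"
    and D: "\<And>k x. 0 \<le> x \<Longrightarrow> (D k has_real_derivative D (Suc k) x) (at x within {0..})"
    using assms(14) unfolding smooth_within_def by auto
  have D10: "D 1 0 = 0"
    using has_field_derivative_unique[OF D[of 0 0, unfolded D0] assms(17)] by (simp add: at_within_Ici_at_right)
  obtain Z where Z: "\<And>k x. k \<le> 2 \<Longrightarrow> 0 \<le> x \<Longrightarrow> x \<le> 2 \<Longrightarrow> \<bar>D k x\<bar> \<le> Z"
    using smooth_within_derivatives_bounded[where D = D, OF D] by blast
  define C0 where "C0 = N * (lam * R0) * (10 * 2 ^ n)"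
  define B where "B = M / (d / 4 / 2) + (N / (d / 8 / 2) + \<bar>stream_const d (2 * (lam * R0)) C0 N (N / (d / 8 / 2)) Z\<bar>)"

  have stream: "stream_config n (c t) (r t) d (\<phi>' t) (H' t) (d / 8) \<zeta> D" if t: "t \<in> ?T" for t
  proof -
    interpret circular_config n "c t" "r t" d by (rule cfg[OF t])
    have EK: "?D t 0 \<subseteq> ?K t 0" by (rule collar_subset_closed_collar) simp
    show ?thesis
    proof
      show "potential_on (?D t 0) (\<phi>' t) (H' t)"
        using H[OF t] H'(2)[OF t] EK unfolding complex_gradient_def potential_on_def by (metis subsetD)
      show "continuous_on (?K t 0) (\<phi>' t)" using H[OF t] by (simp add: complex_gradient_def)
    qed (use d H'(1)[OF t] D0 D assms(18) in auto)
  qed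
  have v_eq: "(\<lambda>x. v x t) = (\<lambda>y. grad (\<phi> t) y + perp_grad (\<psi> t) y)" for t
    by (simp add: v_def fun_eq_iff)

  have main: "(\<exists>A. deriv_bounded (\<lambda>x. v x t) y A B) \<and> divergence (\<lambda>x. v x t) y = 0" if t: "t \<in> ?T" and y: "y \<in> ?D t 0" for t y
  proof -
    interpret S: stream_config n "c t" "r t" d "\<phi>' t" "H' t" "d / 8" \<zeta> D by (rule stream[OF t])
    have KD: "?K t 0 \<subseteq> ?D t (d / 4)" "?K t 0 \<subseteq> ?D t (d / 8)"
      using d by (intro closed_collar_subset_collar; simp)+
    have EK: "?D t 0 \<subseteq> ?K t 0" by (rule collar_subset_closed_collar) simp
    have yK: "y \<in> ?K t 0" using y EK by blast
    have N0: "0 \<le> N" using H'(3)[OF t, of y] yK KD by (auto intro: order_trans[OF norm_ge_zero])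
    have C0: "\<bar>\<phi>' t x\<bar> \<le> C0" if "x \<in> ?K t 0" for x
    proof -
      have "\<bar>\<phi>' t x\<bar> \<le> N * r t 0 * (10 * 2 ^ n)"
      proof (rule S.mean_zero_bound[OF S.pot S.contf _ _ that])
        show "(\<phi>' t has_integral 0) (?D t 0)" using H[OF t] by (simp add: complex_gradient_def)
        show "cmod (H' t x) \<le> N" if "x \<in> ?D t 0" for x using H'(3)[OF t, of x] that EK KD by blast
      qed
      also have "\<dots> \<le> C0"
        unfolding C0_def using r0[OF t] N0 by (intro mult_right_mono mult_left_mono) auto
      finally show ?thesis .
    qed
    obtain A where A: "deriv_bounded (grad (\<psi> t)) y A
        (N / (d / 8 / 2) + \<bar>stream_const d (2 * (lam * R0)) C0 N (N / (d / 8 / 2)) Z\<bar>)"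
    proof -
      have "\<exists>A. deriv_bounded (grad (\<psi> t)) y A
        (N / (d / 8 / 2) + \<bar>stream_const d (2 * (lam * R0)) C0 N (N / (d / 8 / 2)) Z\<bar>)"
        unfolding \<psi>_def
      proof (rule S.grad_stream_deriv_bounded[OF y _ C0 _ _ Z])
        show "2 * r t 0 \<le> 2 * (lam * R0)" using r0[OF t] by simp
        show "cmod (H' t x) \<le> N" if "x \<in> ?K t 0" for x using H'(3)[OF t, of x] that KD by blast
        show "cmod (deriv (H' t) x) \<le> N / (d / 8 / 2)" if "x \<in> ?K t 0" for x
          using d by (intro S.deriv_bound_closed[OF _ H'(1)[OF t] H'(3)[OF t] that]) auto
      qed auto
      then show ?thesis using that by blast
    qed
    have "deriv_bounded (\<lambda>x. - \<i> * grad (\<psi> t) x) y (1 * A) (1 * (N / (d / 8 / 2) + \<bar>stream_const d (2 * (lam * R0)) C0 N (N / (d / 8 / 2)) Z\<bar>))"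
      by (rule deriv_bounded_linear[OF A bounded_linear_mult_right]) (simp_all add: norm_mult)
    then have dp: "deriv_bounded (perp_grad (\<psi> t)) y A (N / (d / 8 / 2) + \<bar>stream_const d (2 * (lam * R0)) C0 N (N / (d / 8 / 2)) Z\<bar>)"
      unfolding perp_grad_eq[abs_def] by simp
    have "deriv_bounded (\<lambda>x. cnj (F' t x)) y M (M / (d / 4 / 2))"
    proof (intro deriv_bounded_cnj deriv_bounded_field)
      show "(F' t has_field_derivative deriv (F' t) y) (at y)"
        using yK KD by (intro holomorphic_derivI[OF F'(1)[OF t] open_collar]) auto
      show "cmod (F' t y) \<le> M" using F'(3)[OF t] yK KD by blast
      show "cmod (deriv (F' t) y) \<le> M / (d / 4 / 2)"
        using d by (intro S.deriv_bound_closed[OF _ F'(1)[OF t] F'(3)[OF t] yK]) auto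
    qed
    then have dg: "deriv_bounded (grad (\<phi> t)) y M (M / (d / 4 / 2))"
    proof (rule deriv_bounded_transform[OF _ open_collar y])
      show "cnj (F' t x) = grad (\<phi> t) x" if "x \<in> ?D t 0" for x
        using F[OF t] F'(2)[OF t, of x] that EK unfolding complex_gradient_def by auto
    qed
    have 1: "deriv_bounded (\<lambda>x. v x t) y (M + A) B"
      unfolding v_eq B_def by (rule deriv_bounded_add[OF dg dp])
    obtain g' where g': "(grad (\<phi> t) has_derivative g') (at y)" using dg unfolding deriv_bounded_def by blast
    obtain p' where p': "(perp_grad (\<psi> t) has_derivative p') (at y)" using dp unfolding deriv_bounded_def by blast
    obtain q' where q': "(grad (\<psi> t) has_derivative q') (at y)" using A unfolding deriv_bounded_def by blast
    have "divergence (grad (\<phi> t)) y = 0"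
      using assms(19)[OF t] y S.domain_eq_collar unfolding neumann_solution_def Let_def laplacian_def by auto
    moreover have "divergence (perp_grad (\<psi> t)) y = 0"
      unfolding \<psi>_def by (rule divergence_perp_grad[OF open_collar y S.stream_fun_differentiable q'[unfolded \<psi>_def]])
    ultimately have "divergence (\<lambda>x. v x t) y = 0"
      unfolding divergence_def v_eq frechet_derivative_at[OF g', symmetric] frechet_derivative_at[OF p', symmetric]
        frechet_derivative_at[OF has_derivative_add[OF g' p'], symmetric] by simp
    with 1 show ?thesis by blast
  qed
  have div: "\<forall>t\<in>?T. \<forall>y\<in>E t. (\<lambda>x. v x t) differentiable (at y) \<and> divergence (\<lambda>x. v x t) y = 0"
    using main E deriv_bounded_onorm(1) by metis

  have bdry: "\<forall>t\<in>?T. \<forall>i\<in>{1..n}. \<forall>\<theta>\<in>{0..2 * pi}.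
      ((\<lambda>x. v x t) \<longlongrightarrow> of_real (?rdot t i) * cis \<theta>) (at (z i t + of_real (r t i) * cis \<theta>) within E t)"
  proof (intro ballI)
    fix t i \<theta> assume t: "t \<in> ?T" and i1: "i \<in> {1..n}"
    interpret S: stream_config n "c t" "r t" d "\<phi>' t" "H' t" "d / 8" \<zeta> D by (rule stream[OF t])
    have i: "i \<le> n" using i1 by simp
    let ?Y = "c t i + of_real (r t i) * cis \<theta>"
    have Y: "gap (c t) (r t) i ?Y = 0" by (rule S.gap_polar[OF i])
    have "((\<lambda>y. grad (\<phi> t) y + perp_grad (\<psi> t) y) \<longlongrightarrow> of_real (r t i * ?rdot t i) / cnj (?Y - c t i)) (at ?Y within ?D t 0)"
      unfolding \<psi>_def
    proof (rule S.velocity_boundary_limit[OF i Y assms(16) D10, where G = "F t"])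
      show "Re ((?Y - c t i) * H' t ?Y) = Re (\<i> * ((?Y - c t i) * F t ?Y))"
        using bcH[OF t i Y] H'(2)[OF t S.circle_point_in_closed_collar[OF i Y]] by simp
    qed (use F[OF t] bcF[OF t i Y] in \<open>auto simp: complex_gradient_def\<close>)
    moreover have "of_real (r t i * ?rdot t i) / cnj (?Y - c t i) = of_real (?rdot t i) * cis \<theta>"
    proof -
      have "cnj (cis \<theta>) * cis \<theta> = 1" by (simp add: cis_cnj cis_mult)
      then have "inverse (cnj (cis \<theta>)) = cis \<theta>" by (rule inverse_unique)
      then have "x / cnj (cis \<theta>) = x * cis \<theta>" for x by (simp only: divide_inverse)
      moreover have "r t i \<noteq> 0" using S.radius_pos[OF i] by simp
      ultimately show ?thesis by simp
    qed
    ultimately show "((\<lambda>x. v x t) \<longlongrightarrow> of_real (?rdot t i) * cis \<theta>) (at (z i t + of_real (r t i) * cis \<theta>) within E t)"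
      unfolding v_eq E[OF t] cz[OF i1, symmetric] by simp
  qed

  have "(SUP t\<in>?T. esssup (lebesgue_on (E t)) (\<lambda>y. ereal (onorm (frechet_derivative (\<lambda>x. v x t) (at y))))) \<le> ereal B"
  proof (rule SUP_least)
    fix t assume t: "t \<in> ?T"
    have oE: "open (E t)" using E[OF t] open_collar by simp
    show "esssup (lebesgue_on (E t)) (\<lambda>y. ereal (onorm (frechet_derivative (\<lambda>x. v x t) (at y)))) \<le> ereal B"
    proof (rule esssup_I)
      have "(\<lambda>y. onorm (frechet_derivative (\<lambda>x. v x t) (at y))) \<in> borel_measurable (lebesgue_on (E t))"
        using div t by (intro measurable_onorm_frechet_derivative[OF oE]) blast
      then show "(\<lambda>y. ereal (onorm (frechet_derivative (\<lambda>x. v x t) (at y)))) \<in> borel_measurable (lebesgue_on (E t))"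
        by (rule borel_measurable_ereal)
      show "AE y in lebesgue_on (E t). ereal (onorm (frechet_derivative (\<lambda>x. v x t) (at y))) \<le> ereal B"
      proof (rule AE_I2)
        fix y assume "y \<in> space (lebesgue_on (E t))"
        then have "y \<in> ?D t 0" using E[OF t] by (simp add: space_restrict_space)
        then obtain A where "deriv_bounded (\<lambda>x. v x t) y A B" using main[OF t] by blast
        then show "ereal (onorm (frechet_derivative (\<lambda>x. v x t) (at y))) \<le> ereal B"
          using deriv_bounded_onorm(2) by simp
      qed
    qed
  qed
  also have "ereal B < \<infinity>" by simp
  finally show ?thesis using div bdry by blast
qed

end
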